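(* Let $f:\mathbb{C}\to\mathbb{P}^n$ be a holomorphic curve with hyper-order $\varsigma(f)<1$, and let $c\in\mathbb{C}$. If $2n+1$ hyperplanes in general position in $\mathbb{P}^n$ have forward invariant preimages under $f$ with respect to the translation $\tau(z)=z+c$, then $f$ is periodic with period $c$, i.e. $f(z+c)=f(z)$ in $\mathbb{P}^n$ for all $z\in\mathbb{C}$.
   Context: $\mathbb{P}^n$ is complex projective $n$-space. A holomorphic curve $f:\mathbb{C}\to\mathbb{P}^n$ is written in a reduced representation $f=[f_0:\cdots:f_n]$, i.e. $f_0,\ldots,f_n$ are entire functions without common zeros. The Cartan characteristic function is $T_f(r)=\int_0^{2\pi}u(re^{i\theta})\frac{d\theta}{2\pi}-u(0)$ with $u(z)=\sup_{k\in\{0,\ldots,n\}}\log|f_k(z)|$ (independent of the reduced representation), and the hyper-order of $f$ is $\varsigma(f)=\limsup_{r\to\infty}\frac{\log^+\log^+T_f(r)}{\log r}$, where $\log^+x=\max\{0,\log x\}$ (with $\log^+0=0$). A hyperplane $H\subset\mathbb{P}^n$ is the set of $[x_0:\cdots:x_n]$ with $\alpha_0x_0+\cdots+\alpha_nx_n=0$, where $\alpha_j\in\mathbb{C}$ are not all zero. Hyperplanes with coefficient vectors $\alpha_k=(\alpha_{0,k},\ldots,\alpha_{n,k})$ ($k=0,\ldots,m$, $m\ge n$) are in general position if any $n+1$ of the vectors $\alpha_k$ are linearly independent over $\mathbb{C}$. The preimage of $H$ under $f$ is forward invariant with respect to $\tau(z)=z+c$ if $\tau(f^{-1}(\{H\}))\subset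 f^{-1}(\{H\})$ as multisets, points being repeated according to multiplicity; i.e., with $\varphi=\alpha_0f_0+\cdots+\alpha_nf_n$, whenever $\varphi$ has a zero of multiplicity $i>0$ at $z_0$, the function $\varphi(z+c)$ has a zero of multiplicity at least $i$ at $z_0$. An empty preimage is forward invariant. *)

theory Defs
  imports "HOL-Complex_Analysis.Complex_Analysis" "HOL-Library.Extended_Nat"
begin

text \<open>
  A vector of \<open>\<complex>\<^sup>n\<^sup>+\<^sup>1\<close> is a function \<^typ>\<open>nat \<Rightarrow> complex\<close> of which only the entries
  with index \<open>\<le> n\<close> are ever read.
\<close>

subsection \<open>Projective space and holomorphic curves\<close>

text \<open>
  \<open>proj_point n x\<close> is \<open>[x\<^sub>0 : \<dots> : x\<^sub>n]\<close>.  Entries with index \<open>> n\<close> are left unconstrained in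
  the class, so two classes are equal iff the first \<open>n + 1\<close> entries are proportional.
\<close>

definition proj_point :: "nat \<Rightarrow> (nat \<Rightarrow> complex) \<Rightarrow> (nat \<Rightarrow> complex) set" where
  "proj_point n x = {y. \<exists>l. l \<noteq> 0 \<and> (\<forall>j\<le>n. y j = l * x j)}"

definition reduced_representation ::
    "nat \<Rightarrow> (nat \<Rightarrow> complex \<Rightarrow> complex) \<Rightarrow> (complex \<Rightarrow> (nat \<Rightarrow> complex) set) \<Rightarrow> bool" where
  "reduced_representation n f F \<longleftrightarrow>
     (\<forall>j\<le>n. f j holomorphic_on UNIV) \<and>
     (\<nexists>z. \<forall>j\<le>n. f j z = 0) \<and>
     (\<forall>z. F z = proj_point n (\<lambda>j. f j z))"

subsection \<open>Cartan characteristic and hyper-order\<close>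

text \<open>
  The indices with \<open>f j z = 0\<close>, for which \<open>log \<bar>f j z\<bar> = -\<infinity>\<close>, do not contribute to the
  supremum; they have to be left out explicitly because \<open>ln 0 = 0\<close> in the library.
\<close>

definition log_max :: "nat \<Rightarrow> (nat \<Rightarrow> complex \<Rightarrow> complex) \<Rightarrow> complex \<Rightarrow> real" where
  "log_max n f z = Max ((\<lambda>j. ln (norm (f j z))) ` {j. j \<le> n \<and> f j z \<noteq> 0})"

definition cartan_char :: "nat \<Rightarrow> (nat \<Rightarrow> complex \<Rightarrow> complex) \<Rightarrow> real \<Rightarrow> real" where
  "cartan_char n f r =
     integral {0..2*pi} (\<lambda>t. log_max n f (of_real r * cis t)) / (2 * pi) - log_max n f 0"

definition log_plus :: "real \<Rightarrow> real" where
  "log_plus x = (if x > 0 then max 0 (ln x) else 0)"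

definition hyper_order :: "nat \<Rightarrow> (nat \<Rightarrow> complex \<Rightarrow> complex) \<Rightarrow> ereal" where
  "hyper_order n f =
     Limsup at_top (\<lambda>r::real. ereal (log_plus (log_plus (cartan_char n f r)) / ln r))"

subsection \<open>Hyperplanes and forward invariant preimages\<close>

text \<open>
  A hyperplane is given by its coefficient vector.  In a family \<open>a\<close> of hyperplanes,
  \<open>a k\<close> is the coefficient vector of the \<open>k\<close>-th one.
\<close>

definition lin_form :: "nat \<Rightarrow> (nat \<Rightarrow> complex) \<Rightarrow> (nat \<Rightarrow> complex) \<Rightarrow> complex" where
  "lin_form n \<alpha> x = (\<Sum>j\<le>n. \<alpha> j * x j)"

definition lin_indep_family :: "nat \<Rightarrow> nat set \<Rightarrow> (nat \<Rightarrow> nat \<Rightarrow> complex) \<Rightarrow> bool" where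
  "lin_indep_family n S a \<longleftrightarrow>
     (\<forall>b::nat \<Rightarrow> complex. (\<forall>j\<le>n. (\<Sum>k\<in>S. b k * a k j) = 0) \<longrightarrow> (\<forall>k\<in>S. b k = 0))"

definition general_position :: "nat \<Rightarrow> nat \<Rightarrow> (nat \<Rightarrow> nat \<Rightarrow> complex) \<Rightarrow> bool" where
  "general_position n m a \<longleftrightarrow>
     n \<le> m \<and> (\<forall>S\<subseteq>{0..m}. card S = n + 1 \<longrightarrow> lin_indep_family n S a)"

text \<open>
  The multiplicity of the zero of an entire function at a point: \<open>0\<close> if the function does not
  vanish there, \<open>\<infinity>\<close> if it vanishes identically (then \<^const>\<open>zorder\<close> is meaningless).
\<close>

definition zero_mult :: "(complex \<Rightarrow> complex) \<Rightarrow> complex \<Rightarrow> enat" where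
  "zero_mult g z =
     (if \<forall>w. g w = 0 then \<infinity>
      else if g z \<noteq> 0 then 0
      else enat (nat (zorder g z)))"

definition forward_invariant_preimage ::
    "nat \<Rightarrow> (nat \<Rightarrow> complex \<Rightarrow> complex) \<Rightarrow> complex \<Rightarrow> (nat \<Rightarrow> complex) \<Rightarrow> bool" where
  "forward_invariant_preimage n f c \<alpha> \<longleftrightarrow>
     (let \<phi> = (\<lambda>z. lin_form n \<alpha> (\<lambda>j. f j z))
      in \<forall>z0. zero_mult \<phi> z0 > 0 \<longrightarrow> zero_mult (\<lambda>z. \<phi> (z + c)) z0 \<ge> zero_mult \<phi> z0)"

end

theory Submission
  imports Defs "Jordan_Normal_Form.Determinant" "HOL-Real_Asymp.Real_Asymp"
begin

text \<open>
  Let \<open>\<phi>\<^sub>k\<close> be the composition of \<open>f\<close> with the \<open>k\<close>-th linear form.  Forward invariance says that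
  \<open>\<phi>\<^sub>k(z + c) = h\<^sub>k(z) \<phi>\<^sub>k(z)\<close> with \<open>h\<^sub>k\<close> entire, and it suffices that all \<open>h\<^sub>k\<close> coincide.  A linear
  relation \<open>\<Sum> \<beta>\<^sub>k \<phi>\<^sub>k = 0\<close> gives, by iterating the shift, entire solutions \<open>v\<close> of
  \<open>\<Sum> v\<^sub>k(z) H\<^sub>k\<^sub>,\<^sub>i(z) = 0\<close> for all \<open>i\<close>, where \<open>H\<^sub>k\<^sub>,\<^sub>i(z) = \<Prod>\<^sub>l\<^sub><\<^sub>i h\<^sub>k(z + l c)\<close>.  A solution of
  minimal support is unique up to a factor, so its component ratios satisfy a first order difference
  equation with coefficient \<open>h\<^sub>j / h\<^sub>k\<close>.  Cramer's rule bounds the characteristic \<open>\<tau>(r)\<close> of these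
  solutions by proximity terms of \<open>H\<^sub>j\<^sub>,\<^sub>i / H\<^sub>k\<^sub>,\<^sub>i\<close> and counting terms of \<open>h\<^sub>k\<close>.  The former are small by
  the lemma on the logarithmic difference, the latter because a zero of \<open>h\<^sub>k\<close> forces zeros of the
  solutions at arbitrarily many shifted points.  Thus \<open>\<tau>(r) \<le> C + \<tau>(R) / 4\<close> for \<open>R\<close> slightly larger
  than \<open>r\<close>, which for hyper-order less than one forces \<open>\<tau>\<close> to be bounded; then the ratios are
  constant and \<open>h\<^sub>j = h\<^sub>k\<close>.
\<close>

section \<open>Entire functions\<close>

text \<open>Estimates relative to the characteristic of the curve would be too weak as well, since
  the ratios of the components of a minimal solution can grow much more slowly than f. Hence every
  error is measured against \<open>\<tau>\<close> itself, and the growth of the curve enters only as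
  an a priori bound that ends the iteration. One step of it lengthens the radius by about
  r^\<delta>: long enough to beat the logarithm in the lemma on the logarithmic difference, short
  enough for \<rho> + \<delta> < 1, which is possible because hyper-order below one gives \<rho> <
  1. The number 2n + 1 is used twice: at each point at most n of the forms vanish, so that n + 1
  spanning ones remain, and two disjoint classes of forms cannot both have more than n members. All
  radii avoid the zeros of countably many functions, so that only continuous functions are
  averaged.\<close>

definition entire :: "(complex \<Rightarrow> complex) \<Rightarrow> bool" where
  "entire f \<longleftrightarrow> f holomorphic_on UNIV"

definition nonzero :: "(complex \<Rightarrow> complex) \<Rightarrow> bool" where
  "nonzero f \<longleftrightarrow> (\<exists>z. f z \<noteq> 0)"

lemma entire_intros [intro, simp]:
  "entire (\<lambda>z. k)" "entire (\<lambda>z. z)"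
  "entire f \<Longrightarrow> entire g \<Longrightarrow> entire (\<lambda>z. f z * g z)"
  "entire f \<Longrightarrow> entire g \<Longrightarrow> entire (\<lambda>z. f z + g z)"
  "entire f \<Longrightarrow> entire g \<Longrightarrow> entire (\<lambda>z. f z - g z)"
  "entire f \<Longrightarrow> entire (\<lambda>z. - f z)"
  "entire f \<Longrightarrow> entire (\<lambda>z. f z ^ n)"
  unfolding entire_def by (auto intro!: holomorphic_intros)

lemma entire_sum [intro]: "(\<And>k. k \<in> A \<Longrightarrow> entire (f k)) \<Longrightarrow> entire (\<lambda>z. \<Sum>k\<in>A. f k z)"
  unfolding entire_def by (auto intro!: holomorphic_intros)

lemma entire_prod [intro]: "(\<And>k. k \<in> A \<Longrightarrow> entire (f k)) \<Longrightarrow> entire (\<lambda>z. \<Prod>k\<in>A. f k z)"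
  unfolding entire_def by (auto intro!: holomorphic_intros)

lemma entire_shift [intro, simp]: "entire f \<Longrightarrow> entire (\<lambda>z. f (z + b))"
  unfolding entire_def
  by (rule holomorphic_on_compose_gen[of _ _ f UNIV, unfolded o_def]) (auto intro!: holomorphic_intros)

lemma entire_shift_diff [intro, simp]: "entire f \<Longrightarrow> entire (\<lambda>z. f (z - b))"
  using entire_shift[of f "- b"] by simp

lemma entire_continuous_on: 
  assumes "entire f" "continuous_on S g" shows "continuous_on S (\<lambda>x. f (g x))"
proof -
  have "continuous_on UNIV f"
    using assms(1) by (auto simp: entire_def intro: holomorphic_on_imp_continuous_on)
  then show ?thesis
    using assms(2) by (rule continuous_on_compose2) auto
qed

lemma entire_isCont: "entire f \<Longrightarrow> isCont f z"
  using entire_continuous_on[of f UNIV id] by (auto simp: continuous_on_eq_continuous_at id_def)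

lemma nonzero_shift [simp]: "nonzero (\<lambda>z. f (z + b)) \<longleftrightarrow> nonzero f"
  unfolding nonzero_def by (metis add.commute add_diff_cancel_left' diff_add_cancel)

lemma nonzero_shift_diff [simp]: "nonzero (\<lambda>z. f (z - b)) \<longleftrightarrow> nonzero f"
  using nonzero_shift[of f "- b"] by simp

lemma entire_eventually_nz:
  assumes "entire f" "nonzero f"
  shows "eventually (\<lambda>w. f w \<noteq> 0) (at z)"
proof -
  obtain b where b: "f b \<noteq> 0" using assms(2) unfolding nonzero_def by blast
  have "eventually (\<lambda>w. f w \<noteq> 0 \<and> w \<in> UNIV) (at z)"
    by (rule non_zero_neighbour_alt[of f UNIV z b]) (use assms b in \<open>auto simp: entire_def\<close>)
  then show ?thesis by simp
qed

text \<open>The zeros of each factor are isolated, so both are nonzero at some point near 0: entire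
  functions form an integral domain, on which all later cancellations rest.\<close>

lemma nonzero_mult:
  assumes "entire f" "nonzero f" "entire g" "nonzero g"
  shows "nonzero (\<lambda>z. f z * g z)"
proof -
  have "eventually (\<lambda>w. f w \<noteq> 0 \<and> g w \<noteq> 0) (at 0)"
    using entire_eventually_nz[OF assms(1,2)] entire_eventually_nz[OF assms(3,4)]
    by (rule eventually_conj)
  then obtain w where "f w \<noteq> 0 \<and> g w \<noteq> 0"
    using eventually_happens[of _ "at (0::complex)"] by auto
  then show ?thesis unfolding nonzero_def by auto
qed

lemma entire_mult_eq_0:
  assumes "entire f" "entire g" "nonzero g" "\<And>z. f z * g z = 0"
  shows "f z = 0"
  using nonzero_mult[OF assms(1) _ assms(2,3)] assms(4) unfolding nonzero_def by auto

lemma entire_mult_cancel: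
  assumes "entire f" "entire g" "entire h" "nonzero h" "\<And>z. f z * h z = g z * h z"
  shows "f z = g z"
proof -
  have "f z - g z = 0"
    by (rule entire_mult_eq_0[where f = "\<lambda>z. f z - g z" and g = h]) (use assms in \<open>auto simp: algebra_simps\<close>)
  then show ?thesis by simp
qed

lemma nonzero_prod:
  assumes "\<And>k. k \<in> A \<Longrightarrow> entire (f k)" "\<And>k. k \<in> A \<Longrightarrow> nonzero (f k)"
  shows "nonzero (\<lambda>z. \<Prod>k\<in>A. f k z)"
  using assms
proof (induction A rule: infinite_finite_induct)
  case (insert x F)
  have "nonzero (\<lambda>z. f x z * (\<Prod>k\<in>F. f k z))"
    by (rule nonzero_mult) (use insert in auto)
  then show ?case using insert by simp
qed (auto simp: nonzero_def)

section \<open>Zeros and divisibility of entire functions\<close>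

lemma countable_zeros_entire:
  assumes "entire f" "nonzero f"
  shows "countable {z. f z = 0}"
proof (cases "f constant_on UNIV")
  case True
  then show ?thesis using assms(2) by (auto simp: constant_on_def nonzero_def)
next
  case False
  have "countable {z\<in>UNIV. f z = 0}"
    by (rule holomorphic_countable_zeros) (use assms False in \<open>auto simp: entire_def \<close>)
  then show ?thesis by simp
qed

lemma finite_zeros_cball:
  assumes "entire f" "nonzero f"
  shows "finite {z \<in> cball 0 R. f z = 0}"
proof (cases "f constant_on UNIV")
  case True
  then show ?thesis using assms(2) by (auto simp: constant_on_def nonzero_def)
next
  case False
  have "finite {z \<in> cball 0 R. f z = 0}"
    by (rule holomorphic_compact_finite_zeros[of f UNIV]) (use assms False in \<open>auto simp: entire_def\<close>)
  then show ?thesis by simp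
qed

text \<open>Local divisibility is enough: a continuous local quotient gives F / G a limit at every
  point, so all singularities are removable. Most later divisibility claims exhibit, at a given
  point, a formula for the quotient whose denominator does not vanish there.\<close>

lemma entire_divides:
  assumes F: "entire F" and G: "entire G" "nonzero G"
    and loc: "\<And>z. \<exists>e. isCont e z \<and> eventually (\<lambda>w. F w = G w * e w) (at z)"
  obtains E where "entire E" "\<And>z. F z = G z * E z"
proof -
  define E where "E = remove_sings (\<lambda>z. F z / G z)"
  have lim: "\<exists>e. (\<lambda>z. F z / G z) \<midarrow>z\<rightarrow> e" for z
  proof -
    obtain e where e: "isCont e z" "eventually (\<lambda>w. F w = G w * e w) (at z)" using loc by blast
    have "eventually (\<lambda>w. F w / G w = e w) (at z)"
      using e(2) entire_eventually_nz[OF G] by eventually_elim auto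
    then have "(\<lambda>z. F z / G z) \<midarrow>z\<rightarrow> e z"
      using e(1) by (subst tendsto_cong) (auto simp: isCont_def)
    then show ?thesis by blast
  qed
  have iso: "isolated_singularity_at (\<lambda>z. F z / G z) z" for z
    by (intro isolated_singularity_at_divide isolated_singularity_at_analytic not_essential_analytic)
       (use F G in \<open>auto simp: entire_def intro: holomorphic_on_imp_analytic_at\<close>)
  have an: "E analytic_on {z}" for z
    using lim[of z] iso[of z] unfolding E_def by (auto intro: remove_sings_analytic_at)
  then have ent: "entire E"
    unfolding entire_def by (metis UNIV_I analytic_imp_holomorphic analytic_on_analytic_at)
  \<comment> \<open>Off the isolated zeros of G the identity is clear; both sides are continuous, so
    it extends to z.\<close>
  have "F z = G z * E z" for z
  proof -
    have "eventually (\<lambda>w. F w = G w * E w) (at z)"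
      using eventually_remove_sings_eq_at[OF iso[of z]] entire_eventually_nz[OF G]
      by eventually_elim (auto simp: E_def)
    then have "F \<midarrow>z\<rightarrow> G z * E z"
      using entire_isCont[of "\<lambda>w. G w * E w" z] ent G by (subst tendsto_cong) (auto simp: isCont_def)
    moreover have "F \<midarrow>z\<rightarrow> F z" using entire_isCont[OF F] by (simp add: isCont_def)
    ultimately show ?thesis using LIM_unique by blast
  qed
  with ent that show thesis by blast
qed

text \<open>Weierstrass factorisation writes F / G as A / B without common zeros; the greatest
  common divisor is then G / B.\<close>

lemma entire_gcd2:
  assumes F: "entire F" and G: "entire G" "nonzero G"
  obtains P A B where "entire P" "entire A" "entire B" "nonzero P"
    "\<And>z. F z = P z * A z" "\<And>z. G z = P z * B z" "\<And>z. \<not> (A z = 0 \<and> B z = 0)"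
proof -
  let ?q = "\<lambda>z. F z / G z"
  have mer: "remove_sings ?q nicely_meromorphic_on UNIV"
    by (intro remove_sings_nicely_meromorphic meromorphic_intros)
       (use F G in \<open>auto simp: entire_def intro!: analytic_on_imp_meromorphic_on simp: analytic_on_open\<close>)
  obtain h f1 f2 where h: "h holomorphic_on UNIV" "f1 holomorphic_on UNIV" "f2 holomorphic_on UNIV"
    "\<forall>z. f1 z = 0 \<longleftrightarrow> \<not>is_pole (remove_sings ?q) z \<and> (remove_sings ?q) z = 0"
    "\<forall>z. f2 z = 0 \<longleftrightarrow> is_pole (remove_sings ?q) z"
    "\<forall>z. h z \<noteq> 0"
    "\<forall>z. (remove_sings ?q) z = h z * f1 z / f2 z"
    by (rule weierstrass_factorization_meromorphic_UNIV[OF mer]) blast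
  define A where "A = (\<lambda>z. h z * f1 z)"
  have A: "entire A" using h unfolding A_def entire_def by (auto intro!: holomorphic_intros)
  have f2: "entire f2" using h by (simp add: entire_def)
  have nc: "\<not> (A z = 0 \<and> f2 z = 0)" for z using h(4,5,6) by (auto simp: A_def)
  have iso: "isolated_singularity_at (\<lambda>z. F z / G z) z" for z
    by (intro isolated_singularity_at_divide isolated_singularity_at_analytic not_essential_analytic)
       (use F G in \<open>auto simp: entire_def intro: holomorphic_on_imp_analytic_at\<close>)
  have nes: "not_essential ?q z" for z
    by (intro not_essential_divide isolated_singularity_at_analytic not_essential_analytic)
       (use F G in \<open>auto simp: entire_def intro: holomorphic_on_imp_analytic_at\<close>)
  \<comment> \<open>f2 vanishes exactly at the poles of F / G, and there is none where G is
    nonzero.\<close>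
  have nf2: "nonzero f2"
  proof (rule ccontr)
    assume "\<not> nonzero f2"
    then have "\<And>z. is_pole (remove_sings ?q) z" using h(5) by (auto simp: nonzero_def)
    moreover obtain w where "G w \<noteq> 0" using G by (auto simp: nonzero_def)
    have "isCont ?q w" using \<open>G w \<noteq> 0\<close> F G by (intro continuous_intros entire_isCont) auto
    then have "\<not> is_pole ?q w" using not_tendsto_and_filterlim_at_infinity[of "at w" ?q] 
      by (auto simp: is_pole_def isCont_def)
    moreover have "is_pole (remove_sings ?q) w \<longleftrightarrow> is_pole ?q w"
      by (rule is_pole_cong) (use eventually_remove_sings_eq_at[OF iso] in auto)
    ultimately show False by auto
  qed
  have cross: "F z * f2 z = G z * A z" for z
  proof -
    have "eventually (\<lambda>w. F w * f2 w = G w * A w) (at 0)"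
      using eventually_remove_sings_eq_at[OF iso[of 0]] entire_eventually_nz[OF G] entire_eventually_nz[OF f2 nf2]
      by eventually_elim (use h(7) in \<open>auto simp: A_def divide_simps mult_ac\<close>)
    moreover have "eventually (\<lambda>w. F w * f2 w - G w * A w \<noteq> 0) (at 0)"
      if "nonzero (\<lambda>w. F w * f2 w - G w * A w)"
      by (rule entire_eventually_nz) (use F G A f2 that in auto)
    ultimately have "\<not> nonzero (\<lambda>w. F w * f2 w - G w * A w)"
      using eventually_happens[of "\<lambda>w. False" "at (0::complex)"]
      by (auto dest: eventually_conj)
    then show ?thesis by (auto simp: nonzero_def)
  qed
  \<comment> \<open>At a zero of f2 the numerator A is nonzero, and the cross relation gives the
    quotient G / f2 as F / A.\<close>
  have "\<exists>e. isCont e z \<and> eventually (\<lambda>w. G w = f2 w * e w) (at z)" for z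
  proof (cases "f2 z = 0")
    case False
    then have "isCont (\<lambda>w. G w / f2 w) z" using f2 G by (intro continuous_intros entire_isCont) auto
    moreover have "eventually (\<lambda>w. G w = f2 w * (G w / f2 w)) (at z)"
      using entire_eventually_nz[OF f2 nf2] by eventually_elim auto
    ultimately show ?thesis by blast
  next
    case True
    then have Az: "A z \<noteq> 0" using nc by blast
    then have "isCont (\<lambda>w. F w / A w) z" using A F by (intro continuous_intros entire_isCont) auto
    moreover have "eventually (\<lambda>w. G w = f2 w * (F w / A w)) (at z)"
    proof -
      have nA: "nonzero A" using Az by (auto simp: nonzero_def)
      show ?thesis using entire_eventually_nz[OF A nA, of z]
      proof eventually_elim
        case (elim w)
        then show ?case using cross[of w] by (simp add: field_simps)
      qed
    qed
    ultimately show ?thesis by blast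
  qed
  then obtain P where P: "entire P" "\<And>z. G z = f2 z * P z" by (rule entire_divides[OF G(1) f2 nf2]) blast
  have nP: "nonzero P" using G(2) P(2) by (auto simp: nonzero_def)
  have "F z = A z * P z" for z
  proof (rule entire_mult_cancel[where h = f2 and f = F and g = "\<lambda>z. A z * P z"])
    show "F z * f2 z = (A z * P z) * f2 z" for z using cross[of z] P(2)[of z] by (simp add: mult_ac)
  qed (use F A P f2 nf2 in auto)
  then show thesis using that[of P A f2] P A f2 nP nc by (simp add: mult.commute)
qed

text \<open>Two at a time, by induction. Dividing out the common zeros makes the logarithm of the
  total modulus of a family finite everywhere, as for a reduced representation.\<close>

lemma entire_gcd:
  assumes "finite D" "D \<noteq> {}" "\<And>k. k \<in> D \<Longrightarrow> entire (G k)" "\<And>k. k \<in> D \<Longrightarrow> nonzero (G k)"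
  shows "\<exists>P V. entire P \<and> nonzero P \<and> (\<forall>k\<in>D. entire (V k) \<and> (\<forall>z. G k z = P z * V k z)) \<and>
           (\<forall>z. \<exists>k\<in>D. V k z \<noteq> 0)"
  using assms
proof (induction D rule: finite_ne_induct)
  case (singleton x)
  then show ?case by (intro exI[of _ "G x"] exI[of _ "\<lambda>_ _. 1"]) auto
next
  case (insert x D)
  have "\<exists>P V. entire P \<and> nonzero P \<and> (\<forall>k\<in>D. entire (V k) \<and> (\<forall>z. G k z = P z * V k z)) \<and>
           (\<forall>z. \<exists>k\<in>D. V k z \<noteq> 0)"
    using insert.prems by (intro insert.IH) auto
  then obtain P V where PV: "entire P" "nonzero P" "\<And>k. k \<in> D \<Longrightarrow> entire (V k)"
    "\<And>k z. k \<in> D \<Longrightarrow> G k z = P z * V k z" "\<And>z. \<exists>k\<in>D. V k z \<noteq> 0" 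
    by blast
  obtain R A B where R: "entire R" "entire A" "entire B" "nonzero R"
    "\<And>z. P z = R z * A z" "\<And>z. G x z = R z * B z" "\<And>z. \<not> (A z = 0 \<and> B z = 0)"
    by (rule entire_gcd2[of P "G x"]) (use PV insert.prems in auto)
  show ?case
  proof (intro exI[of _ R] exI[of _ "\<lambda>k. if k = x then B else (\<lambda>z. A z * V k z)"] conjI ballI allI)
    show "\<exists>k\<in>insert x D. (if k = x then B else (\<lambda>z. A z * V k z)) z \<noteq> 0" for z
    proof (cases "B z = 0")
      case True
      then have "A z \<noteq> 0" using R(7) by blast
      moreover obtain k where "k \<in> D" "V k z \<noteq> 0" using PV(5) by blast
      ultimately show ?thesis using \<open>x \<notin> D\<close> by (intro bexI[of _ k]) auto
    qed auto
  qed (use R PV insert in auto)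
qed

section \<open>Circle means and the Poisson formula\<close>

definition circle_mean :: "real \<Rightarrow> (complex \<Rightarrow> real) \<Rightarrow> real" where
  "circle_mean r u = integral {0..2*pi} (\<lambda>t. u (of_real r * cis t)) / (2*pi)"

lemma circle_mean_integrable:
  fixes u :: "complex \<Rightarrow> real"
  assumes "continuous_on (sphere 0 r) u" "r \<ge> 0"
  shows "(\<lambda>t. u (of_real r * cis t)) integrable_on {0..2*pi}"
proof (rule integrable_continuous_interval)
  show "continuous_on {0..2*pi} (\<lambda>t. u (of_real r * cis t))"
    by (rule continuous_on_compose2[OF assms(1)]) (use assms(2) in \<open>auto intro!: continuous_intros simp: norm_mult\<close>)
qed

lemma circle_mean_add:
  assumes "continuous_on (sphere 0 r) u" "continuous_on (sphere 0 r) v" "r \<ge> 0"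
  shows "circle_mean r (\<lambda>z. u z + v z) = circle_mean r u + circle_mean r v"
  using circle_mean_integrable[OF assms(1,3)] circle_mean_integrable[OF assms(2,3)]
  by (simp add: circle_mean_def integral_add add_divide_distrib)

lemma circle_mean_diff:
  assumes "continuous_on (sphere 0 r) u" "continuous_on (sphere 0 r) v" "r \<ge> 0"
  shows "circle_mean r (\<lambda>z. u z - v z) = circle_mean r u - circle_mean r v"
  using circle_mean_integrable[OF assms(1,3)] circle_mean_integrable[OF assms(2,3)]
  by (simp add: circle_mean_def integral_diff diff_divide_distrib)

lemma circle_mean_cmult: "circle_mean r (\<lambda>z. k * u z) = k * circle_mean r u"
  unfolding circle_mean_def by simp

lemma circle_mean_const [simp]: "circle_mean r (\<lambda>z. k) = k"
  unfolding circle_mean_def by simp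

lemma circle_mean_sum:
  assumes "\<And>k. k \<in> A \<Longrightarrow> continuous_on (sphere 0 r) (u k)" "r \<ge> 0" 
  shows "circle_mean r (\<lambda>z. \<Sum>k\<in>A. u k z) = (\<Sum>k\<in>A. circle_mean r (u k))"
  using assms(1)
proof (induction A rule: infinite_finite_induct)
  case (insert x F)
  then show ?case using assms(2) 
    by (simp add: circle_mean_add continuous_on_sum)
qed auto

lemma circle_mean_mono:
  assumes "continuous_on (sphere 0 r) u" "continuous_on (sphere 0 r) v" "r \<ge> 0"
    "\<And>z. norm z = r \<Longrightarrow> u z \<le> v z"
  shows "circle_mean r u \<le> circle_mean r v"
proof -
  have "integral {0..2*pi} (\<lambda>t. u (of_real r * cis t)) \<le> integral {0..2*pi} (\<lambda>t. v (of_real r * cis t))"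
    by (rule integral_le[OF circle_mean_integrable[OF assms(1,3)] circle_mean_integrable[OF assms(2,3)]])
       (use assms(3,4) in \<open>simp add: norm_mult\<close>)
  then show ?thesis unfolding circle_mean_def by (simp add: divide_right_mono)
qed

lemma circle_mean_cong:
  assumes "r \<ge> 0" "\<And>z. norm z = r \<Longrightarrow> u z = v z"
  shows "circle_mean r u = circle_mean r v"
proof -
  have "integral {0..2*pi} (\<lambda>t. u (of_real r * cis t)) = integral {0..2*pi} (\<lambda>t. v (of_real r * cis t))"
    by (rule integral_cong) (use assms in \<open>simp add: norm_mult\<close>)
  then show ?thesis unfolding circle_mean_def by simp
qed

lemma circle_mean_abs_le:
  assumes "continuous_on (sphere 0 r) u" "r \<ge> 0"
  shows "\<bar>circle_mean r u\<bar> \<le> circle_mean r (\<lambda>z. \<bar>u z\<bar>)"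
proof -
  have "circle_mean r u \<le> circle_mean r (\<lambda>z. \<bar>u z\<bar>)"
    by (rule circle_mean_mono) (use assms in \<open>auto intro!: continuous_intros\<close>)
  moreover have "circle_mean r (\<lambda>z. (-1) * u z) \<le> circle_mean r (\<lambda>z. \<bar>u z\<bar>)"
    by (rule circle_mean_mono) (use assms in \<open>auto intro!: continuous_intros\<close>)
  ultimately show ?thesis unfolding circle_mean_cmult by linarith
qed

lemma continuous_on_circle_mean:
  assumes "continuous_on (S \<times> sphere 0 R) (\<lambda>(z,\<zeta>). k z \<zeta>)" "R \<ge> 0"
  shows "continuous_on S (\<lambda>z. circle_mean R (k z))"
proof -
  have "continuous_on (S \<times> cbox 0 (2*pi)) (\<lambda>(z,t). k z (of_real R * cis t))"
    unfolding case_prod_unfold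
    by (rule continuous_on_compose2[OF assms(1), of _ "\<lambda>p. (fst p, of_real R * cis (snd p))", unfolded case_prod_unfold fst_conv snd_conv])
       (use assms(2) in \<open>auto intro!: continuous_intros simp: norm_mult\<close>)
  from integral_continuous_on_param[OF this]
  show ?thesis unfolding circle_mean_def by (auto intro!: continuous_intros)
qed

lemma circle_mean_swap:
  assumes "continuous_on (sphere 0 r \<times> sphere 0 R) (\<lambda>(z,\<zeta>). k z \<zeta>)" "r \<ge> 0" "R \<ge> 0"
  shows "circle_mean r (\<lambda>z. circle_mean R (k z)) = circle_mean R (\<lambda>\<zeta>. circle_mean r (\<lambda>z. k z \<zeta>))"
proof -
  have "continuous_on (cbox (0,0) (2*pi,2*pi)) (\<lambda>(s,t). k (of_real r * cis s) (of_real R * cis t))"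
    unfolding case_prod_unfold
    by (rule continuous_on_compose2[OF assms(1), of _ "\<lambda>p. (of_real r * cis (fst p), of_real R * cis (snd p))", unfolded case_prod_unfold fst_conv snd_conv])
       (use assms(2,3) in \<open>auto intro!: continuous_intros simp: norm_mult\<close>)
  from integral_swap_continuous[OF this]
  show ?thesis unfolding circle_mean_def by simp
qed

section \<open>The Poisson kernel\<close>

text \<open>As the real part of a function holomorphic in w the kernel is visibly harmonic in w, so
  that the Poisson formula can be applied to the kernel itself; the classical quotient is
  \<open>poisson_kernel_eq\<close>.\<close>

definition poisson_kernel :: "complex \<Rightarrow> complex \<Rightarrow> real" where
  "poisson_kernel \<zeta> w = Re ((\<zeta> + w) / (\<zeta> - w))"

lemma poisson_kernel_eq:
  assumes "\<zeta> \<noteq> w"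
  shows "poisson_kernel \<zeta> w = ((norm \<zeta>)\<^sup>2 - (norm w)\<^sup>2) / (norm (\<zeta> - w))\<^sup>2"
proof -
  have "Re ((\<zeta> + w) * cnj (\<zeta> - w)) = (norm \<zeta>)\<^sup>2 - (norm w)\<^sup>2"
    unfolding cmod_power2 by (simp add: algebra_simps power2_eq_square)
  then show ?thesis
    unfolding poisson_kernel_def by (subst complex_div_cnj) (simp add: Re_divide_of_real)
qed

lemma continuous_on_poisson_kernel [continuous_intros]:
  assumes "continuous_on S f" "continuous_on S g" "\<And>x. x \<in> S \<Longrightarrow> f x \<noteq> g x"
  shows "continuous_on S (\<lambda>x. poisson_kernel (f x) (g x))"
  unfolding poisson_kernel_def by (intro continuous_intros assms) (use assms(3) in auto)

lemma poisson_kernel_bounds: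
  assumes "norm w < norm \<zeta>"
  shows "poisson_kernel \<zeta> w > 0"
    "poisson_kernel \<zeta> w \<le> (norm \<zeta> + norm w) / (norm \<zeta> - norm w)"
proof -
  let ?a = "norm \<zeta>" and ?b = "norm w" and ?d = "norm (\<zeta> - w)"
  have ne: "\<zeta> \<noteq> w" using assms by auto
  have fac: "?a\<^sup>2 - ?b\<^sup>2 = (?a - ?b) * (?a + ?b)" by (simp add: power2_eq_square algebra_simps)
  have p: "(?a - ?b) * (?a + ?b) > 0" using assms by (intro mult_pos_pos) (auto intro: add_pos_nonneg le_less_trans[OF norm_ge_zero])
  have d1: "?a - ?b \<le> ?d" using norm_triangle_ineq2[of \<zeta> w] by simp
  have d0: "?d > 0" using ne by simp
  show "poisson_kernel \<zeta> w > 0"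
    unfolding poisson_kernel_eq[OF ne] fac using p d0 by simp
  have "(?a - ?b)\<^sup>2 \<le> ?d\<^sup>2" using d1 assms by (intro power_mono) auto
  then have "(?a - ?b) * (?a + ?b) / ?d\<^sup>2 \<le> (?a - ?b) * (?a + ?b) / (?a - ?b)\<^sup>2"
    using p assms d0 by (intro divide_left_mono mult_pos_pos) auto
  also have "\<dots> = (?a + ?b) / (?a - ?b)" using assms by (simp add: power2_eq_square)
  finally show "poisson_kernel \<zeta> w \<le> (?a + ?b) / (?a - ?b)"
    unfolding poisson_kernel_eq[OF ne] fac .
qed

text \<open>Two Cauchy integrals are added: the one for F at w, and one whose kernel has its pole at
  the mirror point of w, outside the disc, so that it contributes nothing. On the circle the two
  kernels add up to the real Poisson kernel.\<close>

theorem poisson_formula: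
  assumes S: "open S" "cball 0 R \<subseteq> S" and F: "F holomorphic_on S" and w: "norm w < R"
  shows "circle_mean R (\<lambda>\<zeta>. poisson_kernel \<zeta> w * Re (F \<zeta>)) = Re (F w)"
proof -
  have R: "R > 0" using w by (meson le_less_trans norm_ge_zero)
  have "((\<lambda>u. F u / (u - w)) has_contour_integral (2 * of_real pi * \<i> * F w)) (circlepath 0 R)"
    by (rule Cauchy_integral_circlepath_simple) (use w S F in \<open>auto intro: holomorphic_on_subset\<close>)
  then have I1: "((\<lambda>t. F (0 + R * cis t) / ((0 + R * cis t) - w) * R * \<i> * cis t) has_integral (2 * of_real pi * \<i> * F w)) {0..2*pi}"
    unfolding circlepath_def by (subst (asm) has_contour_integral_part_circlepath_iff) auto
  \<comment> \<open>The pole R^2 / cnj w lies outside the closed disc, and G vanishes at 0, so the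
    Cauchy integral of G at 0 is 0.\<close>
  define G where "G = (\<lambda>u. F u * (cnj w * u) / (of_real (R\<^sup>2) - cnj w * u))"
  have nz: "of_real (R\<^sup>2) - cnj w * u \<noteq> 0" if "norm u \<le> R" for u
  proof
    assume "of_real (R\<^sup>2) - cnj w * u = 0"
    then have "norm (of_real (R\<^sup>2) :: complex) = norm (cnj w * u)" by simp
    then have "R * R = norm w * norm u" by (simp add: norm_mult power2_eq_square)
    moreover have "norm w * norm u \<le> norm w * R" using that by (intro mult_left_mono) auto
    moreover have "norm w * R < R * R" using w R by simp
    ultimately show False by linarith
  qed
  have "((\<lambda>u. G u / (u - 0)) has_contour_integral (2 * of_real pi * \<i> * G 0)) (circlepath 0 R)"
  proof (rule Cauchy_integral_circlepath_simple)
    have "F holomorphic_on cball 0 R" using F S holomorphic_on_subset by blast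
    then show "G holomorphic_on cball 0 R" unfolding G_def
      by (intro holomorphic_intros) (use nz in auto)
  qed (use R in auto)
  then have I2: "((\<lambda>t. G (0 + R * cis t) / ((0 + R * cis t) - 0) * R * \<i> * cis t) has_integral (2 * of_real pi * \<i> * G 0)) {0..2*pi}"
    unfolding circlepath_def by (subst (asm) has_contour_integral_part_circlepath_iff) auto
  have G0: "G 0 = 0" by (simp add: G_def)
  have key: "F (0 + R * cis t) / ((0 + R * cis t) - w) * R * \<i> * cis t + G (0 + R * cis t) / ((0 + R * cis t) - 0) * R * \<i> * cis t
     = of_real (poisson_kernel (R * cis t) w) * F (R * cis t) * \<i>" for t
  proof -
    define \<zeta> where "\<zeta> = complex_of_real R * cis t"
    have n: "norm \<zeta> = R" using R by (simp add: \<zeta>_def norm_mult)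
    have z0: "\<zeta> \<noteq> 0" and zw: "\<zeta> \<noteq> w" using n R w by auto
    \<comment> \<open>On the circle R^2 = \<zeta> * cnj \<zeta>, which turns the kernel of G into
      cnj w / (cnj \<zeta> - cnj w).\<close>
    have R2: "complex_of_real (R\<^sup>2) = \<zeta> * cnj \<zeta>" using n complex_norm_square[of \<zeta>] by simp
    have czw: "cnj \<zeta> - cnj w \<noteq> 0" using zw by simp
    have Gz: "G \<zeta> = F \<zeta> * (cnj w / (cnj \<zeta> - cnj w))"
    proof -
      have "of_real (R\<^sup>2) - cnj w * \<zeta> = \<zeta> * (cnj \<zeta> - cnj w)" unfolding R2 by (simp add: algebra_simps)
      then show ?thesis unfolding G_def using z0 by simp
    qed
    have "of_real (poisson_kernel \<zeta> w) = (1/2) * ((\<zeta> + w) / (\<zeta> - w) + cnj ((\<zeta> + w) / (\<zeta> - w)))"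
      unfolding poisson_kernel_def by (simp only: complex_add_cnj) simp
    also have "\<dots> = \<zeta> / (\<zeta> - w) + cnj w / (cnj \<zeta> - cnj w)"
      using zw czw by (simp add: divide_simps) (simp add: algebra_simps)
    finally have pk: "of_real (poisson_kernel \<zeta> w) = \<zeta> / (\<zeta> - w) + cnj w / (cnj \<zeta> - cnj w)" .
    have "F \<zeta> / (\<zeta> - w) * R * \<i> * cis t + G \<zeta> / \<zeta> * R * \<i> * cis t = F \<zeta> / (\<zeta> - w) * \<zeta> * \<i> + G \<zeta> / \<zeta> * \<zeta> * \<i>"
      by (simp add: \<zeta>_def)
    also have "\<dots> = of_real (poisson_kernel \<zeta> w) * F \<zeta> * \<i>"
      unfolding pk Gz using z0 by (simp add: distrib_left distrib_right mult_ac)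
    finally show ?thesis by (simp add: \<zeta>_def)
  qed
  have "((\<lambda>t. of_real (poisson_kernel (R * cis t) w) * F (R * cis t) * \<i>) has_integral (2 * of_real pi * \<i> * F w)) {0..2*pi}"
    using has_integral_add[OF I1 I2] unfolding key G0 by simp
  from has_integral_mult_left[OF this, of "-\<i>"]
  have "((\<lambda>t. of_real (poisson_kernel (R * cis t) w) * F (R * cis t)) has_integral (2 * of_real pi * F w)) {0..2*pi}"
    by (simp add: mult.assoc) (simp add: mult_ac)
  from has_integral_linear[OF this bounded_linear_Re]
  have "((\<lambda>t. poisson_kernel (R * cis t) w * Re (F (R * cis t))) has_integral (2 * pi * Re (F w))) {0..2*pi}"
    by (simp add: o_def)
  then show ?thesis unfolding circle_mean_def by (simp add: integral_unique)
qed

lemma circle_mean_poisson_kernel: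
  assumes "norm w < R" shows "circle_mean R (\<lambda>\<zeta>. poisson_kernel \<zeta> w) = 1"
  using poisson_formula[of UNIV R "\<lambda>_. 1" w] assms by simp

lemma poisson_kernel_0 [simp]: "\<zeta> \<noteq> 0 \<Longrightarrow> poisson_kernel \<zeta> 0 = 1"
  by (simp add: poisson_kernel_def)

text \<open>The Poisson formula for the function w -> \<open>poisson_kernel \<zeta> (w + b)\<close>;
  the bound on r + norm b keeps its pole outside the disc. With w = 0 it turns the mean over a
  circle about b into a value at b.\<close>

lemma poisson_kernel_poisson:
  assumes "r > 0" "r + norm b < norm \<zeta>" "norm w < r"
  shows "circle_mean r (\<lambda>\<xi>. poisson_kernel \<xi> w * poisson_kernel \<zeta> (\<xi> + b)) = poisson_kernel \<zeta> (w + b)"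
proof -
  have ne: "\<zeta> - (x + b) \<noteq> 0" if "norm x < norm \<zeta> - norm b" for x
    using that norm_triangle_ineq[of x b] by auto
  have "circle_mean r (\<lambda>\<xi>. poisson_kernel \<xi> w * Re ((\<zeta> + (\<xi> + b)) / (\<zeta> - (\<xi> + b)))) = Re ((\<zeta> + (w + b)) / (\<zeta> - (w + b)))"
  proof (rule poisson_formula)
    show "cball 0 r \<subseteq> ball 0 (norm \<zeta> - norm b)" using assms by auto
    show "(\<lambda>\<xi>. (\<zeta> + (\<xi> + b)) / (\<zeta> - (\<xi> + b))) holomorphic_on ball 0 (norm \<zeta> - norm b)"
      by (intro holomorphic_intros) (use ne in auto)
  qed (use assms in auto)
  then show ?thesis by (simp add: poisson_kernel_def[of \<zeta>])
qed

lemma circle_mean_poisson_kernel_shift: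
  assumes "r > 0" "r + norm b < norm \<zeta>"
  shows "circle_mean r (\<lambda>\<xi>. poisson_kernel \<zeta> (\<xi> + b)) = poisson_kernel \<zeta> b"
proof -
  have "circle_mean r (\<lambda>\<xi>. poisson_kernel \<xi> 0 * poisson_kernel \<zeta> (\<xi> + b)) = circle_mean r (\<lambda>\<xi>. poisson_kernel \<zeta> (\<xi> + b))"
    by (rule circle_mean_cong) (use assms in auto)
  then show ?thesis using poisson_kernel_poisson[of r b \<zeta> 0] assms by simp
qed

text \<open>The difference of the two kernels is bounded by a multiple of the kernel itself, whose
  mean is 1. Up to constants and the factor norm c, averaging over w therefore gives 1 / (R - r),
  where a pointwise bound would give R / (R - r)^2.\<close>

lemma poisson_kernel_diff_mean:
  assumes "r > 0" "norm \<zeta> = R" "2 * norm c \<le> R - r" "r < R"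
  shows "circle_mean r (\<lambda>w. \<bar>poisson_kernel \<zeta> (w + c) - poisson_kernel \<zeta> w\<bar>) \<le> 4 * norm c / (R - r)"
proof -
  have R: "R > 0" using assms by linarith
  have pt: "\<bar>poisson_kernel \<zeta> (w + c) - poisson_kernel \<zeta> w\<bar> \<le> 4 * R * norm c / (R\<^sup>2 - r\<^sup>2) * poisson_kernel \<zeta> (w + 0)"
    if w: "norm w = r" for w
  proof -
    have d: "norm (\<zeta> - w) \<ge> R - r" using norm_triangle_ineq2[of \<zeta> w] assms w by simp
    then have d0: "norm (\<zeta> - w) > 0" using assms by linarith
    \<comment> \<open>norm c is at most half of R - r, hence of norm (\<zeta> - w): shifting w costs
      only a factor 2 in the denominator.\<close>
    have d2: "norm (\<zeta> - (w + c)) \<ge> norm (\<zeta> - w) / 2"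
    proof -
      have "norm (\<zeta> - w - c) \<ge> norm (\<zeta> - w) - norm c" by (rule norm_triangle_ineq2)
      then show ?thesis using d assms(3) by (simp add: diff_diff_eq)
    qed
    have ne: "\<zeta> \<noteq> w" "\<zeta> \<noteq> w + c" using d0 d2 by auto
    have "poisson_kernel \<zeta> (w + c) - poisson_kernel \<zeta> w = Re (2 * \<zeta> * c / ((\<zeta> - (w + c)) * (\<zeta> - w)))"
      unfolding poisson_kernel_def minus_complex.simps(1)[symmetric]
      by (rule arg_cong[of _ _ Re]) (use ne in \<open>simp add: divide_simps\<close>, simp add: algebra_simps)
    also have "\<bar>\<dots>\<bar> \<le> norm (2 * \<zeta> * c / ((\<zeta> - (w + c)) * (\<zeta> - w)))" by (rule abs_Re_le_cmod)
    also have "\<dots> = 2 * R * norm c / (norm (\<zeta> - (w + c)) * norm (\<zeta> - w))"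
      using assms(2) by (simp add: norm_mult norm_divide)
    also have "\<dots> \<le> 2 * R * norm c / ((norm (\<zeta> - w) / 2) * norm (\<zeta> - w))"
      using d0 d2 R by (intro divide_left_mono mult_right_mono mult_pos_pos) auto
    also have "\<dots> = 4 * R * norm c / (norm (\<zeta> - w))\<^sup>2" by (simp add: power2_eq_square)
    also have "\<dots> = 4 * R * norm c / (R\<^sup>2 - r\<^sup>2) * poisson_kernel \<zeta> (w + 0)"
    proof -
      have "r\<^sup>2 < R\<^sup>2" using assms by (intro power_strict_mono) auto
      then show ?thesis using poisson_kernel_eq[OF ne(1)] w assms(2) by simp
    qed
    finally show ?thesis .
  qed
  have ne1: "\<zeta> \<noteq> w + c" "\<zeta> \<noteq> w" if "norm w = r" for w
  proof -
    have "norm (w + c) \<le> r + norm c" using norm_triangle_ineq[of w c] that by simp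
    moreover have "r + norm c < R" using assms(3,4) by (smt (verit) norm_ge_zero)
    ultimately show "\<zeta> \<noteq> w + c" using assms(2) by auto
    show "\<zeta> \<noteq> w" using that assms by auto
  qed
  have "circle_mean r (\<lambda>w. \<bar>poisson_kernel \<zeta> (w + c) - poisson_kernel \<zeta> w\<bar>)
     \<le> circle_mean r (\<lambda>w. 4 * R * norm c / (R\<^sup>2 - r\<^sup>2) * poisson_kernel \<zeta> (w + 0))"
  proof (rule circle_mean_mono)
    show "continuous_on (sphere 0 r) (\<lambda>w. \<bar>poisson_kernel \<zeta> (w + c) - poisson_kernel \<zeta> w\<bar>)"
      by (intro continuous_intros) (simp_all add: ne1)
    show "continuous_on (sphere 0 r) (\<lambda>w. 4 * R * norm c / (R\<^sup>2 - r\<^sup>2) * poisson_kernel \<zeta> (w + 0))"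
      by (intro continuous_intros) (simp add: ne1)
  qed (use assms pt in simp_all)
  also have "\<dots> = 4 * R * norm c / (R\<^sup>2 - r\<^sup>2)"
  proof -
    have "\<zeta> \<noteq> 0" using assms R by auto
    then show ?thesis
      unfolding circle_mean_cmult using circle_mean_poisson_kernel_shift[of r 0 \<zeta>] assms by simp
  qed
  also have "\<dots> = 4 * norm c / (R - r) * (R / (R + r))"
  proof -
    have "R\<^sup>2 - r\<^sup>2 = (R - r) * (R + r)" by (simp add: power2_eq_square algebra_simps)
    then show ?thesis by simp
  qed
  also have "\<dots> \<le> 4 * norm c / (R - r) * 1"
    using assms R by (intro mult_left_mono) auto
  finally show ?thesis by simp
qed

section \<open>The Poisson-Jensen formula\<close>

text \<open>\<open>zor_poly\<close> is the quotient near p only; away from p plain division works,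
  and \<open>entire_divides\<close> glues the two. If g p is nonzero, the exponent is 0.\<close>

lemma entire_factor_zero:
  assumes g: "entire g" "nonzero g"
  obtains k E where "entire E" "E p \<noteq> 0" "\<And>z. g z = (z - p) ^ k * E z"
proof -
  define k where "k = nat (zorder g p)"
  have nc: "\<exists>w\<in>UNIV. g w \<noteq> 0" using g(2) by (simp add: nonzero_def)
  obtain r where r: "r > 0" "zor_poly g p holomorphic_on cball p r"
    "\<forall>w\<in>cball p r. g w = zor_poly g p w * (w - p) ^ k \<and> zor_poly g p w \<noteq> 0"
    using zorder_exist_zero[of g UNIV p] g(1) nc unfolding entire_def k_def by auto
  have nz: "nonzero (\<lambda>z. (z - p) ^ k)" unfolding nonzero_def by (rule exI[of _ "p + 1"]) simp
  have ent: "entire (\<lambda>z. (z - p) ^ k)" by auto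
  have ev: "eventually (\<lambda>w. w \<in> ball p r) (at p)"
    using r(1) by (auto simp: eventually_at dist_commute)
  have cp: "isCont (zor_poly g p) p"
  proof -
    have "continuous_on (ball p r) (zor_poly g p)"
      using holomorphic_on_imp_continuous_on[OF r(2)] ball_subset_cball by (rule continuous_on_subset)
    then show ?thesis using r(1) by (simp add: continuous_on_eq_continuous_at)
  qed
  have "\<exists>e. isCont e z \<and> eventually (\<lambda>w. g w = (w - p) ^ k * e w) (at z)" for z
  proof (cases "z = p")
    case True
    then show ?thesis using ev r(3) cp
      by (intro exI[of _ "zor_poly g p"]) (auto elim!: eventually_mono simp: mult.commute)
  next
    case False
    have "isCont (\<lambda>w. g w / (w - p) ^ k) z"
      using False by (intro continuous_intros entire_isCont g) auto
    moreover have "eventually (\<lambda>w. g w = (w - p) ^ k * (g w / (w - p) ^ k)) (at z)"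
      using entire_eventually_nz[OF ent nz, of z] by eventually_elim auto
    ultimately show ?thesis by blast
  qed
  then obtain E where E: "entire E" "\<And>z. g z = (z - p) ^ k * E z"
    by (rule entire_divides[OF g(1) ent nz]) blast
  have "eventually (\<lambda>w. zor_poly g p w = E w) (at p)"
    using ev entire_eventually_nz[OF ent nz, of p] eventually_neq_at_within[of p p]
  proof eventually_elim
    case (elim w)
    then have "zor_poly g p w * (w - p) ^ k = (w - p) ^ k * E w" using r(3) E(2)[of w] by auto
    with elim show ?case by simp
  qed
  then have "E \<midarrow>p\<rightarrow> zor_poly g p p"
    using cp tendsto_cong[of "zor_poly g p" E "at p"] by (auto simp: isCont_def)
  moreover have "E \<midarrow>p\<rightarrow> E p" using entire_isCont[OF E(1)] by (simp add: isCont_def)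
  ultimately have "E p = zor_poly g p p" using LIM_unique by blast
  moreover have "zor_poly g p p \<noteq> 0" using r by auto
  ultimately show thesis using that[of E k] E by simp
qed

text \<open>The zeros are listed with multiplicity, so that n is the counting function of Nevanlinna
  theory. Induction on the number of distinct zeros, each removed with its full
  multiplicity.\<close>

lemma entire_factor_cball:
  assumes "entire g" "nonzero g"
  shows "\<exists>E n a. entire E \<and> (\<forall>z. norm z \<le> R \<longrightarrow> E z \<noteq> 0) \<and>
          (\<forall>i<n. norm (a i) \<le> R \<and> g (a i) = 0) \<and> (\<forall>z. g z = E z * (\<Prod>i<(n::nat). z - a i))"
  using assms
proof (induction "card {z \<in> cball 0 R. g z = 0}" arbitrary: g)
  case 0
  then have "{z \<in> cball 0 R. g z = 0} = {}" using finite_zeros_cball by auto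
  then show ?case using 0 by (intro exI[of _ g] exI[of _ 0]) auto
next
  case (Suc c)
  have fin: "finite {z \<in> cball 0 R. g z = 0}" using Suc.prems by (rule finite_zeros_cball)
  have "{z \<in> cball 0 R. g z = 0} \<noteq> {}" using Suc(2) by (metis card.empty nat.distinct(1))
  then obtain p where p: "norm p \<le> R" "g p = 0" by auto
  obtain k E where E: "entire E" "E p \<noteq> 0" "\<And>z. g z = (z - p) ^ k * E z"
    by (rule entire_factor_zero[OF Suc.prems, where p = p]) blast
  have nE: "nonzero E" using E(2) by (auto simp: nonzero_def)
  have k: "k > 0" using p(2) E(2) E(3)[of p] by (cases k) auto
  have "{z \<in> cball 0 R. E z = 0} = {z \<in> cball 0 R. g z = 0} - {p}"
    using E k by (auto simp: zero_power)
  then have "c = card {z \<in> cball 0 R. E z = 0}"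
    using Suc(2) fin p by simp
  from Suc(1)[OF this E(1) nE] obtain E' n a where IH: "entire E'" "\<forall>z. norm z \<le> R \<longrightarrow> E' z \<noteq> 0"
    "\<forall>i<n. norm (a i) \<le> R \<and> E (a i) = 0" "\<forall>z. E z = E' z * (\<Prod>i<(n::nat). z - a i)" by blast
  show ?case
  proof (intro exI conjI allI impI)
    show "entire E'" by fact
    show "E' z \<noteq> 0" if "norm z \<le> R" for z using IH(2) that by blast
    \<comment> \<open>The list for E is extended by k copies of p.\<close>
    fix i assume i: "i < n + k"
    show "norm ((\<lambda>i. if i < n then a i else p) i) \<le> R" using IH(3) p by auto
    show "g ((\<lambda>i. if i < n then a i else p) i) = 0" using IH(3) p E(3) by auto
  next
    fix z
    have "(\<Prod>i<n+k. z - (\<lambda>i. if i < n then a i else p) i) = (\<Prod>i<n. z - a i) * (z - p) ^ k"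
      by (induction k) auto
    then show "g z = E' z * (\<Prod>i<n+k. z - (\<lambda>i. if i < n then a i else p) i)"
      using E(3)[of z] IH(4) by simp
  qed
qed

text \<open>A zero-free function on a disc has a holomorphic logarithm there, and ln |E| is its real
  part. Compactness provides a disc slightly larger than the closed one on which E is still
  zero-free.\<close>

lemma circle_mean_ln_nonvanishing:
  assumes E: "entire E" "\<And>z. norm z \<le> R \<Longrightarrow> E z \<noteq> 0" and w: "norm w < R"
  shows "circle_mean R (\<lambda>\<zeta>. poisson_kernel \<zeta> w * ln (norm (E \<zeta>))) = ln (norm (E w))"
proof -
  have R: "R > 0" using w by (meson le_less_trans norm_ge_zero)
  have "open {z. E z \<noteq> 0}"
  proof -
    have "open (E -` (- {0}))"
      using entire_continuous_on[OF E(1) continuous_on_id, of UNIV] by (intro open_vimage) auto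
    then show ?thesis by (simp add: vimage_def)
  qed
  moreover have "cball 0 R \<subseteq> {z. E z \<noteq> 0}" using E(2) by auto
  ultimately obtain e where e: "e > 0" "(\<Union>x\<in>cball 0 R. ball x e) \<subseteq> {z. E z \<noteq> 0}"
    using compact_subset_open_imp_ball_epsilon_subset[OF compact_cball] by blast
  have nz: "E z \<noteq> 0" if "z \<in> ball 0 (R + e)" for z
  proof (cases "norm z \<le> R")
    case False
    \<comment> \<open>The nearest point of the closed disc; its distance to z is norm z - R <
      e.\<close>
    define x where "x = of_real (R / norm z) * z"
    have z0: "norm z > 0" using False R by linarith
    have x: "norm x = R" using False R z0 by (simp add: x_def norm_mult norm_divide)
    have "norm (z - x) = norm (of_real (1 - R / norm z) * z)"
      by (rule arg_cong[of _ _ norm]) (simp only: x_def of_real_diff of_real_1 left_diff_distrib mult_1)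
    also have "\<dots> = (1 - R / norm z) * norm z"
      using False z0 R by (simp only: norm_mult norm_of_real) simp
    also have "\<dots> = norm z - R" using z0 by (simp only: left_diff_distrib) simp
    finally have "z \<in> ball x e" using that by (simp add: dist_norm norm_minus_commute)
    moreover have "x \<in> cball 0 R" using x by simp
    ultimately show ?thesis using e(2) by blast
  qed (use E in auto)
  obtain L where L: "L holomorphic_on ball 0 (R + e)" "\<And>x. x \<in> ball 0 (R + e) \<Longrightarrow> exp (L x) = E x"
    by (rule holomorphic_logarithm_exists[of "ball 0 (R + e)" E 0])
       (use E(1) nz R e in \<open>auto simp: entire_def intro: holomorphic_on_subset\<close>)
  have ln: "ln (norm (E z)) = Re (L z)" if "norm z \<le> R" for z
  proof -
    have "z \<in> ball 0 (R + e)" using that e by auto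
    then have "norm (E z) = exp (Re (L z))" using L(2) by (metis norm_exp_eq_Re)
    then show ?thesis by simp
  qed
  have "circle_mean R (\<lambda>\<zeta>. poisson_kernel \<zeta> w * ln (norm (E \<zeta>))) = circle_mean R (\<lambda>\<zeta>. poisson_kernel \<zeta> w * Re (L \<zeta>))"
    by (rule circle_mean_cong) (use R ln in auto)
  also have "\<dots> = Re (L w)" by (rule poisson_formula[of "ball 0 (R + e)"]) (use L e w in auto)
  finally show ?thesis using ln[of w] w by simp
qed

text \<open>A zero inside the disc can be exchanged for its mirror image without changing the
  modulus on the circle. The reflected factor is zero-free in the closed disc
  (\<open>reflect_nonzero\<close>), so the formula for zero-free functions applies to it.\<close>

lemma norm_reflect:
  assumes "norm \<zeta> = R" "R > 0"
  shows "norm (\<zeta> - a) = norm (of_real R - cnj a * \<zeta> / of_real R)"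
proof -
  have "norm (of_real R - cnj a * \<zeta> / of_real R) * R = norm (of_real (R\<^sup>2) - cnj a * \<zeta>)"
  proof -
    have "norm (of_real R - cnj a * \<zeta> / of_real R) * R = norm ((of_real R - cnj a * \<zeta> / of_real R) * of_real R)"
      using assms(2) by (simp add: norm_mult)
    also have "(of_real R - cnj a * \<zeta> / of_real R) * of_real R = of_real (R\<^sup>2) - cnj a * \<zeta>"
      using assms(2) by (simp add: left_diff_distrib power2_eq_square)
    finally show ?thesis .
  qed
  also have "of_real (R\<^sup>2) - cnj a * \<zeta> = \<zeta> * cnj (\<zeta> - a)"
  proof -
    have "complex_of_real (R\<^sup>2) = \<zeta> * cnj \<zeta>" using assms(1) complex_norm_square[of \<zeta>] by simp
    then show ?thesis by (simp only: complex_cnj_diff right_diff_distrib mult.commute)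
  qed
  also have "norm \<dots> = R * norm (\<zeta> - a)" using assms by (simp add: norm_mult flip: complex_cnj_diff)
  finally show ?thesis using assms by simp
qed

lemma reflect_nonzero:
  assumes "norm a < R" "norm z \<le> R"
  shows "of_real R - cnj a * z / of_real R \<noteq> 0"
proof
  assume "of_real R - cnj a * z / of_real R = 0"
  moreover have R: "R > 0" using assms(1) by (meson le_less_trans norm_ge_zero)
  ultimately have "norm (of_real R :: complex) = norm (cnj a * z / of_real R)" by simp
  then have "R * R = norm a * norm z" using R by (simp add: norm_mult norm_divide field_simps)
  moreover have "norm a * norm z \<le> norm a * R" using assms by (intro mult_left_mono) auto
  moreover have "norm a * R < R * R" using assms R by simp
  ultimately show False by linarith
qed

lemma circle_mean_ln_linear:
  assumes a: "norm a < R" and w: "norm w < R"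
  shows "circle_mean R (\<lambda>\<zeta>. poisson_kernel \<zeta> w * ln (norm (\<zeta> - a))) = ln (norm (of_real R - cnj a * w / of_real R))"
proof -
  have R: "R > 0" using w by (meson le_less_trans norm_ge_zero)
  have "circle_mean R (\<lambda>\<zeta>. poisson_kernel \<zeta> w * ln (norm (\<zeta> - a))) =
     circle_mean R (\<lambda>\<zeta>. poisson_kernel \<zeta> w * ln (norm (of_real R - cnj a * \<zeta> / of_real R)))"
  proof (rule circle_mean_cong)
    fix \<zeta> :: complex assume "norm \<zeta> = R"
    from norm_reflect[OF this R, of a]
    show "poisson_kernel \<zeta> w * ln (norm (\<zeta> - a)) = poisson_kernel \<zeta> w * ln (norm (of_real R - cnj a * \<zeta> / of_real R))"
      by (simp only:)
  qed (use R in simp)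
  also have "\<dots> = ln (norm (of_real R - cnj a * w / of_real R))"
  proof (rule circle_mean_ln_nonvanishing)
    show "entire (\<lambda>\<zeta>. of_real R - cnj a * \<zeta> / of_real R)"
      unfolding entire_def by (intro holomorphic_intros) (use R in simp)
    show "of_real R - cnj a * z / of_real R \<noteq> 0" if "norm z \<le> R" for z
      using reflect_nonzero[OF a that] .
  qed (rule w)
  finally show ?thesis .
qed

lemma ln_norm_prod:
  assumes "\<And>i. i < (n::nat) \<Longrightarrow> a i \<noteq> (z::complex)" "e \<noteq> 0"
  shows "ln (norm (e * (\<Prod>i<n. z - a i))) = ln (norm e) + (\<Sum>i<n. ln (norm (z - a i)))"
proof -
  have "(\<Prod>i<n. z - a i) \<noteq> 0" using assms by auto
  then have "ln (norm (e * (\<Prod>i<n. z - a i))) = ln (norm e) + ln (norm (\<Prod>i<n. z - a i))"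
    using assms(2) by (simp add: norm_mult ln_mult)
  also have "ln (norm (\<Prod>i<n. z - a i)) = (\<Sum>i<n. ln (norm (z - a i)))"
    unfolding prod_norm[symmetric] by (rule ln_prod) (use assms in auto)
  finally show ?thesis .
qed

lemma continuous_on_ln_norm:
  assumes "entire g" "\<And>z. z \<in> S \<Longrightarrow> g z \<noteq> 0"
  shows "continuous_on S (\<lambda>z. ln (norm (g z)))"
proof (rule continuous_on_ln)
  have "continuous_on S g"
    using assms(1) unfolding entire_def
    by (meson holomorphic_on_imp_continuous_on holomorphic_on_subset subset_UNIV)
  then show "continuous_on S (\<lambda>z. norm (g z))" by (rule continuous_on_norm)
qed (use assms(2) in auto)

text \<open>The logarithm of the modulus of the Blaschke factor with zero a in the disc of radius R;
  on the circle norm w = R the two logarithms cancel by \<open>norm_reflect\<close>.\<close>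

definition blaschke_term :: "real \<Rightarrow> complex \<Rightarrow> complex \<Rightarrow> real" where
  "blaschke_term R a w = ln (norm (w - a)) - ln (norm (of_real R - cnj a * w / of_real R))"

text \<open>Each factor \<open>z - a i\<close> is averaged through its mirror image, and the
  Blaschke term is the resulting defect at w. The zeros lie off the circle, so that a continuous
  function is averaged.\<close>

lemma poisson_jensen:
  assumes E: "entire E" "\<And>z. norm z \<le> R \<Longrightarrow> E z \<noteq> 0"
    and a: "\<And>i. i < (n::nat) \<Longrightarrow> norm (a i) < R"
    and g: "\<And>z. g z = E z * (\<Prod>i<n. z - a i)"
    and w: "norm w < R" "g w \<noteq> 0"
  shows "ln (norm (g w)) = circle_mean R (\<lambda>\<zeta>. poisson_kernel \<zeta> w * ln (norm (g \<zeta>))) + (\<Sum>i<n. blaschke_term R (a i) w)"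
proof -
  have R: "R > 0" using w by (meson le_less_trans norm_ge_zero)
  have wne: "\<zeta> \<noteq> w" if "norm \<zeta> = R" for \<zeta> using w that by auto
  have ane: "\<zeta> \<noteq> a i" if "norm \<zeta> = R" "i < n" for i \<zeta> using a[OF that(2)] that(1) by auto
  have c0: "continuous_on (sphere 0 R) (\<lambda>\<zeta>. poisson_kernel \<zeta> w * ln (norm (E \<zeta>)))"
    by (intro continuous_on_mult continuous_on_ln_norm continuous_on_poisson_kernel continuous_on_id continuous_on_const E) (use wne in auto)
  have c1: "continuous_on (sphere 0 R) (\<lambda>\<zeta>. poisson_kernel \<zeta> w * ln (norm (\<zeta> - a i)))" if "i < n" for i
    by (intro continuous_intros) (use wne ane that in auto)
  have "circle_mean R (\<lambda>\<zeta>. poisson_kernel \<zeta> w * ln (norm (g \<zeta>))) =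
     circle_mean R (\<lambda>\<zeta>. poisson_kernel \<zeta> w * ln (norm (E \<zeta>)) + (\<Sum>i<n. poisson_kernel \<zeta> w * ln (norm (\<zeta> - a i))))"
  proof (rule circle_mean_cong)
    fix \<zeta> :: complex assume n: "norm \<zeta> = R"
    have "ln (norm (g \<zeta>)) = ln (norm (E \<zeta>)) + (\<Sum>i<n. ln (norm (\<zeta> - a i)))"
      unfolding g by (rule ln_norm_prod) (use ane[OF n] E(2) n in auto)
    then show "poisson_kernel \<zeta> w * ln (norm (g \<zeta>)) = poisson_kernel \<zeta> w * ln (norm (E \<zeta>)) + (\<Sum>i<n. poisson_kernel \<zeta> w * ln (norm (\<zeta> - a i)))"
      by (simp add: distrib_left sum_distrib_left)
  qed (use R in simp)
  also have "\<dots> = circle_mean R (\<lambda>\<zeta>. poisson_kernel \<zeta> w * ln (norm (E \<zeta>))) + (\<Sum>i<n. circle_mean R (\<lambda>\<zeta>. poisson_kernel \<zeta> w * ln (norm (\<zeta> - a i))))"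
    using c0 c1 R by (subst circle_mean_add) (auto intro!: continuous_on_sum circle_mean_sum)
  also have "\<dots> = ln (norm (E w)) + (\<Sum>i<n. ln (norm (of_real R - cnj (a i) * w / of_real R)))"
    using circle_mean_ln_nonvanishing[OF E w(1)] circle_mean_ln_linear[OF a w(1)] by simp
  finally have "circle_mean R (\<lambda>\<zeta>. poisson_kernel \<zeta> w * ln (norm (g \<zeta>))) = \<dots>" .
  moreover have "ln (norm (g w)) = ln (norm (E w)) + (\<Sum>i<n. ln (norm (w - a i)))"
    unfolding g using w(2) unfolding g by (intro ln_norm_prod) auto
  ultimately show ?thesis by (simp add: blaschke_term_def sum_subtractf)
qed

text \<open>The squared moduli of the two factors differ by (R^2 - |a|^2) (R^2 - |w|^2) /
  R^2.\<close>

lemma blaschke_term_nonpos: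
  assumes "norm a < R" "norm w < R" "w \<noteq> a"
  shows "blaschke_term R a w \<le> 0"
proof -
  have R: "R > 0" using assms by (meson le_less_trans norm_ge_zero)
  define X where "X = cnj a * w / of_real R"
  have rX: "R * Re X = Re (cnj a * w)" using R by (simp add: X_def)
  have nX: "norm X = norm a * norm w / R" using R by (simp add: X_def norm_mult norm_divide)
  have 1: "(norm (of_real R - X))\<^sup>2 = R\<^sup>2 - 2 * (R * Re X) + (norm X)\<^sup>2"
    unfolding cmod_power2 by (simp add: power2_eq_square algebra_simps)
  have 2: "(norm (w - a))\<^sup>2 = (norm w)\<^sup>2 + (norm a)\<^sup>2 - 2 * Re (cnj a * w)"
    unfolding cmod_power2 by (simp add: power2_eq_square algebra_simps)
  have "(norm (of_real R - X))\<^sup>2 - (norm (w - a))\<^sup>2 = (R\<^sup>2 - (norm a)\<^sup>2) * (R\<^sup>2 - (norm w)\<^sup>2) / R\<^sup>2"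
    unfolding 1 2 rX nX using R by (simp add: field_simps power2_eq_square)
  moreover have "\<dots> \<ge> 0" using assms R by (intro divide_nonneg_nonneg mult_nonneg_nonneg) (simp_all add: power_mono)
  ultimately have "(norm (w - a))\<^sup>2 \<le> (norm (of_real R - X))\<^sup>2" by linarith
  then have "norm (w - a) \<le> norm (of_real R - X)" by (rule power2_le_imp_le) simp
  moreover have "0 < norm (w - a)" using assms(3) by simp
  ultimately have "ln (norm (w - a)) \<le> ln (norm (of_real R - X))" by (subst ln_le_cancel_iff) linarith+
  then show ?thesis unfolding blaschke_term_def X_def by simp
qed

text \<open>Subharmonicity of ln |g|: Poisson-Jensen with the nonpositive Blaschke terms
  dropped.\<close>

lemma ln_norm_le_poisson:
  assumes g: "entire g" "\<And>z. norm z = R \<Longrightarrow> g z \<noteq> 0" and w: "norm w < R" "g w \<noteq> 0"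
  shows "ln (norm (g w)) \<le> circle_mean R (\<lambda>\<zeta>. poisson_kernel \<zeta> w * ln (norm (g \<zeta>)))"
proof -
  have "nonzero g" using w by (auto simp: nonzero_def)
  from entire_factor_cball[OF g(1) this, of R] obtain E n a where E: "entire E" "\<And>z. norm z \<le> R \<Longrightarrow> E z \<noteq> 0"
    "\<And>i. i < n \<Longrightarrow> norm (a i) \<le> R \<and> g (a i) = 0" "\<And>z. g z = E z * (\<Prod>i<(n::nat). z - a i)" by blast
  have a: "norm (a i) < R" if "i < n" for i using E(3)[OF that] g(2)[of "a i"] by fastforce
  have "(\<Sum>i<n. blaschke_term R (a i) w) \<le> 0"
    by (rule sum_nonpos) (use a w E(3) in \<open>auto intro!: blaschke_term_nonpos\<close>)
  then show ?thesis using poisson_jensen[of E R n a g w] E a w by auto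
qed

section \<open>The lemma on the logarithmic difference\<close>

lemma continuous_on_sphere_ln_norm:
  assumes "entire g" "\<And>z. norm z = r \<Longrightarrow> g z \<noteq> 0"
  shows "continuous_on (sphere 0 r) (\<lambda>z. ln (norm (g z)))"
  by (rule continuous_on_ln_norm) (use assms in auto)

text \<open>Jensen's formula. With E 0 in place of g 0, zeros at the origin need no separate
  treatment: like every other zero in the disc they contribute ln R.\<close>

lemma circle_mean_ln_factored:
  assumes E: "entire E" "\<And>z. norm z \<le> R \<Longrightarrow> E z \<noteq> 0" and R: "R > 0"
    and a: "\<And>i. i < (n::nat) \<Longrightarrow> norm (a i) < R"
    and g: "\<And>z. g z = E z * (\<Prod>i<n. z - a i)"
  shows "circle_mean R (\<lambda>\<zeta>. ln (norm (g \<zeta>))) = ln (norm (E 0)) + n * ln R"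
proof -
  have p0: "poisson_kernel \<zeta> 0 = 1" if "norm \<zeta> = R" for \<zeta> using that R by auto
  have ane: "\<zeta> \<noteq> a i" if "norm \<zeta> = R" "i < n" for i \<zeta> using a[OF that(2)] that(1) by auto
  have c0: "continuous_on (sphere 0 R) (\<lambda>\<zeta>. ln (norm (E \<zeta>)))"
    by (rule continuous_on_sphere_ln_norm) (use E in auto)
  have c1: "continuous_on (sphere 0 R) (\<lambda>\<zeta>. ln (norm (\<zeta> - a i)))" if "i < n" for i
    by (intro continuous_intros) (use ane that in auto)
  have "circle_mean R (\<lambda>\<zeta>. ln (norm (g \<zeta>))) = circle_mean R (\<lambda>\<zeta>. ln (norm (E \<zeta>)) + (\<Sum>i<n. ln (norm (\<zeta> - a i))))"
  proof (rule circle_mean_cong)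
    fix \<zeta> :: complex assume n: "norm \<zeta> = R"
    show "ln (norm (g \<zeta>)) = ln (norm (E \<zeta>)) + (\<Sum>i<n. ln (norm (\<zeta> - a i)))"
      unfolding g by (rule ln_norm_prod) (use ane[OF n] E(2) n in auto)
  qed (use R in simp)
  also have "\<dots> = circle_mean R (\<lambda>\<zeta>. ln (norm (E \<zeta>))) + (\<Sum>i<n. circle_mean R (\<lambda>\<zeta>. ln (norm (\<zeta> - a i))))"
    using c0 c1 R by (subst circle_mean_add) (auto intro!: continuous_on_sum circle_mean_sum)
  also have "circle_mean R (\<lambda>\<zeta>. ln (norm (E \<zeta>))) = circle_mean R (\<lambda>\<zeta>. poisson_kernel \<zeta> 0 * ln (norm (E \<zeta>)))"
    by (rule circle_mean_cong) (use R p0 in auto)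
  also have "\<dots> = ln (norm (E 0))" by (rule circle_mean_ln_nonvanishing) (use E R in auto)
  also have "(\<Sum>i<n. circle_mean R (\<lambda>\<zeta>. ln (norm (\<zeta> - a i)))) = (\<Sum>i<n. ln R)"
  proof (rule sum.cong)
    fix i assume i: "i \<in> {..<n}"
    have "circle_mean R (\<lambda>\<zeta>. ln (norm (\<zeta> - a i))) = circle_mean R (\<lambda>\<zeta>. poisson_kernel \<zeta> 0 * ln (norm (\<zeta> - a i)))"
      by (rule circle_mean_cong) (use R p0 in auto)
    also have "\<dots> = ln (norm (of_real R - cnj (a i) * 0 / of_real R))"
      by (rule circle_mean_ln_linear) (use a i R in auto)
    finally show "circle_mean R (\<lambda>\<zeta>. ln (norm (\<zeta> - a i))) = ln R" using R by simp
  qed simp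
  finally show ?thesis by simp
qed

text \<open>A zero at 0 raises the power of z and leaves h 0 alone, any other zero multiplies h 0 by
  its modulus up to sign and argument. The bounds are at least 1 so that the same product covers the
  first kind.\<close>

lemma leading_coeff_factored:
  assumes "entire E" "E 0 \<noteq> 0" "\<And>i. i < (n::nat) \<Longrightarrow> norm (a i) \<le> b i \<and> 1 \<le> b i"
  shows "\<exists>k h. entire h \<and> h 0 \<noteq> 0 \<and> norm (h 0) \<le> norm (E 0) * (\<Prod>i<n. b i) \<and> (\<forall>z. E z * (\<Prod>i<n. z - a i) = z ^ k * h z)"
  using assms(3)
proof (induction n)
  case 0
  then show ?case using assms by (intro exI[of _ 0] exI[of _ E]) auto
next
  case (Suc n)
  then obtain k h where h: "entire h" "h 0 \<noteq> 0" "norm (h 0) \<le> norm (E 0) * (\<Prod>i<n. b i)"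
    "\<And>z. E z * (\<Prod>i<n. z - a i) = z ^ k * h z" by (metis less_Suc_eq)
  have bn: "norm (a n) \<le> b n" "1 \<le> b n" using Suc.prems by auto
  have split: "E z * (\<Prod>i<Suc n. z - a i) = (z ^ k * h z) * (z - a n)" for z
    using h(4)[of z] by (simp add: mult.assoc[symmetric])
  show ?case
  proof (cases "a n = 0")
    case True
    have "norm (h 0) * 1 \<le> (norm (E 0) * (\<Prod>i<n. b i)) * b n"
      using h(3) bn by (intro mult_mono) (auto intro: order_trans[OF norm_ge_zero])
    then show ?thesis using h True split
      by (intro exI[of _ "Suc k"] exI[of _ h]) (auto simp: mult_ac)
  next
    case False
    have "norm (h 0) * norm (a n) \<le> (norm (E 0) * (\<Prod>i<n. b i)) * b n"
      using h(3) bn by (intro mult_mono) (auto intro: order_trans[OF norm_ge_zero])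
    then show ?thesis using h False split
      by (intro exI[of _ k] exI[of _ "\<lambda>z. h z * (z - a n)"]) (auto simp: mult_ac norm_mult)
  qed
qed

lemma leading_coeff_unique:
  assumes "entire g" "g 0 \<noteq> 0" "entire h" "h 0 \<noteq> 0" "\<And>z. z ^ k * g z = z ^ l * h z"
  shows "g 0 = h 0"
proof -
  have le: False if "entire g" "g 0 \<noteq> 0" "entire h" "h 0 \<noteq> 0" "\<And>z. z ^ k * g z = z ^ l * h z" "k < l" for g h k l
  proof -
    have "g 0 = 0 ^ (l - k) * h 0"
    proof (rule entire_mult_cancel[where f = g and g = "\<lambda>z. z ^ (l - k) * h z" and h = "\<lambda>z. z ^ k"])
      show "nonzero (\<lambda>z. z ^ k)" unfolding nonzero_def by (rule exI[of _ 1]) simp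
      show "g z * z ^ k = z ^ (l - k) * h z * z ^ k" for z
        using that(5)[of z] that(6) by (simp add: mult_ac flip: power_add)
    qed (use that in auto)
    with that show False by simp
  qed
  have "k = l" using le[of g h k l] le[of h g l k] assms by (metis linorder_neqE_nat)
  show ?thesis
  proof (rule entire_mult_cancel[where f = g and g = h and h = "\<lambda>z. z ^ k"])
    show "nonzero (\<lambda>z. z ^ k)" unfolding nonzero_def by (rule exI[of _ 1]) simp
    show "g z * z ^ k = h z * z ^ k" for z using assms(5)[of z] \<open>k = l\<close> by (simp add: mult_ac)
  qed (use assms in auto)
qed

text \<open>Jensen's formula at R'. The leading coefficient of g at 0 is at most |E 0| times a
  product of bounds, in which the listed zeros count with R and all others with R'; the gain n ln
  (R' / R) comes from the former. C depends on g alone, being minus the logarithm of that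
  coefficient.\<close>

lemma jensen_count:
  assumes g: "entire g" "nonzero g"
  shows "\<exists>C. \<forall>R R' n a F. 1 \<le> R \<longrightarrow> R < R' \<longrightarrow> (\<forall>z. norm z = R' \<longrightarrow> g z \<noteq> 0) \<longrightarrow> entire F \<longrightarrow>
     (\<forall>i<(n::nat). norm (a i) \<le> R) \<longrightarrow> (\<forall>z. g z = F z * (\<Prod>i<n. z - a i)) \<longrightarrow>
     n * ln (R' / R) \<le> circle_mean R' (\<lambda>z. ln (norm (g z))) + C"
proof -
  obtain k g1 where g1: "entire g1" "g1 0 \<noteq> 0" "\<And>z. g z = (z - 0) ^ k * g1 z"
    by (rule entire_factor_zero[OF g, where p = 0]) blast
  show ?thesis
  proof (intro exI allI impI)
    fix R R' :: real and n :: nat and a :: "nat \<Rightarrow> complex" and F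
    assume R: "1 \<le> R" "R < R'" and nz: "\<forall>z. norm z = R' \<longrightarrow> g z \<noteq> 0" and F: "entire F"
      and a: "\<forall>i<n. norm (a i) \<le> R" and gF: "\<forall>z. g z = F z * (\<Prod>i<n. z - a i)"
    have nF: "nonzero F" using g(2) gF by (auto simp: nonzero_def)
    from entire_factor_cball[OF F nF, of R'] obtain E m b where E: "entire E" "\<And>z. norm z \<le> R' \<Longrightarrow> E z \<noteq> 0"
      "\<And>i. i < m \<Longrightarrow> norm (b i) \<le> R' \<and> F (b i) = 0" "\<And>z. F z = E z * (\<Prod>i<(m::nat). z - b i)" by blast
    have b: "norm (b i) < R'" if "i < m" for i
      using E(3)[OF that] nz gF by (metis mult_eq_0_iff order_le_less)
    \<comment> \<open>All zeros in the disc of radius R': first those of F, then the given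
      ones.\<close>
    define d where "d i = (if i < m then b i else a (i - m))" for i
    define B where "B i = (if i < m then R' else R)" for i
    have pd: "(\<Prod>i<m+n. f (d i)) = (\<Prod>i<m. f (b i)) * (\<Prod>i<n. f (a i))" for f :: "complex \<Rightarrow> complex"
      by (induction n) (auto simp: d_def)
    have gd: "g z = E z * (\<Prod>i<m+n. z - d i)" for z
      using gF E(4) pd[of "\<lambda>x. z - x"] by simp
    have pB: "(\<Prod>i<m+n. B i) = R' ^ m * R ^ n"
      by (induction n) (auto simp: B_def)
    have dR: "norm (d i) < R'" if "i < m + n" for i
      using that a b R by (auto simp: d_def) (smt (verit) add_diff_inverse_nat add_less_cancel_left)
    have dB: "norm (d i) \<le> B i \<and> 1 \<le> B i" if "i < m + n" for i
      using that a b R by (auto simp: d_def B_def intro: less_imp_le)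
    from leading_coeff_factored[of E "m + n" d B] E R dB
    obtain l h where h: "entire h" "h 0 \<noteq> 0" "norm (h 0) \<le> norm (E 0) * (R' ^ m * R ^ n)" 
      "\<And>z. E z * (\<Prod>i<m+n. z - d i) = z ^ l * h z" unfolding pB by auto
    have "g1 0 = h 0"
      by (rule leading_coeff_unique[where k = k and l = l]) (use g1 h gd in auto)
    then have "ln (norm (g1 0)) \<le> ln (norm (E 0) * (R' ^ m * R ^ n))"
      using h(2,3) by (metis ln_mono zero_less_norm_iff)
    also have "\<dots> = ln (norm (E 0)) + m * ln R' + n * ln R"
      using E(2)[of 0] R by (simp add: ln_mult ln_realpow)
    finally have 1: "ln (norm (g1 0)) \<le> ln (norm (E 0)) + m * ln R' + n * ln R" .
    have "circle_mean R' (\<lambda>z. ln (norm (g z))) = ln (norm (E 0)) + (m + n) * ln R'"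
      using circle_mean_ln_factored[of E R' "m + n" d g] E R dR gd by simp
    moreover have "n * ln (R' / R) = n * ln R' - n * ln R" using R by (simp add: ln_div right_diff_distrib)
    ultimately show "n * ln (R' / R) \<le> circle_mean R' (\<lambda>z. ln (norm (g z))) + (- ln (norm (g1 0)))"
      using 1 by (simp add: distrib_right)
  qed
qed

text \<open>Jensen with an empty list of zeros. Such a lower bound allows a factor to be dropped
  from a product, and turns a bound on the mean of a maximum into one on the mean of an absolute
  value.\<close>

lemma circle_mean_ln_lower_bound:
  assumes g: "entire g" "nonzero g"
  shows "\<exists>C. \<forall>R>1. (\<forall>z. norm z = R \<longrightarrow> g z \<noteq> 0) \<longrightarrow> - C \<le> circle_mean R (\<lambda>z. ln (norm (g z)))"
proof -
  obtain C where C: "\<And>R R' n a F. 1 \<le> R \<Longrightarrow> R < R' \<Longrightarrow> (\<forall>z. norm z = R' \<longrightarrow> g z \<noteq> 0) \<Longrightarrow> entire F \<Longrightarrow>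
     (\<forall>i<(n::nat). norm (a i) \<le> R) \<Longrightarrow> (\<forall>z. g z = F z * (\<Prod>i<n. z - a i)) \<Longrightarrow>
     n * ln (R' / R) \<le> circle_mean R' (\<lambda>z. ln (norm (g z))) + C"
    using jensen_count[OF g] by blast
  show ?thesis
  proof (intro exI allI impI)
    fix R :: real assume "R > 1" "\<forall>z. norm z = R \<longrightarrow> g z \<noteq> 0"
    then show "- C \<le> circle_mean R (\<lambda>z. ln (norm (g z)))" using C[of 1 R g 0 "\<lambda>_. 0"] g by simp
  qed
qed

section \<open>Means of logarithms with a singularity near the circle\<close>

lemma circle_mean_ln_dist_sq:
  assumes r: "r > 0" and y: "y > 0"
  shows "circle_mean r (\<lambda>z. ln ((norm (z - b))\<^sup>2 + y\<^sup>2) / 2) \<le> ln (max r (norm b) + y)"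
proof -
  \<comment> \<open>p and q are the largest and the smallest value of sqrt (|z - b|^2 + y^2) on the
    circle; the modulus of \<alpha> minus a term of modulus \<beta> ranges between \<alpha> -
    \<beta> = q and \<alpha> + \<beta> = p.\<close>
  define p where "p = sqrt ((r + norm b)\<^sup>2 + y\<^sup>2)"
  define q where "q = sqrt ((r - norm b)\<^sup>2 + y\<^sup>2)"
  define \<alpha> where "\<alpha> = (p + q) / 2"
  define \<beta> where "\<beta> = (p - q) / 2"
  have q0: "q > 0" unfolding q_def using y by (simp add: add_nonneg_pos)
  have pq: "q \<le> p" unfolding p_def q_def using r by (auto simp: power2_eq_square algebra_simps)
  have p2: "p\<^sup>2 = (r + norm b)\<^sup>2 + y\<^sup>2" unfolding p_def by simp
  have q2: "q\<^sup>2 = (r - norm b)\<^sup>2 + y\<^sup>2" unfolding q_def by simp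
  have pr: "\<alpha> * \<beta> = r * norm b"
  proof -
    have "\<alpha> * \<beta> = (p\<^sup>2 - q\<^sup>2) / 4" by (simp add: \<alpha>_def \<beta>_def power2_eq_square field_simps)
    then show ?thesis unfolding p2 q2 by (simp add: power2_eq_square algebra_simps)
  qed
  have sq: "\<alpha>\<^sup>2 + \<beta>\<^sup>2 = r\<^sup>2 + (norm b)\<^sup>2 + y\<^sup>2"
  proof -
    have "\<alpha>\<^sup>2 + \<beta>\<^sup>2 = (p\<^sup>2 + q\<^sup>2) / 2" by (simp add: \<alpha>_def \<beta>_def power2_eq_square field_simps)
    then show ?thesis unfolding p2 q2 by (simp add: power2_eq_square algebra_simps)
  qed
  have ab: "0 \<le> \<beta>" "\<beta> < \<alpha>" "\<alpha> > 0" using q0 pq by (auto simp: \<alpha>_def \<beta>_def)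
  \<comment> \<open>The bounds r + |b| + y for p and | r - |b| | + y for q have the average max r
    |b| + y.\<close>
  have al: "\<alpha> \<le> max r (norm b) + y"
  proof -
    have "p\<^sup>2 \<le> (r + norm b + y)\<^sup>2" unfolding p2 using r y by (simp add: power2_eq_square algebra_simps)
    then have 1: "p \<le> r + norm b + y" by (rule power2_le_imp_le) (use r y in auto)
    have "q\<^sup>2 \<le> (\<bar>r - norm b\<bar> + y)\<^sup>2" unfolding q2 using y by (simp add: power2_sum)
    then have 2: "q \<le> \<bar>r - norm b\<bar> + y" by (rule power2_le_imp_le) (use y in auto)
    show ?thesis unfolding \<alpha>_def using 1 2 by auto
  qed
  \<comment> \<open>\<open>\<alpha>\<close> and \<open>\<beta>\<close> are chosen such that \<open>norm (z - b)\<^sup>2 + y\<^sup>2 = norm (E z)\<^sup>2\<close> on the circle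
    for a linear \<open>E\<close> without zeros in the disc.\<close>
  define E where "E = (\<lambda>z. of_real \<alpha> - of_real (\<beta> / r) * cnj (sgn b) * z)"
  have entE: "entire E" unfolding E_def entire_def by (intro holomorphic_intros)
  have s1: "norm (sgn b) \<le> 1" by (simp add: norm_sgn)
  have Enz: "E z \<noteq> 0" if "norm z \<le> r" for z
  proof
    assume "E z = 0"
    then have "norm (of_real \<alpha> :: complex) = norm (of_real (\<beta> / r) * cnj (sgn b) * z)" by (simp add: E_def)
    also have "\<dots> = (\<beta> / r) * norm (sgn b) * norm z" using ab r by (simp add: norm_mult norm_divide)
    also have "\<dots> \<le> (\<beta> / r) * 1 * r" using that s1 ab r by (intro mult_mono) auto
    finally show False using ab r by simp
  qed
  have En: "(norm (E z))\<^sup>2 = (norm (z - b))\<^sup>2 + y\<^sup>2" if z: "norm z = r" for z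
  proof -
    define X where "X = of_real (\<beta> / r) * cnj (sgn b) * z"
    have "(norm (E z))\<^sup>2 = \<alpha>\<^sup>2 - 2 * (\<alpha> * Re X) + (norm X)\<^sup>2"
      unfolding E_def X_def[symmetric] cmod_power2 by (simp add: power2_eq_square algebra_simps)
    moreover have "(norm X)\<^sup>2 = \<beta>\<^sup>2"
    proof (cases "b = 0")
      case True
      then have "\<beta> = 0" using pr ab by simp
      then show ?thesis by (simp add: X_def)
    next
      case False
      then have "norm X = \<beta>" using z r ab by (simp add: X_def norm_mult norm_divide norm_sgn)
      then show ?thesis by simp
    qed
    moreover have "\<alpha> * Re X = Re (cnj b * z)"
    proof -
      have "of_real (norm b) * sgn b = b" by (cases "b = 0") (auto simp: sgn_eq)
      then have cb: "cnj b = of_real (norm b) * cnj (sgn b)" by (metis complex_cnj_complex_of_real complex_cnj_mult)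
      have "\<alpha> * Re X = Re (of_real \<alpha> * X)" by simp
      also have "of_real \<alpha> * X = of_real (\<alpha> * \<beta> / r) * cnj (sgn b) * z" by (simp add: X_def)
      also have "\<alpha> * \<beta> / r = norm b" using pr r by simp
      finally show ?thesis unfolding cb .
    qed
    moreover have "(norm (z - b))\<^sup>2 = (norm z)\<^sup>2 + (norm b)\<^sup>2 - 2 * Re (cnj b * z)"
      unfolding cmod_power2 by (simp add: power2_eq_square algebra_simps)
    ultimately show ?thesis using sq z by simp
  qed
  have "circle_mean r (\<lambda>z. ln ((norm (z - b))\<^sup>2 + y\<^sup>2) / 2) = circle_mean r (\<lambda>z. ln (norm (E z)))"
  proof (rule circle_mean_cong)
    fix z :: complex assume z: "norm z = r"
    have "norm (E z) > 0" using Enz z by simp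
    then show "ln ((norm (z - b))\<^sup>2 + y\<^sup>2) / 2 = ln (norm (E z))" unfolding En[OF z, symmetric] by (simp add: ln_realpow)
  qed (use r in simp)
  also have "\<dots> = ln (norm (E 0))"
    using circle_mean_ln_factored[of E r 0 "\<lambda>_. 0" E] entE Enz r by simp
  also have "\<dots> = ln \<alpha>" using ab by (simp add: E_def)
  also have "\<dots> \<le> ln (max r (norm b) + y)" using al ab by (intro ln_mono) auto
  finally show ?thesis .
qed

lemma circle_mean_ln_dist:
  assumes r: "r > 0" and b: "norm b \<noteq> r"
  shows "circle_mean r (\<lambda>z. ln (norm (z - b))) = ln (max r (norm b))"
proof (cases "norm b < r")
  case True
  then show ?thesis using circle_mean_ln_factored[of "\<lambda>_. 1" r 1 "\<lambda>_. b" "\<lambda>z. z - b"] r by simp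
next
  case False
  then have "z - b \<noteq> 0" if "norm z \<le> r" for z using that b by auto
  then show ?thesis using circle_mean_ln_factored[of "\<lambda>z. z - b" r 0 "\<lambda>_. b" "\<lambda>z. z - b"] r b False by simp
qed

text \<open>The integrand is the excess of the regularised logarithm ln sqrt (|z - b|^2 + y^2) over
  ln |z - b|. The mean of the latter is known exactly, and the two means differ by at most ln (1 + y
  / max r |b|), however close b is to the circle.\<close>

lemma circle_mean_near:
  assumes r: "r > 0" and y: "y > 0" and b: "norm b \<noteq> r"
  shows "circle_mean r (\<lambda>z. ln (1 + (y / norm (z - b))\<^sup>2) / 2) \<le> y / r"
proof -
  have ne: "z \<noteq> b" if "norm z = r" for z using that b by auto
  have "circle_mean r (\<lambda>z. ln (1 + (y / norm (z - b))\<^sup>2) / 2) =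
        circle_mean r (\<lambda>z. ln ((norm (z - b))\<^sup>2 + y\<^sup>2) / 2 - ln (norm (z - b)))"
  proof (rule circle_mean_cong)
    fix z :: complex assume "norm z = r"
    then have n: "norm (z - b) > 0" using ne by auto
    have "1 + (y / norm (z - b))\<^sup>2 = ((norm (z - b))\<^sup>2 + y\<^sup>2) / (norm (z - b))\<^sup>2"
      using n by (simp add: power_divide add_divide_distrib)
    then have "ln (1 + (y / norm (z - b))\<^sup>2) = ln ((norm (z - b))\<^sup>2 + y\<^sup>2) - ln ((norm (z - b))\<^sup>2)"
      using n y by (simp add: ln_div add_pos_pos)
    then show "ln (1 + (y / norm (z - b))\<^sup>2) / 2 = ln ((norm (z - b))\<^sup>2 + y\<^sup>2) / 2 - ln (norm (z - b))"
      using n by (simp add: ln_realpow)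
  qed (use r in simp)
  also have "\<dots> = circle_mean r (\<lambda>z. ln ((norm (z - b))\<^sup>2 + y\<^sup>2) / 2) - circle_mean r (\<lambda>z. ln (norm (z - b)))"
  proof (rule circle_mean_diff)
    have "(norm (z - b))\<^sup>2 + y\<^sup>2 \<noteq> 0" for z using y by (metis add_nonneg_pos less_irrefl zero_le_power2 zero_less_power)
    then show "continuous_on (sphere 0 r) (\<lambda>z. ln ((norm (z - b))\<^sup>2 + y\<^sup>2) / 2)"
      by (intro continuous_intros) auto
    show "continuous_on (sphere 0 r) (\<lambda>z. ln (norm (z - b)))"
      by (intro continuous_intros) (use ne in auto)
  qed (use r in simp)
  also have "\<dots> \<le> ln (max r (norm b) + y) - ln (max r (norm b))"
    using circle_mean_ln_dist_sq[OF r y, of b] circle_mean_ln_dist[OF r b] by simp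
  also have "\<dots> = ln (1 + y / max r (norm b))"
  proof -
    define m where "m = max r (norm b)"
    have m: "m > 0" using r by (simp add: m_def)
    have "1 + y / m = (m + y) / m" using m by (simp add: add_divide_distrib)
    then show ?thesis using m y unfolding m_def[symmetric] by (simp add: ln_div)
  qed
  also have "\<dots> \<le> y / max r (norm b)" by (rule ln_add_one_self_le_self) (use r y in auto)
  also have "\<dots> \<le> y / r" using r y by (intro divide_left_mono) auto
  finally show ?thesis .
qed

text \<open>For large t the left side decays like x / t, but each term that
  \<open>circle_mean_near\<close> can handle decays quadratically. A sum over dyadic scales with
  weights 3 / 2^j restores the linear decay up to distance 2^J x: each dyadic range of t is paid for
  by the term of its own scale.\<close>

lemma ln_1p_dyadic:
  fixes x t :: real
  assumes "x > 0" "t > 0" "t \<le> 2 ^ J * x"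
  shows "ln (1 + x / t) \<le> 2 * (ln (1 + (x / t)\<^sup>2) / 2) + (\<Sum>j<J. 3 / 2 ^ j * (ln (1 + (2 ^ Suc j * x / t)\<^sup>2) / 2))"
  using assms(3)
proof (induction J)
  case 0
  then have "1 \<le> x / t" using assms by simp
  then have "x / t * 1 \<le> (x / t) * (x / t)" using assms by (intro mult_left_mono) auto
  then have "1 + x / t \<le> 1 + (x / t)\<^sup>2" by (simp add: power2_eq_square)
  then have "ln (1 + x / t) \<le> ln (1 + (x / t)\<^sup>2)" using assms by (intro ln_mono) (auto intro: add_pos_pos)
  then show ?case by simp
next
  case (Suc J)
  let ?L = "\<lambda>j. 3 / 2 ^ j * (ln (1 + (2 ^ Suc j * x / t)\<^sup>2) / 2) :: real"
  have nn: "?L j \<ge> 0" for j by simp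
  show ?case
  proof (cases "t \<le> 2 ^ J * x")
    case True
    from Suc.IH[OF True] nn[of J] show ?thesis unfolding sum.lessThan_Suc by linarith
  next
    case False
    have "ln (1 + x / t) \<le> x / t" by (rule ln_add_one_self_le_self) (use assms in auto)
    also have "x / t \<le> 1 / 2 ^ J" using False assms by (simp add: field_simps)
    \<comment> \<open>The weight 3 is chosen because 3 * ln 2 / 2 is at least 1, by ln 2 \<ge>
      2/3.\<close>
    also have "\<dots> \<le> ?L J"
    proof -
      have "1 \<le> 2 ^ Suc J * x / t" using Suc.prems assms by simp
      then have "1\<^sup>2 \<le> (2 ^ Suc J * x / t)\<^sup>2" by (intro power_mono) auto
      then have "ln 2 \<le> ln (1 + (2 ^ Suc J * x / t)\<^sup>2)" by (intro ln_mono) auto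
      then have "1 \<le> 3 * (ln (1 + (2 ^ Suc J * x / t)\<^sup>2) / 2)" using ln2_ge_two_thirds by linarith
      then have "1 / 2 ^ J * 1 \<le> 1 / 2 ^ J * (3 * (ln (1 + (2 ^ Suc J * x / t)\<^sup>2) / 2))" by (intro mult_left_mono) auto
      then show ?thesis by simp
    qed
    finally have "ln (1 + x / t) \<le> ?L J" .
    moreover have "0 \<le> (\<Sum>j<J. ?L j)" using nn by (intro sum_nonneg) auto
    moreover have "0 \<le> 2 * (ln (1 + (x / t)\<^sup>2) / 2)" by simp
    ultimately show ?thesis unfolding sum.lessThan_Suc by linarith
  qed
qed

text \<open>About log r dyadic scales contribute 6 x / r each, since the weight 3 / 2^j cancels the
  scale 2^(j+1) x; this is the origin of the factor ln r. The bound is uniform in b because it will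
  be summed over zeros.\<close>

lemma circle_mean_ln_1p:
  assumes x: "x \<ge> 0"
  shows "\<exists>K\<ge>0. \<forall>r b. 1 \<le> r \<longrightarrow> norm b \<noteq> r \<longrightarrow> circle_mean r (\<lambda>z. ln (1 + x / norm (z - b))) \<le> K * ((1 + ln r) / r)"
proof (cases "x = 0")
  case True
  then show ?thesis by (intro exI[of _ 0]) auto
next
  case False
  with x have x: "x > 0" by simp
  show ?thesis
  proof (intro exI[of _ "1 + 9 * x"] conjI allI impI)
    show "0 \<le> 1 + 9 * x" using x by simp
    fix r :: real and b :: complex assume r: "1 \<le> r" and b: "norm b \<noteq> r"
    \<comment> \<open>2^J is at least r, so beyond the distance 2^J x the integrand is at most 1 /
      r.\<close>
    define J where "J = nat \<lceil>log 2 r\<rceil>"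
    have l0: "log 2 r \<ge> 0" using r by simp
    have "real J \<ge> log 2 r" unfolding J_def by linarith
    then have "2 powr (log 2 r) \<le> 2 powr real J" by (intro powr_mono) auto
    then have J1: "r \<le> 2 ^ J" using r by (simp add: powr_realpow)
    have "real J \<le> log 2 r + 1" unfolding J_def using l0 by linarith
    also have "log 2 r \<le> 3 / 2 * ln r"
    proof -
      have "ln r / ln 2 \<le> ln r / (2/3)" using r ln2_ge_two_thirds by (intro divide_left_mono) auto
      then show ?thesis by (simp add: log_def)
    qed
    finally have J2: "real J \<le> 3 / 2 * ln r + 1" by simp
    have ne: "z \<noteq> b" if "norm z = r" for z using that b by auto
    let ?l = "\<lambda>y z. ln (1 + (y / norm (z - b))\<^sup>2) / 2"
    have nz1: "1 + w\<^sup>2 \<noteq> 0" for w :: real using zero_le_power2[of w] by linarith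
    have c: "continuous_on (sphere 0 r) (?l y)" for y
      by (intro continuous_intros) (use ne nz1 in auto)
    have nz2: "1 + x / norm (z - b) \<noteq> 0" for z
      using divide_nonneg_nonneg[OF less_imp_le[OF x] norm_ge_zero[of "z - b"]] by linarith
    have "circle_mean r (\<lambda>z. ln (1 + x / norm (z - b))) \<le>
      circle_mean r (\<lambda>z. (1 / r + 2 * ?l x z) + (\<Sum>j<J. 3 / 2 ^ j * ?l (2 ^ Suc j * x) z))"
    proof (rule circle_mean_mono)
      show "continuous_on (sphere 0 r) (\<lambda>z. ln (1 + x / norm (z - b)))"
        by (intro continuous_intros) (use ne nz2 in auto)
      show "continuous_on (sphere 0 r) (\<lambda>z. (1 / r + 2 * ?l x z) + (\<Sum>j<J. 3 / 2 ^ j * ?l (2 ^ Suc j * x) z))"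
        by (intro continuous_on_add continuous_on_const continuous_on_mult continuous_on_sum c)
      fix z :: complex assume z: "norm z = r"
      define t where "t = norm (z - b)"
      have t: "t > 0" using ne[OF z] by (simp add: t_def)
      have nn: "0 \<le> (\<Sum>j<J. 3 / 2 ^ j * ?l (2 ^ Suc j * x) z)" "0 \<le> ?l x z" by (auto intro!: sum_nonneg)
      show "ln (1 + x / norm (z - b)) \<le> (1 / r + 2 * ?l x z) + (\<Sum>j<J. 3 / 2 ^ j * ?l (2 ^ Suc j * x) z)"
      proof (cases "t \<le> 2 ^ J * x")
        case True
        have "0 \<le> 1 / r" using r by simp
        then show ?thesis using ln_1p_dyadic[OF x t True] unfolding t_def by linarith
      next
        case False
        have "ln (1 + x / t) \<le> x / t" by (rule ln_add_one_self_le_self) (use x t in auto)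
        also have "\<dots> \<le> 1 / 2 ^ J" using False x t by (simp add: field_simps)
        also have "\<dots> \<le> 1 / r" using J1 r by (intro divide_left_mono) auto
        finally show ?thesis using nn unfolding t_def by linarith
      qed
    qed (use r in simp)
    also have "\<dots> = (1 / r + 2 * circle_mean r (?l x)) + (\<Sum>j<J. 3 / 2 ^ j * circle_mean r (?l (2 ^ Suc j * x)))"
    proof -
      have ca: "continuous_on (sphere 0 r) (\<lambda>z. 1 / r + 2 * ?l x z)"
        by (intro continuous_on_add continuous_on_const continuous_on_mult c)
      have cb: "continuous_on (sphere 0 r) (\<lambda>z. 3 / 2 ^ j * ?l (2 ^ Suc j * x) z)" for j
        by (intro continuous_on_const continuous_on_mult c)
      have "circle_mean r (\<lambda>z. 1 / r + 2 * ?l x z) = circle_mean r (\<lambda>z. 1 / r) + circle_mean r (\<lambda>z. 2 * ?l x z)"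
        by (intro circle_mean_add continuous_on_const continuous_on_mult c) (use r in simp)
      then have A: "circle_mean r (\<lambda>z. 1 / r + 2 * ?l x z) = 1 / r + 2 * circle_mean r (?l x)"
        by (simp only: circle_mean_const circle_mean_cmult)
      have B: "circle_mean r (\<lambda>z. \<Sum>j<J. 3 / 2 ^ j * ?l (2 ^ Suc j * x) z) = (\<Sum>j<J. 3 / 2 ^ j * circle_mean r (?l (2 ^ Suc j * x)))"
      proof -
        have "circle_mean r (\<lambda>z. \<Sum>j<J. 3 / 2 ^ j * ?l (2 ^ Suc j * x) z) = (\<Sum>j<J. circle_mean r (\<lambda>z. 3 / 2 ^ j * ?l (2 ^ Suc j * x) z))"
          by (rule circle_mean_sum[OF cb]) (use r in simp)
        then show ?thesis by (simp only: circle_mean_cmult)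
      qed
      show ?thesis
        unfolding A[symmetric] B[symmetric] using r by (intro circle_mean_add ca continuous_on_sum cb) auto
    qed
    also have "\<dots> \<le> (1 / r + 2 * (x / r)) + (\<Sum>j<J. 3 / 2 ^ j * ((2 ^ Suc j * x) / r))"
      using r x b by (intro add_mono sum_mono mult_left_mono circle_mean_near order_refl) auto
    also have "(\<Sum>j<J. 3 / 2 ^ j * ((2 ^ Suc j * x) / r)) = J * (6 * x / r)" by simp
    also have "(1 / r + 2 * (x / r)) + J * (6 * x / r) \<le> (1 / r + 2 * (x / r)) + (3 / 2 * ln r + 1) * (6 * x / r)"
      using J2 r x by (intro add_left_mono mult_right_mono) auto
    \<comment> \<open>8 = 2 + 6, from the nearest scale and from rounding J up; 9 = 6 * 3/2, from J
      \<le> 3/2 ln r + 1.\<close>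
    also have "\<dots> = (1 + 8 * x + 9 * x * ln r) / r" using r by (simp add: field_simps)
    also have "\<dots> \<le> (1 + 9 * x) * (1 + ln r) / r"
    proof (rule divide_right_mono)
      have "0 \<le> ln r" using r by simp
      then show "1 + 8 * x + 9 * x * ln r \<le> (1 + 9 * x) * (1 + ln r)" using x by (simp add: algebra_simps)
    qed (use r in simp)
    finally show "circle_mean r (\<lambda>z. ln (1 + x / norm (z - b))) \<le> (1 + 9 * x) * ((1 + ln r) / r)" by simp
  qed
qed

section \<open>Logarithmic differences\<close>

lemma abs_ln_norm_diff_le:
  fixes u b :: complex
  assumes "u \<noteq> 0" "u + b \<noteq> 0"
  shows "\<bar>ln (norm (u + b)) - ln (norm u)\<bar> \<le> ln (1 + norm b / norm u) + ln (1 + norm b / norm (u + b))"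
proof -
  have gen: "ln (norm v) - ln (norm w) \<le> ln (1 + norm b / norm w)" if "v \<noteq> 0" "w \<noteq> 0" "norm v \<le> norm w + norm b" for v w :: complex
  proof -
    have "norm v \<le> norm w * (1 + norm b / norm w)" using that by (simp add: distrib_left)
    then have "ln (norm v) \<le> ln (norm w * (1 + norm b / norm w))" using that by (intro ln_mono) auto
    also have "\<dots> = ln (norm w) + ln (1 + norm b / norm w)"
      using that by (intro ln_mult_pos) (auto intro: add_pos_nonneg)
    finally show ?thesis by simp
  qed
  have "ln (norm (u + b)) - ln (norm u) \<le> ln (1 + norm b / norm u)"
    by (rule gen) (use assms norm_triangle_ineq in auto)
  moreover have "ln (norm u) - ln (norm (u + b)) \<le> ln (1 + norm b / norm (u + b))"
    by (rule gen) (use assms norm_triangle_ineq4[of "u + b" b] in auto)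
  moreover have "0 \<le> ln (1 + norm b / norm u)" "0 \<le> ln (1 + norm b / norm (u + b))" by auto
  ultimately show ?thesis by linarith
qed

text \<open>A Blaschke term is, up to a constant, the logarithm of the ratio of the distances to a
  and to its mirror image p = R^2 / cnj a. The shift by b changes each of the two logarithms by at
  most two terms ln (1 + |b| / dist), whence 4 K.\<close>

lemma circle_mean_blaschke_diff:
  "\<exists>K\<ge>0. \<forall>r R a. 1 \<le> r \<longrightarrow> r + norm b < R \<longrightarrow> norm a < R \<longrightarrow> norm a \<noteq> r \<longrightarrow> norm (a - b) \<noteq> r \<longrightarrow>
     continuous_on (sphere 0 r) (\<lambda>z. blaschke_term R a (z + b) - blaschke_term R a z) \<and>
     circle_mean r (\<lambda>z. \<bar>blaschke_term R a (z + b) - blaschke_term R a z\<bar>) \<le> K * ((1 + ln r) / r)"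
proof -
  obtain K where K: "K \<ge> 0" "\<And>r a. 1 \<le> r \<Longrightarrow> norm a \<noteq> r \<Longrightarrow> circle_mean r (\<lambda>z. ln (1 + norm b / norm (z - a))) \<le> K * ((1 + ln r) / r)"
    using circle_mean_ln_1p[of "norm b"] by auto
  show ?thesis
  proof (intro exI[of _ "4 * K"] conjI allI impI)
    show "0 \<le> 4 * K" using K by simp
    fix r R :: real and a :: complex
    assume r: "1 \<le> r" and R: "r + norm b < R" and a: "norm a < R" "norm a \<noteq> r" "norm (a - b) \<noteq> r"
    have rR: "r < R" using R by (meson add_increasing2 leD leI norm_ge_zero order_refl less_le_trans le_less_trans)
    have zb: "norm (z + b) < R" if "norm z = r" for z using norm_triangle_ineq[of z b] that R by linarith
    let ?c = "\<lambda>z. of_real R - cnj a * z / of_real R"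
    have za: "z \<noteq> a" "z + b \<noteq> a" if "norm z = r" for z using that a by auto
    have nz: "?c z \<noteq> 0" "?c (z + b) \<noteq> 0" if "norm z = r" for z
      using reflect_nonzero[OF a(1)] zb[OF that] that rR by auto
    show cont: "continuous_on (sphere 0 r) (\<lambda>z. blaschke_term R a (z + b) - blaschke_term R a z)"
      unfolding blaschke_term_def using rR r by (intro continuous_intros) (use za nz in auto)
    define T where "T = (\<lambda>p z. ln (1 + norm b / norm (z - p)) + ln (1 + norm b / norm (z - (p - b))))"
    have pos: "1 + norm b / w \<noteq> 0" if "w \<ge> 0" for w
      using divide_nonneg_nonneg[OF norm_ge_zero that, of b] by linarith
    have contT: "continuous_on (sphere 0 r) (T p)" if "norm p \<noteq> r" "norm (p - b) \<noteq> r" for p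
      unfolding T_def by (intro continuous_intros) (use that pos in auto)
    have meanT: "circle_mean r (T p) \<le> 2 * K * ((1 + ln r) / r)" if "norm p \<noteq> r" "norm (p - b) \<noteq> r" for p
    proof -
      have "circle_mean r (T p) = circle_mean r (\<lambda>z. ln (1 + norm b / norm (z - p))) + circle_mean r (\<lambda>z. ln (1 + norm b / norm (z - (p - b))))"
        unfolding T_def by (rule circle_mean_add; (intro continuous_intros)?) (use that pos r in auto)
      then show ?thesis using K(2)[OF r that(1)] K(2)[OF r that(2)] by simp
    qed
    have T1: "\<bar>ln (norm (z + b - a)) - ln (norm (z - a))\<bar> \<le> T a z" if "norm z = r" for z
      using abs_ln_norm_diff_le[of "z - a" b] za[OF that] by (simp add: T_def algebra_simps)
    have "circle_mean r (\<lambda>z. \<bar>blaschke_term R a (z + b) - blaschke_term R a z\<bar>) \<le> 4 * K * ((1 + ln r) / r)"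
    proof (cases "a = 0")
      \<comment> \<open>For a = 0 there is no mirror image; the reflected factor is the constant
        R.\<close>
      case True
      have "circle_mean r (\<lambda>z. \<bar>blaschke_term R a (z + b) - blaschke_term R a z\<bar>) \<le> circle_mean r (T a)"
        by (rule circle_mean_mono) (use cont contT a r T1 True in \<open>auto intro!: continuous_intros simp: blaschke_term_def\<close>)
      also have "\<dots> \<le> 2 * K * ((1 + ln r) / r)" by (rule meanT) (use a in auto)
      also have "\<dots> \<le> 4 * K * ((1 + ln r) / r)" using K r by (intro mult_right_mono) auto
      finally show ?thesis .
    next
      case False
      define p where "p = of_real (R\<^sup>2) / cnj a"
      have np: "norm p > R"
      proof -
        have "R * norm a < R * R" using a rR r by (intro mult_strict_left_mono) auto
        moreover have "norm p = R * R / norm a" using rR r by (simp add: p_def norm_divide norm_mult power2_eq_square)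
        ultimately show ?thesis using False by (simp add: pos_less_divide_eq)
      qed
      have np2: "norm (p - b) > r" using np R norm_triangle_ineq2[of p b] by linarith
      have cz: "?c z = - (cnj a / of_real R) * (z - p)" for z
        using False rR r by (simp add: p_def field_simps power2_eq_square)
      have zp: "z \<noteq> p" "z + b \<noteq> p" if "norm z = r" for z using np zb[OF that] that rR by auto
      have lc: "ln (norm (?c z)) = ln (norm (cnj a / of_real R)) + ln (norm (z - p))" if "z \<noteq> p" for z
        unfolding cz norm_mult using False rR r that by (subst ln_mult_pos) auto
      have T2: "\<bar>ln (norm (?c (z + b))) - ln (norm (?c z))\<bar> \<le> T p z" if "norm z = r" for z
        unfolding lc[OF zp(1)[OF that]] lc[OF zp(2)[OF that]]
        using abs_ln_norm_diff_le[of "z - p" b] zp[OF that] by (simp add: T_def algebra_simps)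
      have p2: "norm p \<noteq> r" "norm (p - b) \<noteq> r" using np np2 rR by auto
      have "circle_mean r (\<lambda>z. \<bar>blaschke_term R a (z + b) - blaschke_term R a z\<bar>) \<le> circle_mean r (\<lambda>z. T a z + T p z)"
      proof (rule circle_mean_mono)
        show "\<bar>blaschke_term R a (z + b) - blaschke_term R a z\<bar> \<le> T a z + T p z" if "norm z = r" for z
          using T1[OF that] T2[OF that] unfolding blaschke_term_def by linarith
      qed (use cont contT a p2 r in \<open>auto intro!: continuous_intros\<close>)
      also have "\<dots> = circle_mean r (T a) + circle_mean r (T p)"
        by (rule circle_mean_add) (use contT a p2 r in auto)
      also have "\<dots> \<le> 4 * K * ((1 + ln r) / r)" using meanT[OF a(2,3)] meanT[OF p2] by simp
      finally show ?thesis .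
    qed
    then show "circle_mean r (\<lambda>z. \<bar>blaschke_term R a (z + b) - blaschke_term R a z\<bar>) \<le> 4 * K * ((1 + ln r) / r)" .
  qed
qed

lemma poisson_jensen_factored:
  assumes g: "entire g" "nonzero g" and nz: "\<And>z. norm z = R \<Longrightarrow> g z \<noteq> 0"
  obtains E n a where "entire E" "\<And>i. i < (n::nat) \<Longrightarrow> norm (a i) < R \<and> g (a i) = 0" "\<And>z. g z = E z * (\<Prod>i<n. z - a i)"
    "\<And>w. norm w < R \<Longrightarrow> g w \<noteq> 0 \<Longrightarrow>
      ln (norm (g w)) = circle_mean R (\<lambda>\<zeta>. poisson_kernel \<zeta> w * ln (norm (g \<zeta>))) + (\<Sum>i<n. blaschke_term R (a i) w)"
proof -
  from entire_factor_cball[OF g, of R] obtain E n a where E: "entire E" "\<And>z. norm z \<le> R \<Longrightarrow> E z \<noteq> 0"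
    "\<And>i. i < n \<Longrightarrow> norm (a i) \<le> R \<and> g (a i) = 0" "\<And>z. g z = E z * (\<Prod>i<(n::nat). z - a i)" by blast
  have a: "norm (a i) < R \<and> g (a i) = 0" if "i < n" for i using E(3)[OF that] nz[of "a i"] by fastforce
  show thesis
    by (rule that[of E n a]) (use E a poisson_jensen[of E R n a g] in auto)
qed

text \<open>By Poisson-Jensen the difference of ln |g1 / g2| splits into a Poisson part and Blaschke
  terms. The first costs 1 / (R - r) times the mean of the absolute value of ln |g1 / g2|, the
  second (1 + ln r) / r per zero, with a number of zeros in the disc of radius R of order T R' / (R'
  - R). K and C depend only on g1, g2 and b.\<close>

theorem log_difference:
  assumes g1: "entire g1" "nonzero g1" and g2: "entire g2" "nonzero g2"
  shows "\<exists>K C. K \<ge> 0 \<and> C \<ge> 0 \<and> (\<forall>r R R' T. 1 \<le> r \<longrightarrow> r < R \<longrightarrow> 2 * norm b \<le> R - r \<longrightarrow> R < R' \<longrightarrow>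
     (\<forall>z. norm z = r \<longrightarrow> g1 z \<noteq> 0 \<and> g2 z \<noteq> 0 \<and> g1 (z + b) \<noteq> 0 \<and> g2 (z + b) \<noteq> 0) \<longrightarrow>
     (\<forall>z. norm z = R \<or> norm z = R' \<longrightarrow> g1 z \<noteq> 0 \<and> g2 z \<noteq> 0) \<longrightarrow>
     circle_mean R (\<lambda>z. max (ln (norm (g1 z))) (ln (norm (g2 z)))) \<le> T \<longrightarrow>
     circle_mean R' (\<lambda>z. ln (norm (g1 z))) \<le> T \<longrightarrow> circle_mean R' (\<lambda>z. ln (norm (g2 z))) \<le> T \<longrightarrow>
     circle_mean r (\<lambda>z. \<bar>(ln (norm (g1 (z + b))) - ln (norm (g1 z))) - (ln (norm (g2 (z + b))) - ln (norm (g2 z)))\<bar>)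
       \<le> K * (1 / (R - r) + R' / (R' - R) * ((1 + ln r) / r)) * (T + C))"
proof -
  obtain K where K: "K \<ge> 0" "\<And>r R a. 1 \<le> r \<Longrightarrow> r + norm b < R \<Longrightarrow> norm a < R \<Longrightarrow> norm a \<noteq> r \<Longrightarrow> norm (a - b) \<noteq> r \<Longrightarrow>
     continuous_on (sphere 0 r) (\<lambda>z. blaschke_term R a (z + b) - blaschke_term R a z) \<and>
     circle_mean r (\<lambda>z. \<bar>blaschke_term R a (z + b) - blaschke_term R a z\<bar>) \<le> K * ((1 + ln r) / r)"
    using circle_mean_blaschke_diff[of b] by blast
  obtain C1 where C1: "\<And>R R' n a F. 1 \<le> R \<Longrightarrow> R < R' \<Longrightarrow> (\<forall>z. norm z = R' \<longrightarrow> g1 z \<noteq> 0) \<Longrightarrow> entire F \<Longrightarrow>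
     (\<forall>i<(n::nat). norm (a i) \<le> R) \<Longrightarrow> (\<forall>z. g1 z = F z * (\<Prod>i<n. z - a i)) \<Longrightarrow>
     n * ln (R' / R) \<le> circle_mean R' (\<lambda>z. ln (norm (g1 z))) + C1"
    using jensen_count[OF g1] by blast
  obtain C2 where C2: "\<And>R R' n a F. 1 \<le> R \<Longrightarrow> R < R' \<Longrightarrow> (\<forall>z. norm z = R' \<longrightarrow> g2 z \<noteq> 0) \<Longrightarrow> entire F \<Longrightarrow>
     (\<forall>i<(n::nat). norm (a i) \<le> R) \<Longrightarrow> (\<forall>z. g2 z = F z * (\<Prod>i<n. z - a i)) \<Longrightarrow>
     n * ln (R' / R) \<le> circle_mean R' (\<lambda>z. ln (norm (g2 z))) + C2"
    using jensen_count[OF g2] by blast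
  define C where "C = \<bar>C1\<bar> + \<bar>C2\<bar>"
  show ?thesis
  \<comment> \<open>4 norm b comes from the kernel difference and K from each zero; both are doubled
    because both parts carry the factor 2 T + C.\<close>
  proof (rule exI[of _ "8 * norm b + 2 * K"], rule exI[of _ C], intro conjI allI impI)
    show "0 \<le> 8 * norm b + 2 * K" using K by simp
    show "0 \<le> C" by (simp add: C_def)
    fix r R R' T
    assume r: "1 \<le> r" and rR: "r < R" and bR: "2 * norm b \<le> R - r" and RR: "R < R'"
      and nzr: "\<forall>z. norm z = r \<longrightarrow> g1 z \<noteq> 0 \<and> g2 z \<noteq> 0 \<and> g1 (z + b) \<noteq> 0 \<and> g2 (z + b) \<noteq> 0"
      and nzR: "\<forall>z. norm z = R \<or> norm z = R' \<longrightarrow> g1 z \<noteq> 0 \<and> g2 z \<noteq> 0"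
      and T: "circle_mean R (\<lambda>z. max (ln (norm (g1 z))) (ln (norm (g2 z)))) \<le> T"
       "circle_mean R' (\<lambda>z. ln (norm (g1 z))) \<le> T" "circle_mean R' (\<lambda>z. ln (norm (g2 z))) \<le> T"
    have R1: "1 < R" and R0: "R > 0" using r rR by auto
    have rb: "r + norm b < R"
      using bR rR by (smt (verit) norm_ge_zero)
    have zb: "norm (z + b) < R" if "norm z = r" for z using norm_triangle_ineq[of z b] that rb by linarith
    obtain E1 n1 a1 where 1: "entire E1" "\<And>i. i < (n1::nat) \<Longrightarrow> norm (a1 i) < R \<and> g1 (a1 i) = 0" "\<And>z. g1 z = E1 z * (\<Prod>i<n1. z - a1 i)"
      "\<And>w. norm w < R \<Longrightarrow> g1 w \<noteq> 0 \<Longrightarrow>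
      ln (norm (g1 w)) = circle_mean R (\<lambda>\<zeta>. poisson_kernel \<zeta> w * ln (norm (g1 \<zeta>))) + (\<Sum>i<n1. blaschke_term R (a1 i) w)"
      by (rule poisson_jensen_factored[OF g1, of R]) (use nzR in auto)
    obtain E2 n2 a2 where 2: "entire E2" "\<And>i. i < (n2::nat) \<Longrightarrow> norm (a2 i) < R \<and> g2 (a2 i) = 0" "\<And>z. g2 z = E2 z * (\<Prod>i<n2. z - a2 i)"
      "\<And>w. norm w < R \<Longrightarrow> g2 w \<noteq> 0 \<Longrightarrow>
      ln (norm (g2 w)) = circle_mean R (\<lambda>\<zeta>. poisson_kernel \<zeta> w * ln (norm (g2 \<zeta>))) + (\<Sum>i<n2. blaschke_term R (a2 i) w)"
      by (rule poisson_jensen_factored[OF g2, of R]) (use nzR in auto)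
    have a1: "norm (a1 i) < R" "norm (a1 i) \<noteq> r" "norm (a1 i - b) \<noteq> r" if "i < n1" for i
      using 1(2)[OF that] nzr[rule_format, of "a1 i"] nzr[rule_format, of "a1 i - b"] by auto
    have a2: "norm (a2 i) < R" "norm (a2 i) \<noteq> r" "norm (a2 i - b) \<noteq> r" if "i < n2" for i
      using 2(2)[OF that] nzr[rule_format, of "a2 i"] nzr[rule_format, of "a2 i - b"] by auto
    define q where "q = (\<lambda>z. ln (norm (g1 z)) - ln (norm (g2 z)))"
    have cg1: "continuous_on (sphere 0 \<rho>) (\<lambda>z. ln (norm (g1 z)))" if "\<rho> = R \<or> \<rho> = R'" for \<rho>
      by (rule continuous_on_sphere_ln_norm) (use g1 nzR that in auto)
    have cg2: "continuous_on (sphere 0 \<rho>) (\<lambda>z. ln (norm (g2 z)))" if "\<rho> = R \<or> \<rho> = R'" for \<rho>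
      by (rule continuous_on_sphere_ln_norm) (use g2 nzR that in auto)
    have cq: "continuous_on (sphere 0 R) q" unfolding q_def by (intro continuous_on_diff cg1 cg2) auto
    have cp: "continuous_on (sphere 0 R) (\<lambda>\<zeta>. poisson_kernel \<zeta> w * v \<zeta>)"
      if "norm w < R" "continuous_on (sphere 0 R) v" for w v
      by (intro continuous_intros that) (use that in auto)
    have pq: "ln (norm (g1 w)) - ln (norm (g2 w)) = circle_mean R (\<lambda>\<zeta>. poisson_kernel \<zeta> w * q \<zeta>) 
        + (\<Sum>i<n1. blaschke_term R (a1 i) w) - (\<Sum>i<n2. blaschke_term R (a2 i) w)"
      if "norm w < R" "g1 w \<noteq> 0" "g2 w \<noteq> 0" for w
    proof -
      have "circle_mean R (\<lambda>\<zeta>. poisson_kernel \<zeta> w * q \<zeta>) =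
         circle_mean R (\<lambda>\<zeta>. poisson_kernel \<zeta> w * ln (norm (g1 \<zeta>)) - poisson_kernel \<zeta> w * ln (norm (g2 \<zeta>)))"
        by (simp add: q_def right_diff_distrib)
      also have "\<dots> = circle_mean R (\<lambda>\<zeta>. poisson_kernel \<zeta> w * ln (norm (g1 \<zeta>))) - circle_mean R (\<lambda>\<zeta>. poisson_kernel \<zeta> w * ln (norm (g2 \<zeta>)))"
        by (rule circle_mean_diff) (use cp[OF that(1)] cg1 cg2 R0 in auto)
      finally show ?thesis using 1(4)[OF that(1,2)] 2(4)[OF that(1,3)] by simp
    qed
    define \<Delta> where "\<Delta> = (\<lambda>a z. blaschke_term R a (z + b) - blaschke_term R a z)"
    define P where "P = (\<lambda>z \<zeta>. \<bar>poisson_kernel \<zeta> (z + b) - poisson_kernel \<zeta> z\<bar> * \<bar>q \<zeta>\<bar>)"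
    let ?D = "\<lambda>z. (ln (norm (g1 (z + b))) - ln (norm (g1 z))) - (ln (norm (g2 (z + b))) - ln (norm (g2 z)))"
    have pt: "\<bar>?D z\<bar> \<le> circle_mean R (P z) + ((\<Sum>i<n1. \<bar>\<Delta> (a1 i) z\<bar>) + (\<Sum>i<n2. \<bar>\<Delta> (a2 i) z\<bar>))" if z: "norm z = r" for z
    proof -
      have zR: "norm z < R" using z rR by simp
      have c: "continuous_on (sphere 0 R) (\<lambda>\<zeta>. poisson_kernel \<zeta> w * q \<zeta>)" if "norm w < R" for w
        by (rule cp[OF that cq])
      have "?D z = (ln (norm (g1 (z + b))) - ln (norm (g2 (z + b)))) - (ln (norm (g1 z)) - ln (norm (g2 z)))" by simp
      also have "\<dots> = (circle_mean R (\<lambda>\<zeta>. poisson_kernel \<zeta> (z + b) * q \<zeta>) - circle_mean R (\<lambda>\<zeta>. poisson_kernel \<zeta> z * q \<zeta>))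
          + ((\<Sum>i<n1. \<Delta> (a1 i) z) - (\<Sum>i<n2. \<Delta> (a2 i) z))"
        using pq[OF zb[OF z]] pq[OF zR] nzr z by (simp add: \<Delta>_def sum_subtractf)
      also have "circle_mean R (\<lambda>\<zeta>. poisson_kernel \<zeta> (z + b) * q \<zeta>) - circle_mean R (\<lambda>\<zeta>. poisson_kernel \<zeta> z * q \<zeta>) =
          circle_mean R (\<lambda>\<zeta>. poisson_kernel \<zeta> (z + b) * q \<zeta> - poisson_kernel \<zeta> z * q \<zeta>)"
        by (rule circle_mean_diff[symmetric]) (use c zb[OF z] zR R0 in auto)
      finally have D: "?D z = circle_mean R (\<lambda>\<zeta>. poisson_kernel \<zeta> (z + b) * q \<zeta> - poisson_kernel \<zeta> z * q \<zeta>)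
          + ((\<Sum>i<n1. \<Delta> (a1 i) z) - (\<Sum>i<n2. \<Delta> (a2 i) z))" .
      have "\<bar>circle_mean R (\<lambda>\<zeta>. poisson_kernel \<zeta> (z + b) * q \<zeta> - poisson_kernel \<zeta> z * q \<zeta>)\<bar>
          \<le> circle_mean R (\<lambda>\<zeta>. \<bar>poisson_kernel \<zeta> (z + b) * q \<zeta> - poisson_kernel \<zeta> z * q \<zeta>\<bar>)"
        by (rule circle_mean_abs_le) (use c zb[OF z] zR R0 in \<open>auto intro!: continuous_on_diff\<close>)
      also have "\<dots> = circle_mean R (P z)" by (simp add: P_def abs_mult left_diff_distrib flip: abs_mult)
      finally have A: "\<bar>circle_mean R (\<lambda>\<zeta>. poisson_kernel \<zeta> (z + b) * q \<zeta> - poisson_kernel \<zeta> z * q \<zeta>)\<bar> \<le> circle_mean R (P z)" .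
      have "\<bar>\<Sum>i<n1. \<Delta> (a1 i) z\<bar> \<le> (\<Sum>i<n1. \<bar>\<Delta> (a1 i) z\<bar>)" "\<bar>\<Sum>i<n2. \<Delta> (a2 i) z\<bar> \<le> (\<Sum>i<n2. \<bar>\<Delta> (a2 i) z\<bar>)"
        by (rule sum_abs)+
      then show ?thesis unfolding D using A by linarith
    qed
    have contP: "continuous_on (sphere 0 r \<times> sphere 0 R) (\<lambda>(z, \<zeta>). P z \<zeta>)"
    proof -
      have ne: "snd x \<noteq> fst x + b" "snd x \<noteq> fst x" if "x \<in> sphere 0 r \<times> sphere 0 R" for x :: "complex \<times> complex"
        using that zb[of "fst x"] rR by (cases x; force)+
      have "continuous_on (sphere 0 r \<times> sphere 0 R) (\<lambda>x. q (snd x))"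
        by (rule continuous_on_compose2[OF cq]) (auto intro!: continuous_intros)
      then show ?thesis unfolding P_def case_prod_unfold
        by (intro continuous_intros) (use ne in auto)
    qed
    have contD: "continuous_on (sphere 0 r) (\<lambda>z. \<bar>\<Delta> (a1 i) z\<bar>)" if "i < n1" for i
      unfolding \<Delta>_def using K(2)[OF r rb a1[OF that]] by (auto intro: continuous_on_rabs)
    have contD2: "continuous_on (sphere 0 r) (\<lambda>z. \<bar>\<Delta> (a2 i) z\<bar>)" if "i < n2" for i
      unfolding \<Delta>_def using K(2)[OF r rb a2[OF that]] by (auto intro: continuous_on_rabs)
    have cDD: "continuous_on (sphere 0 r) (\<lambda>z. \<bar>?D z\<bar>)"
    proof -
      have "continuous_on (sphere 0 r) (\<lambda>z. ln (norm (g1 (z + b))))" "continuous_on (sphere 0 r) (\<lambda>z. ln (norm (g1 z)))"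
        "continuous_on (sphere 0 r) (\<lambda>z. ln (norm (g2 (z + b))))" "continuous_on (sphere 0 r) (\<lambda>z. ln (norm (g2 z)))"
        using nzr g1 g2 by (auto intro!: continuous_on_sphere_ln_norm)
      then show ?thesis by (intro continuous_on_rabs continuous_on_diff)
    qed
    have cS: "continuous_on (sphere 0 r) (\<lambda>z. (\<Sum>i<n1. \<bar>\<Delta> (a1 i) z\<bar>))" "continuous_on (sphere 0 r) (\<lambda>z. (\<Sum>i<n2. \<bar>\<Delta> (a2 i) z\<bar>))"
      using contD contD2 by (auto intro!: continuous_on_sum)
    have cM: "continuous_on (sphere 0 r) (\<lambda>z. circle_mean R (P z))" using contP R0 by (intro continuous_on_circle_mean) auto
    have "circle_mean r (\<lambda>z. \<bar>?D z\<bar>) \<le> circle_mean r (\<lambda>z. circle_mean R (P z) + ((\<Sum>i<n1. \<bar>\<Delta> (a1 i) z\<bar>) + (\<Sum>i<n2. \<bar>\<Delta> (a2 i) z\<bar>)))"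
      by (rule circle_mean_mono) (use cDD cS cM pt r in \<open>auto intro!: continuous_on_add\<close>)
    also have "\<dots> = circle_mean r (\<lambda>z. circle_mean R (P z)) + circle_mean r (\<lambda>z. (\<Sum>i<n1. \<bar>\<Delta> (a1 i) z\<bar>) + (\<Sum>i<n2. \<bar>\<Delta> (a2 i) z\<bar>))"
      by (rule circle_mean_add) (use cS cM r in \<open>auto intro!: continuous_on_add\<close>)
    also have "circle_mean r (\<lambda>z. (\<Sum>i<n1. \<bar>\<Delta> (a1 i) z\<bar>) + (\<Sum>i<n2. \<bar>\<Delta> (a2 i) z\<bar>)) =
       circle_mean r (\<lambda>z. (\<Sum>i<n1. \<bar>\<Delta> (a1 i) z\<bar>)) + circle_mean r (\<lambda>z. (\<Sum>i<n2. \<bar>\<Delta> (a2 i) z\<bar>))"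
      by (rule circle_mean_add) (use cS r in auto)
    also have "circle_mean r (\<lambda>z. (\<Sum>i<n1. \<bar>\<Delta> (a1 i) z\<bar>)) = (\<Sum>i<n1. circle_mean r (\<lambda>z. \<bar>\<Delta> (a1 i) z\<bar>))"
      by (rule circle_mean_sum) (use contD r in auto)
    also have "circle_mean r (\<lambda>z. (\<Sum>i<n2. \<bar>\<Delta> (a2 i) z\<bar>)) = (\<Sum>i<n2. circle_mean r (\<lambda>z. \<bar>\<Delta> (a2 i) z\<bar>))"
      by (rule circle_mean_sum) (use contD2 r in auto)
    finally have main: "circle_mean r (\<lambda>z. \<bar>?D z\<bar>) \<le> circle_mean r (\<lambda>z. circle_mean R (P z)) +
        ((\<Sum>i<n1. circle_mean r (\<lambda>z. \<bar>\<Delta> (a1 i) z\<bar>)) + (\<Sum>i<n2. circle_mean r (\<lambda>z. \<bar>\<Delta> (a2 i) z\<bar>)))" .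
    define \<kappa> where "\<kappa> = (1 + ln r) / r"
    have k0: "\<kappa> \<ge> 0" using r by (simp add: \<kappa>_def)
    have s1: "(\<Sum>i<n1. circle_mean r (\<lambda>z. \<bar>\<Delta> (a1 i) z\<bar>)) \<le> n1 * (K * \<kappa>)"
      using sum_bounded_above[of "{..<n1}" "\<lambda>i. circle_mean r (\<lambda>z. \<bar>\<Delta> (a1 i) z\<bar>)" "K * \<kappa>"] K(2)[OF r rb a1]
      by (auto simp: \<Delta>_def \<kappa>_def)
    have s2: "(\<Sum>i<n2. circle_mean r (\<lambda>z. \<bar>\<Delta> (a2 i) z\<bar>)) \<le> n2 * (K * \<kappa>)"
      using sum_bounded_above[of "{..<n2}" "\<lambda>i. circle_mean r (\<lambda>z. \<bar>\<Delta> (a2 i) z\<bar>)" "K * \<kappa>"] K(2)[OF r rb a2]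
      by (auto simp: \<Delta>_def \<kappa>_def)
    \<comment> \<open>The inequality 1 - 1/x \<le> ln x at x = R' / R turns the Jensen count into a
      bound by R' / (R' - R).\<close>
    have lnRR: "ln (R' / R) \<ge> (R' - R) / R'"
    proof -
      have "ln (R / R') \<le> R / R' - 1" using R0 RR by (intro ln_le_minus_one) auto
      then show ?thesis using R0 RR by (simp add: ln_div diff_divide_distrib)
    qed
    have count: "real n \<le> R' / (R' - R) * (T + c)" if "real n * ln (R' / R) \<le> T + c" for n c
    proof -
      have "real n * ((R' - R) / R') \<le> real n * ln (R' / R)" using lnRR by (intro mult_left_mono) auto
      then have "real n * ((R' - R) / R') \<le> T + c" using that by linarith
      then show ?thesis using R0 RR by (simp add: field_simps)
    qed
    have n1: "real n1 \<le> R' / (R' - R) * (T + \<bar>C1\<bar>)"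
      using C1[of R R' E1 n1 a1] R1 RR nzR 1 T(2) by (intro count) fastforce
    have n2: "real n2 \<le> R' / (R' - R) * (T + \<bar>C2\<bar>)"
      using C2[of R R' E2 n2 a2] R1 RR nzR 2 T(3) by (intro count) fastforce
    \<comment> \<open>The Jensen count with an empty list of zeros is a lower bound for the
      mean.\<close>
    have low1: "- \<bar>C1\<bar> \<le> circle_mean R (\<lambda>z. ln (norm (g1 z)))"
      using C1[of 1 R g1 0 a1] R1 nzR g1 by simp
    have low2: "- \<bar>C2\<bar> \<le> circle_mean R (\<lambda>z. ln (norm (g2 z)))"
      using C2[of 1 R g2 0 a1] R1 nzR g2 by simp
    have cmax: "continuous_on (sphere 0 R) (\<lambda>z. max (ln (norm (g1 z))) (ln (norm (g2 z))))"
      by (intro continuous_on_max cg1 cg2) auto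
    \<comment> \<open>|x - y| = 2 max x y - x - y; the lower bounds for the single means turn the
      bound on the maximum into one on |q|.\<close>
    have "circle_mean R (\<lambda>z. \<bar>q z\<bar>) = circle_mean R (\<lambda>z. (2 * max (ln (norm (g1 z))) (ln (norm (g2 z))) - ln (norm (g1 z))) - ln (norm (g2 z)))"
      by (rule circle_mean_cong) (use R0 in \<open>auto simp: q_def max_def\<close>)
    also have "\<dots> = 2 * circle_mean R (\<lambda>z. max (ln (norm (g1 z))) (ln (norm (g2 z)))) - circle_mean R (\<lambda>z. ln (norm (g1 z))) - circle_mean R (\<lambda>z. ln (norm (g2 z)))"
      using cmax cg1 cg2 R0 by (simp add: circle_mean_diff circle_mean_cmult continuous_on_diff continuous_on_mult_left)
    finally have q1: "circle_mean R (\<lambda>z. \<bar>q z\<bar>) \<le> 2 * T + C" using low1 low2 T(1) by (simp add: C_def)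
    \<comment> \<open>After the exchange the kernel difference is averaged over z for fixed \<zeta>,
      where \<open>poisson_kernel_diff_mean\<close> applies.\<close>
    have "circle_mean r (\<lambda>z. circle_mean R (P z)) = circle_mean R (\<lambda>\<zeta>. circle_mean r (\<lambda>z. P z \<zeta>))"
      by (rule circle_mean_swap[OF contP]) (use r R0 in auto)
    also have "\<dots> \<le> circle_mean R (\<lambda>\<zeta>. 4 * norm b / (R - r) * \<bar>q \<zeta>\<bar>)"
    proof (rule circle_mean_mono)
      have "continuous_on (sphere 0 R \<times> sphere 0 r) (\<lambda>(\<zeta>, z). P z \<zeta>)"
        unfolding case_prod_unfold
        by (rule continuous_on_compose2[OF contP, of _ "\<lambda>x. (snd x, fst x)", unfolded case_prod_unfold fst_conv snd_conv])
           (auto intro!: continuous_intros)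
      then show "continuous_on (sphere 0 R) (\<lambda>\<zeta>. circle_mean r (\<lambda>z. P z \<zeta>))"
        using r by (intro continuous_on_circle_mean) auto
      show "continuous_on (sphere 0 R) (\<lambda>\<zeta>. 4 * norm b / (R - r) * \<bar>q \<zeta>\<bar>)"
        using cq by (intro continuous_on_mult continuous_on_rabs continuous_on_const)
      fix \<zeta> :: complex assume z: "norm \<zeta> = R"
      have "circle_mean r (\<lambda>z. P z \<zeta>) = \<bar>q \<zeta>\<bar> * circle_mean r (\<lambda>z. \<bar>poisson_kernel \<zeta> (z + b) - poisson_kernel \<zeta> z\<bar>)"
        unfolding P_def by (simp add: circle_mean_cmult[symmetric] mult.commute)
      also have "\<dots> \<le> \<bar>q \<zeta>\<bar> * (4 * norm b / (R - r))"
        using poisson_kernel_diff_mean[OF _ z bR rR] r by (intro mult_left_mono) auto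
      finally show "circle_mean r (\<lambda>z. P z \<zeta>) \<le> 4 * norm b / (R - r) * \<bar>q \<zeta>\<bar>" by (simp add: mult.commute)
    qed (use R0 in simp)
    also have "\<dots> = 4 * norm b / (R - r) * circle_mean R (\<lambda>\<zeta>. \<bar>q \<zeta>\<bar>)" by (rule circle_mean_cmult)
    also have "\<dots> \<le> 4 * norm b / (R - r) * (2 * T + C)" using q1 rR by (intro mult_left_mono) auto
    finally have p1: "circle_mean r (\<lambda>z. circle_mean R (P z)) \<le> 4 * norm b / (R - r) * (2 * T + C)" .
    have "real n1 * (K * \<kappa>) + real n2 * (K * \<kappa>) = (real n1 + real n2) * (K * \<kappa>)" by (simp add: distrib_right)
    also have "\<dots> \<le> (R' / (R' - R) * (T + \<bar>C1\<bar>) + R' / (R' - R) * (T + \<bar>C2\<bar>)) * (K * \<kappa>)"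
      using n1 n2 K k0 by (intro mult_right_mono add_mono) auto
    also have "\<dots> = R' / (R' - R) * \<kappa> * K * (2 * T + C)"
    proof -
      have "(Z * (T + c) + Z * (T + d)) * (K * \<kappa>) = Z * \<kappa> * K * (2 * T + (c + d))" for Z c d
        by (simp add: algebra_simps)
      then show ?thesis unfolding C_def .
    qed
    finally have p2: "real n1 * (K * \<kappa>) + real n2 * (K * \<kappa>) \<le> R' / (R' - R) * \<kappa> * K * (2 * T + C)" .
    define X where "X = 1 / (R - r)"
    define Y where "Y = R' / (R' - R) * \<kappa>"
    have XY: "X \<ge> 0" "Y \<ge> 0" using rR RR R0 k0 by (auto simp: X_def Y_def)
    have TC: "0 \<le> 2 * T + C" using q1 circle_mean_mono[OF continuous_on_const[of _ 0] continuous_on_rabs[OF cq]] R0 by simp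
    have "circle_mean r (\<lambda>z. \<bar>?D z\<bar>) \<le> 4 * norm b * X * (2 * T + C) + Y * K * (2 * T + C)"
      using main p1 p2 s1 s2 unfolding X_def Y_def by simp
    also have "\<dots> = (4 * norm b * X + K * Y) * (2 * T + C)" by (simp add: algebra_simps)
    also have "\<dots> \<le> ((4 * norm b + K) * (X + Y)) * (2 * T + C)"
      using XY K TC by (intro mult_right_mono) (auto simp: algebra_simps)
    also have "\<dots> \<le> ((4 * norm b + K) * (X + Y)) * (2 * (T + C))"
      using XY K by (intro mult_left_mono) (auto simp: C_def)
    also have "\<dots> = (8 * norm b + 2 * K) * (X + Y) * (T + C)" by (simp add: algebra_simps)
    finally show "circle_mean r (\<lambda>z. \<bar>?D z\<bar>) \<le> (8 * norm b + 2 * K) * (1 / (R - r) + R' / (R' - R) * ((1 + ln r) / r)) * (T + C)"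
      unfolding X_def Y_def \<kappa>_def .
  qed
qed

section \<open>Shifted circle means and families without common zeros\<close>

text \<open>The moduli of the zeros form a countable set. On circles that avoid it all logarithms in
  question are continuous, so that neither integrable singularities nor exceptional sets of positive
  measure have to be handled.\<close>

lemma good_radius:
  assumes "countable F" "\<And>f. f \<in> F \<Longrightarrow> entire f \<and> nonzero f" "x < y"
  shows "\<exists>r. x < r \<and> r < y \<and> (\<forall>f\<in>F. \<forall>z. norm z = r \<longrightarrow> f z \<noteq> 0)"
proof -
  let ?B = "\<Union>f\<in>F. norm ` {z. f z = 0}"
  have "countable ?B" using assms countable_zeros_entire by (intro countable_UN countable_image) auto
  moreover have "uncountable {x<..<y}" using assms(3) by (simp add: uncountable_open_interval)
  ultimately have "\<not> {x<..<y} \<subseteq> ?B" using countable_subset by blast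
  then obtain r where "r \<in> {x<..<y}" "r \<notin> ?B" by blast
  then show ?thesis by (intro exI[of _ r]) force
qed

section \<open>Means over shifted circles\<close>

text \<open>A circle about b is not centred at 0, so ln |E| is replaced by its Poisson integral v:
  it is harmonic, dominates ln |E|, and has mean v b over that circle. Harnack's inequality on the
  disc of radius \<rho>, where ln |E| is bounded, compares v b with the mean of v over the circle of
  radius \<rho>, which equals the mean of ln |E| at R.\<close>

lemma circle_mean_shift_zero_free:
  assumes E: "entire E" and nz: "\<And>z. norm z \<le> \<rho> \<Longrightarrow> E z \<noteq> 0" and \<rho>: "\<rho> > 0" "2 * norm b \<le> \<rho>"
  shows "\<exists>C. \<forall>r R. 0 < r \<longrightarrow> \<rho> < R \<longrightarrow> r + norm b < R \<longrightarrow> (\<forall>z. norm z = R \<longrightarrow> E z \<noteq> 0) \<longrightarrow> (\<forall>z. norm z = r \<longrightarrow> E (z + b) \<noteq> 0) \<longrightarrow>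
    circle_mean r (\<lambda>z. ln (norm (E (z + b)))) \<le> 3 * circle_mean R (\<lambda>z. ln (norm (E z))) + C"
proof -
  have "continuous_on (cball 0 \<rho>) (\<lambda>z. ln (norm (E z)))" by (rule continuous_on_ln_norm) (use E nz in auto)
  then have "compact ((\<lambda>z. ln (norm (E z))) ` cball 0 \<rho>)" by (intro compact_continuous_image) auto
  then have "bounded ((\<lambda>z. ln (norm (E z))) ` cball 0 \<rho>)" by (rule compact_imp_bounded)
  then obtain B where B': "\<forall>x\<in>cball 0 \<rho>. \<bar>ln (norm (E x))\<bar> \<le> B"
    by (auto simp: bounded_iff)
  have B: "\<bar>ln (norm (E z))\<bar> \<le> B" if "norm z \<le> \<rho>" for z using B' that by simp
  show ?thesis
  proof (intro exI[of _ "2 * B"] allI impI)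
    fix r R assume r: "0 < r" and R: "\<rho> < R" "r + norm b < R" and nzR: "\<forall>z. norm z = R \<longrightarrow> E z \<noteq> 0"
      and nzr: "\<forall>z. norm z = r \<longrightarrow> E (z + b) \<noteq> 0"
    have R0: "R > 0" using R \<rho> by linarith
    define U where "U = (\<lambda>\<zeta>. ln (norm (E \<zeta>)))"
    have cU: "continuous_on (sphere 0 R) U" unfolding U_def by (rule continuous_on_sphere_ln_norm) (use E nzR in auto)
    define v where "v = (\<lambda>w. circle_mean R (\<lambda>\<zeta>. poisson_kernel \<zeta> w * U \<zeta>))"
    have swap: "circle_mean s (\<lambda>w. k w * v (w + d)) = circle_mean R (\<lambda>\<zeta>. circle_mean s (\<lambda>w. k w * poisson_kernel \<zeta> (w + d)) * U \<zeta>)"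
      if "0 < s" "s + norm d < R" "continuous_on (sphere 0 s) k" for s d k
    proof -
      have ne: "snd x \<noteq> fst x + d" if "x \<in> sphere 0 s \<times> sphere 0 R" for x
        using that norm_triangle_ineq[of "fst x" d] \<open>s + norm d < R\<close> by (cases x) auto
      have "continuous_on (sphere 0 s \<times> sphere 0 R) (\<lambda>x. U (snd x))"
        by (rule continuous_on_compose2[OF cU]) (auto intro!: continuous_intros)
      moreover have "continuous_on (sphere 0 s \<times> sphere 0 R) (\<lambda>x. k (fst x))"
        by (rule continuous_on_compose2[OF that(3)]) (auto intro!: continuous_intros)
      ultimately have c: "continuous_on (sphere 0 s \<times> sphere 0 R) (\<lambda>(w, \<zeta>). k w * (poisson_kernel \<zeta> (w + d) * U \<zeta>))"
        unfolding case_prod_unfold by (intro continuous_intros) (use ne in auto)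
      have "circle_mean s (\<lambda>w. k w * v (w + d)) = circle_mean s (\<lambda>w. circle_mean R (\<lambda>\<zeta>. k w * (poisson_kernel \<zeta> (w + d) * U \<zeta>)))"
        unfolding v_def circle_mean_cmult ..
      also have "\<dots> = circle_mean R (\<lambda>\<zeta>. circle_mean s (\<lambda>w. k w * (poisson_kernel \<zeta> (w + d) * U \<zeta>)))"
        by (rule circle_mean_swap[OF c]) (use that R0 in auto)
      also have "\<dots> = circle_mean R (\<lambda>\<zeta>. circle_mean s (\<lambda>w. U \<zeta> * (k w * poisson_kernel \<zeta> (w + d))))"
        by (simp only: mult.assoc mult.left_commute mult.commute)
      also have "\<dots> = circle_mean R (\<lambda>\<zeta>. circle_mean s (\<lambda>w. k w * poisson_kernel \<zeta> (w + d)) * U \<zeta>)"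
        unfolding circle_mean_cmult by (simp only: mult.commute)
      finally show ?thesis .
    qed
    have contv: "continuous_on (sphere 0 s) (\<lambda>w. v (w + d))" if "0 < s" "s + norm d < R" for s d
    proof -
      have ne: "snd x \<noteq> fst x + d" if "x \<in> sphere 0 s \<times> sphere 0 R" for x
        using that norm_triangle_ineq[of "fst x" d] \<open>s + norm d < R\<close> by (cases x) auto
      have "continuous_on (sphere 0 s \<times> sphere 0 R) (\<lambda>x. U (snd x))"
        by (rule continuous_on_compose2[OF cU]) (auto intro!: continuous_intros)
      then have "continuous_on (sphere 0 s \<times> sphere 0 R) (\<lambda>(w, \<zeta>). poisson_kernel \<zeta> (w + d) * U \<zeta>)"
        unfolding case_prod_unfold by (intro continuous_intros) (use ne in auto)
      then show ?thesis unfolding v_def using R0 by (intro continuous_on_circle_mean) auto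
    qed
    have Ev: "U w \<le> v w" if "norm w < R" "E w \<noteq> 0" for w
      unfolding v_def U_def by (rule ln_norm_le_poisson) (use E nzR that in auto)
    have zb: "norm (z + b) < R" if "norm z = r" for z using norm_triangle_ineq[of z b] that R by linarith
    have "circle_mean r (\<lambda>z. U (z + b)) \<le> circle_mean r (\<lambda>z. v (z + b))"
    proof (rule circle_mean_mono)
      show "continuous_on (sphere 0 r) (\<lambda>z. U (z + b))"
        unfolding U_def by (rule continuous_on_sphere_ln_norm) (use E nzr in auto)
    qed (use contv r R Ev zb nzr in auto)
    also have "\<dots> = circle_mean r (\<lambda>z. 1 * v (z + b))" by simp
    also have "\<dots> = circle_mean R (\<lambda>\<zeta>. circle_mean r (\<lambda>w. 1 * poisson_kernel \<zeta> (w + b)) * U \<zeta>)"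
      by (rule swap) (use r R in auto)
    also have "\<dots> = v b"
      unfolding v_def by (rule circle_mean_cong) (use r R R0 circle_mean_poisson_kernel_shift[of r b] in auto)
    finally have 1: "circle_mean r (\<lambda>z. U (z + b)) \<le> v b" .
    have b\<rho>: "norm b < \<rho>" using \<rho> by (smt (verit) norm_ge_zero)
    have ck: "continuous_on (sphere 0 \<rho>) (\<lambda>\<xi>. poisson_kernel \<xi> b)"
      by (intro continuous_intros) (use b\<rho> in auto)
    have cv: "continuous_on (sphere 0 \<rho>) v" using contv[of \<rho> 0] \<rho> R by simp
    have "circle_mean \<rho> (\<lambda>\<xi>. poisson_kernel \<xi> b * v (\<xi> + 0)) = circle_mean R (\<lambda>\<zeta>. circle_mean \<rho> (\<lambda>\<xi>. poisson_kernel \<xi> b * poisson_kernel \<zeta> (\<xi> + 0)) * U \<zeta>)"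
      by (rule swap) (use \<rho> R ck in auto)
    also have "\<dots> = v b"
      unfolding v_def
    proof (rule circle_mean_cong)
      fix \<zeta> :: complex assume "norm \<zeta> = R"
      then show "circle_mean \<rho> (\<lambda>\<xi>. poisson_kernel \<xi> b * poisson_kernel \<zeta> (\<xi> + 0)) * U \<zeta> = poisson_kernel \<zeta> b * U \<zeta>"
        using poisson_kernel_poisson[of \<rho> 0 \<zeta> b] \<rho> R b\<rho> by simp
    qed (use R0 in simp)
    finally have 2: "circle_mean \<rho> (\<lambda>\<xi>. poisson_kernel \<xi> b * v \<xi>) = v b" by simp
    have "circle_mean \<rho> (\<lambda>\<xi>. 1 * v (\<xi> + 0)) = circle_mean R (\<lambda>\<zeta>. circle_mean \<rho> (\<lambda>\<xi>. 1 * poisson_kernel \<zeta> (\<xi> + 0)) * U \<zeta>)"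
      by (rule swap) (use \<rho> R in auto)
    also have "\<dots> = circle_mean R U"
    proof (rule circle_mean_cong)
      fix \<zeta> :: complex assume \<zeta>: "norm \<zeta> = R"
      then have "\<zeta> \<noteq> 0" using R0 by auto
      then show "circle_mean \<rho> (\<lambda>\<xi>. 1 * poisson_kernel \<zeta> (\<xi> + 0)) * U \<zeta> = U \<zeta>"
        using circle_mean_poisson_kernel_shift[of \<rho> 0 \<zeta>] \<rho> R \<zeta> by simp
    qed (use R0 in simp)
    finally have 3: "circle_mean \<rho> v = circle_mean R U" by simp
    have vB: "0 \<le> v \<xi> + B" if "norm \<xi> = \<rho>" for \<xi>
    proof -
      have "\<bar>U \<xi>\<bar> \<le> B" unfolding U_def using B that by simp
      moreover have "U \<xi> \<le> v \<xi>" using that R nz by (intro Ev) auto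
      ultimately show ?thesis by linarith
    qed
    \<comment> \<open>Harnack's constant; it is at most 3 because 2 |b| \<le> \<rho>.\<close>
    have k3: "poisson_kernel \<xi> b \<le> 3" if "norm \<xi> = \<rho>" for \<xi>
    proof -
      have "poisson_kernel \<xi> b \<le> (\<rho> + norm b) / (\<rho> - norm b)" using poisson_kernel_bounds(2)[of b \<xi>] that b\<rho> by simp
      also have "\<dots> \<le> 3" using b\<rho> \<rho> by (simp add: field_simps)
      finally show ?thesis .
    qed
    \<comment> \<open>Adding B makes the averaged function nonnegative on the circle, so that the
      kernel may be replaced by its bound 3.\<close>
    have "v b + B = circle_mean \<rho> (\<lambda>\<xi>. poisson_kernel \<xi> b * v \<xi>) + circle_mean \<rho> (\<lambda>\<xi>. B * poisson_kernel \<xi> b)"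
      unfolding circle_mean_cmult circle_mean_poisson_kernel[OF b\<rho>] 2 by simp
    also have "\<dots> = circle_mean \<rho> (\<lambda>\<xi>. poisson_kernel \<xi> b * v \<xi> + B * poisson_kernel \<xi> b)"
      by (rule circle_mean_add[symmetric]) (use ck cv \<rho> in \<open>auto intro!: continuous_on_mult continuous_on_const\<close>)
    also have "\<dots> \<le> circle_mean \<rho> (\<lambda>\<xi>. 3 * (v \<xi> + B))"
    proof (rule circle_mean_mono)
      fix \<xi> :: complex assume z: "norm \<xi> = \<rho>"
      have "poisson_kernel \<xi> b * (v \<xi> + B) \<le> 3 * (v \<xi> + B)" using k3[OF z] vB[OF z] by (rule mult_right_mono)
      then show "poisson_kernel \<xi> b * v \<xi> + B * poisson_kernel \<xi> b \<le> 3 * (v \<xi> + B)" by (simp add: algebra_simps)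
    qed (use ck cv \<rho> in \<open>auto intro!: continuous_on_mult continuous_on_const continuous_on_add\<close>)
    also have "\<dots> = 3 * (circle_mean \<rho> v + B)"
      unfolding circle_mean_cmult using cv \<rho> by (simp add: circle_mean_add continuous_on_const)
    finally have "v b \<le> 3 * circle_mean R U + 2 * B" unfolding 3 by simp
    with 1 show "circle_mean r (\<lambda>z. ln (norm (E (z + b)))) \<le> 3 * circle_mean R (\<lambda>z. ln (norm (E z))) + 2 * B"
      unfolding U_def by linarith
  qed
qed

text \<open>Zeros near the origin would destroy the lower bound for ln |E|, so those in the disc of
  radius \<rho> are split off. Each linear factor has mean exactly ln R on the large circle and at
  most ln R plus a constant on the shifted one.\<close>

theorem circle_mean_shift:
  assumes g: "entire g" "nonzero g"
  shows "\<exists>C. \<forall>r R. 1 \<le> r \<longrightarrow> 2 * norm b + 1 < R \<longrightarrow> r + norm b < R \<longrightarrow> (\<forall>z. norm z = R \<longrightarrow> g z \<noteq> 0) \<longrightarrow> (\<forall>z. norm z = r \<longrightarrow> g (z + b) \<noteq> 0) \<longrightarrow>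
    circle_mean r (\<lambda>z. ln (norm (g (z + b)))) \<le> 3 * circle_mean R (\<lambda>z. ln (norm (g z))) + C"
proof -
  define \<rho> where "\<rho> = 2 * norm b + 1"
  have \<rho>: "\<rho> > 0" "2 * norm b \<le> \<rho>" by (auto simp: \<rho>_def add_nonneg_pos)
  from entire_factor_cball[OF g, of \<rho>] obtain E n a where E: "entire E" "\<And>z. norm z \<le> \<rho> \<Longrightarrow> E z \<noteq> 0"
    "\<And>i. i < n \<Longrightarrow> norm (a i) \<le> \<rho> \<and> g (a i) = 0" "\<And>z. g z = E z * (\<Prod>i<(n::nat). z - a i)" by blast
  obtain C where C: "\<And>r R. 0 < r \<Longrightarrow> \<rho> < R \<Longrightarrow> r + norm b < R \<Longrightarrow> (\<forall>z. norm z = R \<longrightarrow> E z \<noteq> 0) \<Longrightarrow> (\<forall>z. norm z = r \<longrightarrow> E (z + b) \<noteq> 0) \<Longrightarrow>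
    circle_mean r (\<lambda>z. ln (norm (E (z + b)))) \<le> 3 * circle_mean R (\<lambda>z. ln (norm (E z))) + C"
    using circle_mean_shift_zero_free[OF E(1,2) \<rho>] by blast
  show ?thesis
  proof (intro exI[of _ "C + n * ln (1 + \<rho>)"] allI impI)
    fix r R assume r: "1 \<le> r" and R1: "2 * norm b + 1 < R" and R2: "r + norm b < R" and nzR: "\<forall>z. norm z = R \<longrightarrow> g z \<noteq> 0"
      and nzr: "\<forall>z. norm z = r \<longrightarrow> g (z + b) \<noteq> 0"
    have R\<rho>: "\<rho> < R" using R1 by (simp add: \<rho>_def)
    have R0: "R > 0" "R \<ge> 1" using R1 norm_ge_zero[of b] by linarith+
    have aR: "norm (a i) < R" if "i < n" for i using E(3)[OF that] R\<rho> by auto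
    have ER: "E z \<noteq> 0" if "norm z = R" for z using nzR that E(4) by auto
    have Er: "E (z + b) \<noteq> 0" if "norm z = r" for z using nzr that E(4) by auto
    have a1: "z \<noteq> a i" if "norm z = R" "i < n" for z i using aR that by auto
    have a2: "z + b \<noteq> a i" if "norm z = r" "i < n" for z i using nzr E(3) that by metis
    have cE: "continuous_on (sphere 0 r) (\<lambda>z. ln (norm (E (z + b))))" 
      by (rule continuous_on_sphere_ln_norm) (use E Er in auto)
    have cER: "continuous_on (sphere 0 R) (\<lambda>z. ln (norm (E z)))" 
      by (rule continuous_on_sphere_ln_norm) (use E ER in auto)
    have ca: "continuous_on (sphere 0 r) (\<lambda>z. ln (norm (z + b - a i)))" if "i < n" for i
      by (intro continuous_intros) (use a2 that in auto)
    have caR: "continuous_on (sphere 0 R) (\<lambda>z. ln (norm (z - a i)))" if "i < n" for i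
      by (intro continuous_intros) (use a1 that in auto)
    have "circle_mean r (\<lambda>z. ln (norm (g (z + b)))) = circle_mean r (\<lambda>z. ln (norm (E (z + b))) + (\<Sum>i<n. ln (norm (z + b - a i))))"
    proof (rule circle_mean_cong)
      fix z :: complex assume z: "norm z = r"
      show "ln (norm (g (z + b))) = ln (norm (E (z + b))) + (\<Sum>i<n. ln (norm (z + b - a i)))"
        unfolding E(4) by (rule ln_norm_prod) (use a2[OF z] Er[OF z] in metis, rule Er[OF z])
    qed (use r in simp)
    also have "\<dots> = circle_mean r (\<lambda>z. ln (norm (E (z + b)))) + circle_mean r (\<lambda>z. \<Sum>i<n. ln (norm (z + b - a i)))"
      by (rule circle_mean_add) (use cE ca r in \<open>auto intro!: continuous_on_sum\<close>)
    also have "circle_mean r (\<lambda>z. \<Sum>i<n. ln (norm (z + b - a i))) = (\<Sum>i<n. circle_mean r (\<lambda>z. ln (norm (z + b - a i))))"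
      by (rule circle_mean_sum) (use ca r in auto)
    \<comment> \<open>3 ln R instead of ln R, so that the split-off zeros carry the same factor 3 as
      E; this only increases the bound since R \<ge> 1.\<close>
    also have "\<dots> \<le> (\<Sum>i<n. 3 * ln R + ln (1 + \<rho>))"
    proof (rule sum_mono)
      fix i assume "i \<in> {..<n}"
      then have i: "i < n" by simp
      have "circle_mean r (\<lambda>z. ln (norm (z + b - a i))) \<le> circle_mean r (\<lambda>z. 3 * ln R + ln (1 + \<rho>))"
      proof (rule circle_mean_mono)
        fix z :: complex assume z: "norm z = r"
        have "norm (z + b - a i) \<le> norm z + norm b + norm (a i)"
          using norm_triangle_ineq4[of "z + b" "a i"] norm_triangle_ineq[of z b] by linarith
        also have "\<dots> \<le> R + \<rho>" using z R2 E(3)[OF i] by auto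
        also have "\<dots> \<le> R * (1 + \<rho>)" using R0 \<rho> by (simp add: distrib_left)
        finally have "ln (norm (z + b - a i)) \<le> ln (R * (1 + \<rho>))" using a2[OF z i] by (intro ln_mono) auto
        also have "\<dots> = ln R + ln (1 + \<rho>)" using R0 \<rho> by (intro ln_mult_pos) auto
        also have "\<dots> \<le> 3 * ln R + ln (1 + \<rho>)" using R0 by simp
        finally show "ln (norm (z + b - a i)) \<le> 3 * ln R + ln (1 + \<rho>)" .
      qed (use ca[OF i] r in auto)
      then show "circle_mean r (\<lambda>z. ln (norm (z + b - a i))) \<le> 3 * ln R + ln (1 + \<rho>)" by simp
    qed
    also have "\<dots> = n * (3 * ln R + ln (1 + \<rho>))" by simp
    finally have A: "circle_mean r (\<lambda>z. ln (norm (g (z + b)))) \<le> circle_mean r (\<lambda>z. ln (norm (E (z + b)))) + n * (3 * ln R + ln (1 + \<rho>))" by simp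
    have "circle_mean R (\<lambda>z. ln (norm (g z))) = circle_mean R (\<lambda>z. ln (norm (E z)) + (\<Sum>i<n. ln (norm (z - a i))))"
    proof (rule circle_mean_cong)
      fix z :: complex assume z: "norm z = R"
      show "ln (norm (g z)) = ln (norm (E z)) + (\<Sum>i<n. ln (norm (z - a i)))"
        unfolding E(4) by (rule ln_norm_prod) (use a1[OF z] in metis, rule ER[OF z])
    qed (use R0 in simp)
    also have "\<dots> = circle_mean R (\<lambda>z. ln (norm (E z))) + circle_mean R (\<lambda>z. \<Sum>i<n. ln (norm (z - a i)))"
      by (rule circle_mean_add) (use cER caR R0 in \<open>auto intro!: continuous_on_sum\<close>)
    also have "circle_mean R (\<lambda>z. \<Sum>i<n. ln (norm (z - a i))) = (\<Sum>i<n. circle_mean R (\<lambda>z. ln (norm (z - a i))))"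
      by (rule circle_mean_sum) (use caR R0 in auto)
    also have "\<dots> = (\<Sum>i<n. ln R)"
      by (rule sum.cong) (use aR R0 circle_mean_ln_dist[of R] in \<open>force simp: max_def\<close>)+
    finally have B: "circle_mean R (\<lambda>z. ln (norm (g z))) = circle_mean R (\<lambda>z. ln (norm (E z))) + n * ln R" by simp
    have "circle_mean r (\<lambda>z. ln (norm (E (z + b)))) \<le> 3 * circle_mean R (\<lambda>z. ln (norm (E z))) + C"
      by (rule C) (use r R\<rho> R2 ER Er in auto)
    then show "circle_mean r (\<lambda>z. ln (norm (g (z + b)))) \<le> 3 * circle_mean R (\<lambda>z. ln (norm (g z))) + (C + n * ln (1 + \<rho>))"
      using A B by (simp add: algebra_simps)
  qed
qed

section \<open>Characteristics of finite families\<close>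

text \<open>The integrand of Cartan's characteristic up to a bounded term: the sum in place of the
  maximum changes it by at most ln (card D).\<close>

definition log_sum :: "nat set \<Rightarrow> (nat \<Rightarrow> complex \<Rightarrow> complex) \<Rightarrow> complex \<Rightarrow> real" where
  "log_sum D v z = ln (\<Sum>k\<in>D. norm (v k z))"

lemma continuous_on_log_sum:
  assumes "finite D" "\<And>k. k \<in> D \<Longrightarrow> entire (v k)" "\<And>z. z \<in> S \<Longrightarrow> \<exists>k\<in>D. v k z \<noteq> 0"
  shows "continuous_on S (log_sum D v)"
proof -
  have pos: "(\<Sum>k\<in>D. norm (v k z)) > 0" if "z \<in> S" for z
    using assms(1) assms(3)[OF that] by (auto intro: sum_pos2)
  have "continuous_on S (v k)" if "k \<in> D" for k
    using assms(2)[OF that] unfolding entire_def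
    by (meson holomorphic_on_imp_continuous_on holomorphic_on_subset subset_UNIV)
  then show ?thesis unfolding log_sum_def
    by (intro continuous_on_ln continuous_on_sum continuous_on_norm) (use pos in fastforce)+
qed

lemma ln_norm_le_log_sum:
  assumes "finite D" "k \<in> D" "v k z \<noteq> 0"
  shows "ln (norm (v k z)) \<le> log_sum D v z"
  unfolding log_sum_def by (intro ln_mono member_le_sum) (use assms in auto)

lemma log_sum_le_max:
  assumes "finite D" "\<exists>k\<in>D. v k z \<noteq> 0"
  obtains k where "k \<in> D" "v k z \<noteq> 0" "log_sum D v z \<le> ln (card D) + ln (norm (v k z))"
proof -
  have ne: "D \<noteq> {}" using assms by auto
  define M where "M = Max ((\<lambda>k. norm (v k z)) ` D)"
  have "M \<in> (\<lambda>k. norm (v k z)) ` D" unfolding M_def using assms(1) ne by (intro Max_in) auto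
  then obtain k where k: "k \<in> D" "M = norm (v k z)" by auto
  have le: "norm (v j z) \<le> M" if "j \<in> D" for j unfolding M_def using assms(1) that by (intro Max_ge) auto
  have "M > 0" using assms(2) le by (metis less_le_trans zero_less_norm_iff)
  have c: "card D > 0" using assms(1) ne by (simp add: card_gt_0_iff)
  have "(\<Sum>k\<in>D. norm (v k z)) \<le> card D * M" using sum_bounded_above[of D "\<lambda>k. norm (v k z)" M] le by simp
  moreover have "(\<Sum>k\<in>D. norm (v k z)) > 0" using assms by (auto intro: sum_pos2)
  ultimately have "log_sum D v z \<le> ln (card D * M)" unfolding log_sum_def by (intro ln_mono)
  also have "\<dots> = ln (card D) + ln M" using c \<open>M > 0\<close> by (intro ln_mult_pos) auto
  finally show thesis using that[of k] k \<open>M > 0\<close> by auto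
qed

text \<open>Subharmonicity is applied to the component that is largest at the given point; replacing
  the sum by it costs ln (card D).\<close>

lemma circle_mean_log_sum_mono:
  assumes D: "finite D" "\<And>k. k \<in> D \<Longrightarrow> entire (v k)" and nc: "\<And>z. \<exists>k\<in>D. v k z \<noteq> 0"
    and r: "0 < r" "r < R" and nzR: "\<And>k z. k \<in> D \<Longrightarrow> norm z = R \<Longrightarrow> v k z \<noteq> 0"
  shows "circle_mean r (log_sum D v) \<le> circle_mean R (log_sum D v) + ln (card D)"
proof -
  let ?U = "log_sum D v"
  have cU: "continuous_on S ?U" for S by (rule continuous_on_log_sum) (use D nc in auto)
  have R0: "R > 0" using r by simp
  have cp: "continuous_on (sphere 0 R) (\<lambda>\<zeta>. poisson_kernel \<zeta> z * u \<zeta>)" if "norm z < R" "continuous_on (sphere 0 R) u" for z u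
    by (intro continuous_intros that) (use that in auto)
  have pt: "?U z \<le> circle_mean R (\<lambda>\<zeta>. poisson_kernel \<zeta> z * ?U \<zeta>) + ln (card D)" if z: "norm z = r" for z
  proof -
    have zR: "norm z < R" using z r by simp
    obtain k where k: "k \<in> D" "v k z \<noteq> 0" "?U z \<le> ln (card D) + ln (norm (v k z))"
      by (rule log_sum_le_max[of D v z]) (use D nc in auto)
    have "ln (norm (v k z)) \<le> circle_mean R (\<lambda>\<zeta>. poisson_kernel \<zeta> z * ln (norm (v k \<zeta>)))"
      by (rule ln_norm_le_poisson) (use D k nzR zR in auto)
    also have "\<dots> \<le> circle_mean R (\<lambda>\<zeta>. poisson_kernel \<zeta> z * ?U \<zeta>)"
    proof (rule circle_mean_mono)
      show "continuous_on (sphere 0 R) (\<lambda>\<zeta>. poisson_kernel \<zeta> z * ln (norm (v k \<zeta>)))"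
        by (intro cp continuous_on_sphere_ln_norm zR) (use D k nzR in auto)
      show "continuous_on (sphere 0 R) (\<lambda>\<zeta>. poisson_kernel \<zeta> z * ?U \<zeta>)" by (intro cp cU zR)
      fix \<zeta> :: complex assume \<zeta>: "norm \<zeta> = R"
      show "poisson_kernel \<zeta> z * ln (norm (v k \<zeta>)) \<le> poisson_kernel \<zeta> z * ?U \<zeta>"
        using poisson_kernel_bounds(1)[of z \<zeta>] \<zeta> zR ln_norm_le_log_sum[of D k v \<zeta>] D k nzR
        by (intro mult_left_mono) auto
    qed (use R0 in simp)
    finally show ?thesis using k(3) by linarith
  qed
  have c2: "continuous_on (sphere 0 r \<times> sphere 0 R) (\<lambda>(z, \<zeta>). poisson_kernel \<zeta> z * ?U \<zeta>)"
  proof -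
    have "continuous_on (sphere 0 r \<times> sphere 0 R) (\<lambda>x. ?U (snd x))"
      by (rule continuous_on_compose2[OF cU[of UNIV]]) (auto intro!: continuous_intros)
    then show ?thesis unfolding case_prod_unfold by (intro continuous_intros) (use r in auto)
  qed
  have "circle_mean r ?U \<le> circle_mean r (\<lambda>z. circle_mean R (\<lambda>\<zeta>. poisson_kernel \<zeta> z * ?U \<zeta>) + ln (card D))"
    by (rule circle_mean_mono) (use pt r R0 c2 cU in \<open>auto intro!: continuous_on_add continuous_on_const continuous_on_circle_mean\<close>)
  also have "\<dots> = circle_mean r (\<lambda>z. circle_mean R (\<lambda>\<zeta>. poisson_kernel \<zeta> z * ?U \<zeta>)) + ln (card D)"
    using r R0 c2 by (subst circle_mean_add) (auto intro!: continuous_on_const continuous_on_circle_mean)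
  also have "circle_mean r (\<lambda>z. circle_mean R (\<lambda>\<zeta>. poisson_kernel \<zeta> z * ?U \<zeta>)) = circle_mean R (\<lambda>\<zeta>. circle_mean r (\<lambda>z. poisson_kernel \<zeta> z * ?U \<zeta>))"
    by (rule circle_mean_swap[OF c2]) (use r R0 in auto)
  also have "\<dots> = circle_mean R ?U"
  proof (rule circle_mean_cong)
    fix \<zeta> :: complex assume \<zeta>: "norm \<zeta> = R"
    then have "\<zeta> \<noteq> 0" using R0 by auto
    then have "circle_mean r (\<lambda>z. poisson_kernel \<zeta> (z + 0)) = 1"
      using circle_mean_poisson_kernel_shift[of r 0 \<zeta>] r \<zeta> by simp
    then show "circle_mean r (\<lambda>z. poisson_kernel \<zeta> z * ?U \<zeta>) = ?U \<zeta>"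
      using circle_mean_cmult[of r "?U \<zeta>" "poisson_kernel \<zeta>"] by (simp add: mult.commute)
  qed (use R0 in simp)
  finally show ?thesis .
qed

text \<open>Bounded characteristic means constant quotient. By Jensen a zero would make the mean
  grow like ln R, so both functions are zero-free; then ln |g1 / g2| is harmonic with bounded
  absolute mean, hence bounded above, and Liouville's theorem applies.\<close>

lemma proportional_of_bounded_mean:
  assumes g1: "entire g1" "nonzero g1" and g2: "entire g2" "nonzero g2"
    and bd: "\<And>X. \<exists>R>X. (\<forall>z. norm z = R \<longrightarrow> g1 z \<noteq> 0 \<and> g2 z \<noteq> 0) \<and> circle_mean R (\<lambda>z. max (ln (norm (g1 z))) (ln (norm (g2 z)))) \<le> M"
  shows "\<exists>k. k \<noteq> 0 \<and> (\<forall>z. g1 z = k * g2 z)"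
proof -
  have zf: "g p \<noteq> 0" if g: "entire g" "nonzero g" and bd: "\<And>X. \<exists>R>X. (\<forall>z. norm z = R \<longrightarrow> g z \<noteq> 0) \<and> circle_mean R (\<lambda>z. ln (norm (g z))) \<le> M" for g p
  proof
    assume 0: "g p = 0"
    obtain k E where E: "entire E" "E p \<noteq> 0" "\<And>z. g z = (z - p) ^ k * E z"
      by (rule entire_factor_zero[OF g, where p = p]) blast
    have "k \<noteq> 0" using E 0 by (cases k) auto
    then obtain l where l: "k = Suc l" by (cases k) auto
    obtain C where C: "\<And>R R' n a F. 1 \<le> R \<Longrightarrow> R < R' \<Longrightarrow> (\<forall>z. norm z = R' \<longrightarrow> g z \<noteq> 0) \<Longrightarrow> entire F \<Longrightarrow>
     (\<forall>i<(n::nat). norm (a i) \<le> R) \<Longrightarrow> (\<forall>z. g z = F z * (\<Prod>i<n. z - a i)) \<Longrightarrow>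
     n * ln (R' / R) \<le> circle_mean R' (\<lambda>z. ln (norm (g z))) + C"
      using jensen_count[OF g] by blast
    define R1 where "R1 = max 1 (norm p)"
    \<comment> \<open>Beyond this radius a single zero already forces a mean above M + 1.\<close>
    obtain R where R: "R > max R1 (R1 * exp (M + C + 1))" "\<forall>z. norm z = R \<longrightarrow> g z \<noteq> 0" "circle_mean R (\<lambda>z. ln (norm (g z))) \<le> M"
      using bd by blast
    have R1: "R1 \<ge> 1" "norm p \<le> R1" by (auto simp: R1_def)
    have "real 1 * ln (R / R1) \<le> circle_mean R (\<lambda>z. ln (norm (g z))) + C"
      by (rule C[where a = "\<lambda>_. p" and F = "\<lambda>z. (z - p) ^ l * E z"]) (use R R1 E l in auto)
    moreover
    have "exp (M + C + 1) < R / R1" using R R1 by (simp add: field_simps)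
    then have "ln (exp (M + C + 1)) < ln (R / R1)" using order.strict_trans[OF exp_gt_zero] by (subst ln_less_cancel_iff) auto
    then have "M + C + 1 < ln (R / R1)" by simp
    ultimately show False using R(3) by simp
  qed
  have m1: "circle_mean R (\<lambda>z. ln (norm (g1 z))) \<le> M \<and> circle_mean R (\<lambda>z. ln (norm (g2 z))) \<le> M"
    if "R > 0" "\<forall>z. norm z = R \<longrightarrow> g1 z \<noteq> 0 \<and> g2 z \<noteq> 0" "circle_mean R (\<lambda>z. max (ln (norm (g1 z))) (ln (norm (g2 z)))) \<le> M" for R
  proof -
    have c: "continuous_on (sphere 0 R) (\<lambda>z. ln (norm (g1 z)))" "continuous_on (sphere 0 R) (\<lambda>z. ln (norm (g2 z)))"
      using that g1 g2 by (auto intro!: continuous_on_sphere_ln_norm)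
    have "circle_mean R (\<lambda>z. ln (norm (g1 z))) \<le> circle_mean R (\<lambda>z. max (ln (norm (g1 z))) (ln (norm (g2 z))))"
      "circle_mean R (\<lambda>z. ln (norm (g2 z))) \<le> circle_mean R (\<lambda>z. max (ln (norm (g1 z))) (ln (norm (g2 z))))"
      by (rule circle_mean_mono; use c that in \<open>auto intro: continuous_on_max\<close>)+
    then show ?thesis using that(3) by linarith
  qed
  have z1: "g1 p \<noteq> 0" for p
  proof (rule zf[OF g1])
    show "\<exists>R>X. (\<forall>z. norm z = R \<longrightarrow> g1 z \<noteq> 0) \<and> circle_mean R (\<lambda>z. ln (norm (g1 z))) \<le> M" for X
      using bd[of "max X 0"] m1 by (metis max.strict_boundedE)
  qed
  have z2: "g2 p \<noteq> 0" for p
  proof (rule zf[OF g2])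
    show "\<exists>R>X. (\<forall>z. norm z = R \<longrightarrow> g2 z \<noteq> 0) \<and> circle_mean R (\<lambda>z. ln (norm (g2 z))) \<le> M" for X
      using bd[of "max X 0"] m1 by (metis max.strict_boundedE)
  qed
  obtain C1 where C1: "\<And>R. R > 1 \<Longrightarrow> (\<forall>z. norm z = R \<longrightarrow> g1 z \<noteq> 0) \<Longrightarrow> - C1 \<le> circle_mean R (\<lambda>z. ln (norm (g1 z)))"
    using circle_mean_ln_lower_bound[OF g1] by blast
  obtain C2 where C2: "\<And>R. R > 1 \<Longrightarrow> (\<forall>z. norm z = R \<longrightarrow> g2 z \<noteq> 0) \<Longrightarrow> - C2 \<le> circle_mean R (\<lambda>z. ln (norm (g2 z)))"
    using circle_mean_ln_lower_bound[OF g2] by blast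
  define Q where "Q = (\<lambda>z. g1 z / g2 z)"
  have Q: "entire Q" unfolding Q_def using g1 g2 z2 by (auto simp: entire_def intro!: holomorphic_intros)
  have Q0: "Q z \<noteq> 0" for z using z1 z2 by (simp add: Q_def)
  have lnQ: "ln (norm (Q z)) = ln (norm (g1 z)) - ln (norm (g2 z))" for z
    using z1 z2 by (simp add: Q_def norm_divide ln_div)
  have bound: "ln (norm (Q w)) \<le> 3 * (2 * M + C1 + C2)" for w
  proof -
    \<comment> \<open>R > 2 |w| bounds the Poisson kernel at w by 3, uniformly in w.\<close>
    obtain R where R: "R > 2 * norm w + 1" "circle_mean R (\<lambda>z. max (ln (norm (g1 z))) (ln (norm (g2 z)))) \<le> M"
      using bd by blast
    have R1: "R > 1" using R by (smt (verit) norm_ge_zero)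
    have c: "continuous_on (sphere 0 R) (\<lambda>z. ln (norm (g1 z)))" "continuous_on (sphere 0 R) (\<lambda>z. ln (norm (g2 z)))"
      "continuous_on (sphere 0 R) (\<lambda>z. ln (norm (Q z)))"
      using z1 z2 g1 g2 Q Q0 by (auto intro!: continuous_on_sphere_ln_norm)
    have "circle_mean R (\<lambda>z. \<bar>ln (norm (Q z))\<bar>) = circle_mean R (\<lambda>z. (2 * max (ln (norm (g1 z))) (ln (norm (g2 z))) - ln (norm (g1 z))) - ln (norm (g2 z)))"
      by (rule circle_mean_cong) (use R1 in \<open>auto simp: lnQ max_def\<close>)
    also have "\<dots> = 2 * circle_mean R (\<lambda>z. max (ln (norm (g1 z))) (ln (norm (g2 z)))) - circle_mean R (\<lambda>z. ln (norm (g1 z))) - circle_mean R (\<lambda>z. ln (norm (g2 z)))"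
      using c R1 by (simp add: circle_mean_diff circle_mean_cmult continuous_on_diff continuous_on_mult_left continuous_on_max)
    also have "\<dots> \<le> 2 * M + C1 + C2" using C1[OF R1] C2[OF R1] z1 z2 R(2) by auto
    finally have q1: "circle_mean R (\<lambda>z. \<bar>ln (norm (Q z))\<bar>) \<le> 2 * M + C1 + C2" .
    have wR: "norm w < R" using R by (smt (verit) norm_ge_zero)
    have "ln (norm (Q w)) \<le> circle_mean R (\<lambda>\<zeta>. poisson_kernel \<zeta> w * ln (norm (Q \<zeta>)))"
      by (rule ln_norm_le_poisson) (use Q Q0 wR in auto)
    also have "\<dots> \<le> circle_mean R (\<lambda>\<zeta>. 3 * \<bar>ln (norm (Q \<zeta>))\<bar>)"
    proof (rule circle_mean_mono)
      show "continuous_on (sphere 0 R) (\<lambda>\<zeta>. poisson_kernel \<zeta> w * ln (norm (Q \<zeta>)))"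
        by (intro continuous_on_mult c continuous_on_poisson_kernel continuous_on_id continuous_on_const) (use wR in auto)
      show "continuous_on (sphere 0 R) (\<lambda>\<zeta>. 3 * \<bar>ln (norm (Q \<zeta>))\<bar>)"
        by (intro continuous_on_mult continuous_on_const continuous_on_rabs c)
      fix \<zeta> :: complex assume z: "norm \<zeta> = R"
      have "poisson_kernel \<zeta> w \<le> (R + norm w) / (R - norm w)" using poisson_kernel_bounds(2)[of w \<zeta>] z wR by simp
      also have "\<dots> \<le> 3" using wR R by (simp add: field_simps)
      finally have k3: "poisson_kernel \<zeta> w \<le> 3" .
      have k0: "poisson_kernel \<zeta> w > 0" using poisson_kernel_bounds(1)[of w \<zeta>] z wR by simp
      have "poisson_kernel \<zeta> w * ln (norm (Q \<zeta>)) \<le> poisson_kernel \<zeta> w * \<bar>ln (norm (Q \<zeta>))\<bar>" using k0 by (intro mult_left_mono) auto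
      also have "\<dots> \<le> 3 * \<bar>ln (norm (Q \<zeta>))\<bar>" using k3 by (intro mult_right_mono) auto
      finally show "poisson_kernel \<zeta> w * ln (norm (Q \<zeta>)) \<le> 3 * \<bar>ln (norm (Q \<zeta>))\<bar>" .
    qed (use R1 in simp)
    also have "\<dots> = 3 * circle_mean R (\<lambda>\<zeta>. \<bar>ln (norm (Q \<zeta>))\<bar>)" by (rule circle_mean_cmult)
    also have "\<dots> \<le> 3 * (2 * M + C1 + C2)" using q1 by (intro mult_left_mono) auto
    finally show ?thesis .
  qed
  have "norm (Q w) \<le> exp (3 * (2 * M + C1 + C2))" for w
    using bound[of w] Q0[of w] by (metis exp_le_cancel_iff exp_ln zero_less_norm_iff)
  then have "bounded (range Q)" unfolding bounded_iff by blast
  then obtain k where k: "\<And>z. Q z = k" using Liouville_theorem[of Q] Q unfolding entire_def constant_on_def by auto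
  have "k \<noteq> 0" using Q0 k by metis
  moreover have "g1 z = k * g2 z" for z using k[of z] z2[of z] by (simp add: Q_def field_simps)
  ultimately show ?thesis by blast
qed

section \<open>Linear relations between products of shifted multipliers\<close>

lemma entire_det:
  assumes "\<And>a b. a < p \<Longrightarrow> b < p \<Longrightarrow> entire (A a b)"
  shows "entire (\<lambda>z. det (mat p p (\<lambda>(a, b). A a b z)))"
proof -
  have "det (mat p p (\<lambda>(a, b). A a b z)) = (\<Sum>\<pi> \<in> {\<pi>. \<pi> permutes {0..<p}}. signof \<pi> * (\<Prod>i\<in>{0..<p}. A i (\<pi> i) z))" for z
    by (subst det_def'[of _ p]) (auto intro!: sum.cong prod.cong)
  moreover have "entire (\<lambda>z. \<Sum>\<pi> \<in> {\<pi>. \<pi> permutes {0..<p}}. signof \<pi> * (\<Prod>i\<in>{0..<p}. A i (\<pi> i) z))"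
    by (intro entire_sum entire_intros entire_prod assms) auto
  ultimately show ?thesis by simp
qed

lemma norm_det_le:
  fixes A :: "nat \<Rightarrow> nat \<Rightarrow> complex"
  assumes "\<And>a b. a < p \<Longrightarrow> b < p \<Longrightarrow> norm (A a b) \<le> X a"
  shows "norm (det (mat p p (\<lambda>(a, b). A a b))) \<le> fact p * (\<Prod>a<p. X a)"
proof -
  have "det (mat p p (\<lambda>(a, b). A a b)) = (\<Sum>\<pi> \<in> {\<pi>. \<pi> permutes {0..<p}}. signof \<pi> * (\<Prod>i\<in>{0..<p}. A i (\<pi> i)))"
    by (subst det_def'[of _ p]) (auto intro!: sum.cong prod.cong)
  also have "norm \<dots> \<le> (\<Sum>\<pi> \<in> {\<pi>. \<pi> permutes {0..<p}}. norm (signof \<pi> * (\<Prod>i\<in>{0..<p}. A i (\<pi> i))))"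
    by (rule norm_sum)
  also have "\<dots> \<le> (\<Sum>\<pi> \<in> {\<pi>. \<pi> permutes {0..<p}}. \<Prod>a<p. X a)"
  proof (rule sum_mono)
    fix \<pi> assume "\<pi> \<in> {\<pi>. \<pi> permutes {0..<p}}"
    then have \<pi>: "\<pi> permutes {0..<p}" by simp
    have "norm (signof \<pi> * (\<Prod>i\<in>{0..<p}. A i (\<pi> i))) = (\<Prod>i\<in>{0..<p}. norm (A i (\<pi> i)))"
      by (auto simp: norm_mult sign_def prod_norm)
    also have "\<dots> \<le> (\<Prod>i\<in>{0..<p}. X i)"
      by (rule prod_mono) (use assms \<pi> in auto)
    finally show "norm (signof \<pi> * (\<Prod>i\<in>{0..<p}. A i (\<pi> i))) \<le> (\<Prod>a<p. X a)" by (simp add: atLeast0LessThan)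
  qed
  also have "\<dots> = fact p * (\<Prod>a<p. X a)" using card_permutations[of "{0..<p}" p] by simp
  finally show ?thesis .
qed

text \<open>The signed maximal minors of a p by p + 1 matrix: the cofactors of the last row of any
  square matrix that extends A by one row.\<close>

definition last_minor :: "nat \<Rightarrow> (nat \<Rightarrow> nat \<Rightarrow> complex) \<Rightarrow> nat \<Rightarrow> complex" where
  "last_minor p A b = (-1) ^ (p + b) * det (mat p p (\<lambda>(a, j). A a (if j < b then j else Suc j)))"

lemma cofactor_last_row:
  assumes "b < Suc p" "\<And>a j. a < p \<Longrightarrow> j < Suc p \<Longrightarrow> M $$ (a, j) = A a j" "M \<in> carrier_mat (Suc p) (Suc p)"
  shows "cofactor M p b = last_minor p A b"
proof -
  have "mat_delete M p b = mat p p (\<lambda>(a, j). A a (if j < b then j else Suc j))"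
    by (rule eq_matI) (use assms in \<open>auto simp: mat_delete_def\<close>)
  then show ?thesis by (simp add: cofactor_def last_minor_def)
qed

lemma last_minor_p: "last_minor p A p = det (mat p p (\<lambda>(a, j). A a j))"
proof -
  have "mat p p (\<lambda>(a, j). A a (if j < p then j else Suc j)) = mat p p (\<lambda>(a, j). A a j)"
    by (rule eq_matI) auto
  then show ?thesis by (simp add: last_minor_def)
qed

lemma entire_last_minor:
  assumes "\<And>a b. a < p \<Longrightarrow> b < Suc p \<Longrightarrow> entire (A a b)" "b < Suc p"
  shows "entire (\<lambda>z. last_minor p (\<lambda>a b. A a b z) b)"
  unfolding last_minor_def
  by (intro entire_intros entire_det[where A = "\<lambda>a j. A a (if j < b then j else Suc j)"] assms) auto

lemma norm_last_minor_le:
  assumes "\<And>a b. a < p \<Longrightarrow> b < Suc p \<Longrightarrow> norm (A a b) \<le> X a" "b < Suc p"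
  shows "norm (last_minor p A b) \<le> fact p * (\<Prod>a<p. X a)"
proof -
  have "norm (last_minor p A b) = norm (det (mat p p (\<lambda>(a, j). A a (if j < b then j else Suc j))))"
    by (simp add: last_minor_def norm_mult norm_power)
  also have "\<dots> \<le> fact p * (\<Prod>a<p. X a)" by (rule norm_det_le) (use assms in auto)
  finally show ?thesis .
qed

text \<open>Cramer's rule for one more unknown than equations.\<close>
lemma last_minor_kernel:
  assumes ker: "\<And>a. a < p \<Longrightarrow> (\<Sum>b<Suc p. A a b * x b) = 0" and b: "b < Suc p" "b' < Suc p"
  shows "last_minor p A b * x b' = last_minor p A b' * x b"
proof -
  \<comment> \<open>A is extended by the unit row with entry 1 at b. Then det M is the minor at b,
    and M sends x to x b times the last unit vector; multiplying by the adjugate gives the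
    claim.\<close>
  define M where "M = mat (Suc p) (Suc p) (\<lambda>(a, j). if a < p then A a j else if j = b then 1 else 0)"
  have M: "M \<in> carrier_mat (Suc p) (Suc p)" by (simp add: M_def)
  have cof: "cofactor M p j = last_minor p A j" if "j < Suc p" for j
    by (rule cofactor_last_row) (use that in \<open>auto simp: M_def\<close>)
  have "det M = (\<Sum>j<Suc p. M $$ (p, j) * cofactor M p j)"
    by (rule laplace_expansion_row[OF M]) simp
  also have "\<dots> = (\<Sum>j<Suc p. if j = b then last_minor p A j else 0)"
  proof (rule sum.cong)
    fix j assume "j \<in> {..<Suc p}"
    then have "M $$ (p, j) = (if j = b then 1 else 0)" "cofactor M p j = last_minor p A j"
      using cof[of j] by (auto simp: M_def)
    then show "M $$ (p, j) * cofactor M p j = (if j = b then last_minor p A j else 0)" by simp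
  qed simp
  also have "\<dots> = last_minor p A b" using b by simp
  finally have dM: "det M = last_minor p A b" .
  have adj: "(\<Sum>i<Suc p. cofactor M i b' * M $$ (i, j)) = (if j = b' then det M else 0)" if "j < Suc p" for j
  proof -
    have "(adj_mat M * M) $$ (b', j) = (det M \<cdot>\<^sub>m 1\<^sub>m (Suc p)) $$ (b', j)" using adj_mat(3)[OF M] by simp
    moreover have "(adj_mat M * M) $$ (b', j) = (\<Sum>i<Suc p. cofactor M i b' * M $$ (i, j))"
      using b that M by (simp add: times_mat_def scalar_prod_def adj_mat_def atLeast0LessThan)
    ultimately show ?thesis using b that by auto
  qed
  have row: "(\<Sum>j<Suc p. M $$ (i, j) * x j) = (if i = p then x b else 0)" if "i < Suc p" for i
  proof (cases "i < p")
    case True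
    then have "(\<Sum>j<Suc p. M $$ (i, j) * x j) = (\<Sum>j<Suc p. A i j * x j)"
      by (intro sum.cong) (auto simp: M_def)
    then show ?thesis using ker[OF True] True by simp
  next
    case False
    then have ip: "i = p" using that by simp
    have "(\<Sum>j<Suc p. M $$ (i, j) * x j) = (\<Sum>j<Suc p. if j = b then x j else 0)"
      by (intro sum.cong) (auto simp: M_def ip)
    then show ?thesis using b ip by simp
  qed
  have "det M * x b' = (\<Sum>j<Suc p. (if j = b' then det M else 0) * x j)"
  proof -
    have "(\<Sum>j<Suc p. (if j = b' then det M else 0) * x j) = (\<Sum>j<Suc p. if j = b' then det M * x j else 0)"
      by (intro sum.cong) auto
    then show ?thesis using b by simp
  qed
  also have "\<dots> = (\<Sum>j<Suc p. (\<Sum>i<Suc p. cofactor M i b' * M $$ (i, j)) * x j)"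
    by (intro sum.cong) (use adj in auto)
  also have "\<dots> = (\<Sum>i<Suc p. cofactor M i b' * (\<Sum>j<Suc p. M $$ (i, j) * x j))"
    unfolding sum_distrib_left sum_distrib_right by (subst sum.swap) (simp only: mult.assoc)
  also have "\<dots> = (\<Sum>i<Suc p. if i = p then cofactor M i b' * x b else 0)"
    by (intro sum.cong) (use row in auto)
  also have "\<dots> = last_minor p A b' * x b" using b cof by simp
  finally show ?thesis using dM by simp
qed

text \<open>The columns y b are either independent over the meromorphic functions, as witnessed by a
  minor, or satisfy an entire relation. If a p-minor is nonzero but all its borderings by one more
  row vanish, expanding along that row gives the relation; its last coefficient is the
  p-minor.\<close>

lemma minor_or_relation:
  fixes y :: "nat \<Rightarrow> 'i \<Rightarrow> complex \<Rightarrow> complex"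
  assumes "\<And>b i. b < p \<Longrightarrow> entire (y b i)"
  shows "(\<exists>\<rho> z. det (mat p p (\<lambda>(a, b). y b (\<rho> a) z)) \<noteq> 0) \<or>
    (\<exists>w. (\<forall>b<p. entire (w b)) \<and> (\<exists>b<p. nonzero (w b)) \<and> (\<forall>i z. (\<Sum>b<p. w b z * y b i z) = 0))"
  using assms
proof (induction p)
  case 0
  then show ?case by simp
next
  case (Suc p)
  then consider (minor) \<rho> z where "det (mat p p (\<lambda>(a, b). y b (\<rho> a) z)) \<noteq> 0"
    | (rel) w where "\<And>b. b < p \<Longrightarrow> entire (w b)" "\<exists>b<p. nonzero (w b)" "\<And>i z. (\<Sum>b<p. w b z * y b i z) = 0"
    by (metis less_Suc_eq)
  then show ?case
  proof cases
    case rel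
    obtain b where "b < p" "nonzero (w b)" using rel(2) by blast
    then have "b < Suc p" "nonzero (\<lambda>z. if b < p then w b z else 0)" by auto
    then have "\<exists>b<Suc p. nonzero ((\<lambda>b z. if b < p then w b z else 0) b)" by blast
    moreover have "(\<Sum>b<Suc p. (\<lambda>b z. if b < p then w b z else 0) b z * y b i z) = 0" for i z
      using rel(3)[where i = i and z = z] by simp
    moreover have "entire (\<lambda>z. if b < p then w b z else 0)" for b
      using rel(1) by (cases "b < p") auto
    ultimately show ?thesis
      by (intro disjI2 exI[of _ "\<lambda>b z. if b < p then w b z else 0"]) blast
  next
    case minor
    define B where "B i z = mat (Suc p) (Suc p) (\<lambda>(a, b). y b (if a < p then \<rho> a else i) z)" for i z
    show ?thesis
    proof (cases "\<exists>i z. det (B i z) \<noteq> 0")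
      case True
      then obtain i z where "det (B i z) \<noteq> 0" by blast
      then show ?thesis unfolding B_def
        by (intro disjI1 exI[of _ "\<lambda>a. if a < p then \<rho> a else i"] exI[of _ z])
    next
      case False
      define w where "w b z = last_minor p (\<lambda>a b. y b (\<rho> a) z) b" for b z
      have cof: "cofactor (B i z) p b = w b z" if "b < Suc p" for i z b
        unfolding w_def by (rule cofactor_last_row) (use that in \<open>auto simp: B_def\<close>)
      have "(\<Sum>b<Suc p. w b z * y b i z) = 0" for i z
      proof -
        have "0 = det (B i z)" using False by simp
        also have "\<dots> = (\<Sum>b<Suc p. B i z $$ (p, b) * cofactor (B i z) p b)"
          by (rule laplace_expansion_row) (auto simp: B_def)
        also have "\<dots> = (\<Sum>b<Suc p. w b z * y b i z)"
        proof (rule sum.cong)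
          fix b assume "b \<in> {..<Suc p}"
          then have "B i z $$ (p, b) = y b i z" "cofactor (B i z) p b = w b z"
            using cof[of b] by (auto simp: B_def)
          then show "B i z $$ (p, b) * cofactor (B i z) p b = w b z * y b i z" by simp
        qed simp
        finally show ?thesis by simp
      qed
      moreover have "entire (w b)" if "b < Suc p" for b
        unfolding w_def by (rule entire_last_minor) (use Suc.prems that in auto)
      moreover have "nonzero (w p)"
        using minor unfolding nonzero_def w_def last_minor_p by blast
      ultimately show ?thesis by (intro disjI2 exI[of _ w]) auto
    qed
  qed
qed

definition mult_prod :: "complex \<Rightarrow> (complex \<Rightarrow> complex) \<Rightarrow> nat \<Rightarrow> complex \<Rightarrow> complex" where
  "mult_prod c h i z = (\<Prod>l<i. h (z + of_nat l * c))"

lemma mult_prod_0 [simp]: "mult_prod c h 0 z = 1"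
  by (simp add: mult_prod_def)

lemma mult_prod_Suc: "mult_prod c h (Suc i) z = mult_prod c h i z * h (z + of_nat i * c)"
  by (simp add: mult_prod_def)

lemma mult_prod_Suc_shift: "mult_prod c h (Suc i) z = h z * mult_prod c h i (z + c)"
  unfolding mult_prod_def prod.lessThan_Suc_shift by (simp add: algebra_simps)

lemma entire_mult_prod [simp, intro]: "entire h \<Longrightarrow> entire (mult_prod c h i)"
  unfolding mult_prod_def by (intro entire_prod entire_shift)

lemma nonzero_mult_prod: "entire h \<Longrightarrow> nonzero h \<Longrightarrow> nonzero (mult_prod c h i)"
  unfolding mult_prod_def by (intro nonzero_prod) auto

lemma mult_prod_shift_eq:
  assumes "\<And>z. g (z + c) = h z * g z"
  shows "g (z + of_nat i * c) = mult_prod c h i z * g z"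
proof (induction i)
  case (Suc i)
  have "g (z + of_nat (Suc i) * c) = g ((z + of_nat i * c) + c)" by (simp add: algebra_simps)
  also have "\<dots> = h (z + of_nat i * c) * (mult_prod c h i z * g z)" unfolding assms Suc ..
  finally show ?case by (simp add: mult_prod_Suc mult_ac)
qed simp

section \<open>Solutions of minimal support\<close>

locale shift_system =
  fixes N :: "nat set" and h :: "nat \<Rightarrow> complex \<Rightarrow> complex" and c :: complex
  assumes finN: "finite N"
    and h: "\<And>k. k \<in> N \<Longrightarrow> entire (h k)" "\<And>k. k \<in> N \<Longrightarrow> nonzero (h k)"
begin

abbreviation H :: "nat \<Rightarrow> nat \<Rightarrow> complex \<Rightarrow> complex" where
  "H k \<equiv> mult_prod c (h k)"

text \<open>Imposing all i at once makes the solutions stable under the shift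
  (\<open>rel_shift\<close>). Components outside N vanish identically, so that \<open>supp\<close>
  stays inside N.\<close>

definition rel :: "(nat \<Rightarrow> complex \<Rightarrow> complex) \<Rightarrow> bool" where
  "rel v \<longleftrightarrow> (\<forall>k. entire (v k)) \<and> (\<forall>k. k \<notin> N \<longrightarrow> \<not> nonzero (v k)) \<and> (\<forall>i z. (\<Sum>k\<in>N. v k z * H k i z) = 0)"

definition supp :: "(nat \<Rightarrow> complex \<Rightarrow> complex) \<Rightarrow> nat set" where
  "supp v = {k. nonzero (v k)}"

text \<open>Circuits in the sense of matroid theory, for the columns \<open>H k\<close> over the
  meromorphic functions.\<close>

definition circuit :: "(nat \<Rightarrow> complex \<Rightarrow> complex) \<Rightarrow> bool" where
  "circuit v \<longleftrightarrow> rel v \<and> supp v \<noteq> {} \<and> (\<forall>u. rel u \<longrightarrow> supp u \<subset> supp v \<longrightarrow> supp u = {})"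

definition reduced_circuit :: "(nat \<Rightarrow> complex \<Rightarrow> complex) \<Rightarrow> bool" where
  "reduced_circuit v \<longleftrightarrow> circuit v \<and> (\<forall>z. \<exists>k\<in>supp v. v k z \<noteq> 0)"

lemma supp_subset: "rel v \<Longrightarrow> supp v \<subseteq> N"
  unfolding rel_def supp_def by auto

lemma finite_supp: "rel v \<Longrightarrow> finite (supp v)"
  using supp_subset finN finite_subset by blast

lemma not_supp: "k \<notin> supp v \<Longrightarrow> v k z = 0"
  unfolding supp_def nonzero_def by auto

lemma rel_sum_supp: "rel v \<Longrightarrow> (\<Sum>k\<in>supp v. v k z * H k i z) = 0"
proof -
  assume v: "rel v"
  have "(\<Sum>k\<in>supp v. v k z * H k i z) = (\<Sum>k\<in>N. v k z * H k i z)"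
    by (rule sum.mono_neutral_left) (use finN supp_subset[OF v] not_supp in auto)
  then show ?thesis using v by (simp add: rel_def)
qed

lemma rel_combine:
  assumes u: "rel u" and v: "rel v" and p: "entire p" and q: "entire q"
  shows "rel (\<lambda>k z. p z * u k z - q z * v k z)"
proof -
  have "(\<Sum>k\<in>N. (p z * u k z - q z * v k z) * H k i z) = p z * (\<Sum>k\<in>N. u k z * H k i z) - q z * (\<Sum>k\<in>N. v k z * H k i z)" for i z
    by (simp add: sum_distrib_left sum_subtractf left_diff_distrib mult.assoc)
  then show ?thesis using assms unfolding rel_def nonzero_def by auto
qed

text \<open>Equation i for the shifted solution is equation i + 1 for v at z - c, since
  \<open>H k (Suc i)\<close> begins with the factor h k.\<close>

lemma rel_shift:
  assumes v: "rel v"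
  shows "rel (\<lambda>k z. if k \<in> N then v k (z - c) * h k (z - c) else 0)"
proof -
  have "(\<Sum>k\<in>N. (if k \<in> N then v k (z - c) * h k (z - c) else 0) * H k i z) = 0" for i z
  proof -
    have "(\<Sum>k\<in>N. (if k \<in> N then v k (z - c) * h k (z - c) else 0) * H k i z) = (\<Sum>k\<in>N. v k (z - c) * H k (Suc i) (z - c))"
      by (rule sum.cong) (auto simp: mult_prod_Suc_shift)
    then show ?thesis using v by (simp add: rel_def)
  qed
  moreover have "entire (\<lambda>z. if k \<in> N then v k (z - c) * h k (z - c) else 0)" for k
    using v h by (cases "k \<in> N") (auto simp: rel_def)
  ultimately show ?thesis unfolding rel_def nonzero_def by auto
qed

text \<open>A support of least size among those that contain k is minimal altogether: a solution w
  with smaller support cannot contain k, and could then be used to eliminate another index from v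
  while keeping k.\<close>

lemma exists_circuit:
  assumes u: "rel u" and k: "k \<in> supp u"
  shows "\<exists>v. circuit v \<and> k \<in> supp v \<and> supp v \<subseteq> supp u"
proof -
  let ?P = "\<lambda>v. rel v \<and> k \<in> supp v \<and> supp v \<subseteq> supp u"
  have "?P u" using u k by auto
  then obtain v where v: "?P v" "\<And>w. ?P w \<Longrightarrow> card (supp v) \<le> card (supp w)"
    using ex_has_least_nat[of ?P u "\<lambda>v. card (supp v)"] by blast
  have fin: "finite (supp v)" using v(1) finite_supp by blast
  have "supp w = {}" if w: "rel w" "supp w \<subset> supp v" for w
  proof (rule ccontr)
    assume "supp w \<noteq> {}"
    then obtain j where j: "j \<in> supp w" by blast
    have kw: "k \<notin> supp w"
      using v(2)[of w] w v(1) psubset_card_mono[OF fin w(2)] by auto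
    \<comment> \<open>Eliminates j; the component at k survives because w has none there.\<close>
    define x where "x = (\<lambda>i z. w j z * v i z - v j z * w i z)"
    have ent: "entire (w j)" "entire (v j)" using w v(1) by (auto simp: rel_def)
    have rx: "rel x" unfolding x_def by (rule rel_combine) (use v w ent in auto)
    have "x k z = w j z * v k z" for z using not_supp[OF kw] by (simp add: x_def)
    moreover have "nonzero (\<lambda>z. w j z * v k z)"
      by (rule nonzero_mult) (use ent j v(1) in \<open>auto simp: supp_def rel_def\<close>)
    ultimately have kx: "k \<in> supp x" by (auto simp: supp_def nonzero_def)
    have jx: "j \<notin> supp x" by (auto simp: supp_def x_def nonzero_def)
    have "supp x \<subseteq> supp v"
    proof
      fix i assume "i \<in> supp x"
      then obtain z where "x i z \<noteq> 0" by (auto simp: supp_def nonzero_def)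
      then have "v i z \<noteq> 0 \<or> w i z \<noteq> 0" by (auto simp: x_def)
      then show "i \<in> supp v" using not_supp w(2) by blast
    qed
    moreover have "j \<in> supp v" using j w by auto
    ultimately have "supp x \<subset> supp v" using jx by auto
    then have "card (supp x) < card (supp v)" by (rule psubset_card_mono[OF fin])
    moreover have "card (supp v) \<le> card (supp x)"
      by (rule v(2)) (use rx kx \<open>supp x \<subseteq> supp v\<close> v(1) in auto)
    ultimately show False by simp
  qed
  then show ?thesis using v(1) unfolding circuit_def by blast
qed

lemma exists_reduced_circuit:
  assumes v: "circuit v"
  shows "\<exists>v'. reduced_circuit v' \<and> supp v' = supp v"
proof -
  have r: "rel v" and ne: "supp v \<noteq> {}" using v by (auto simp: circuit_def)
  have "\<exists>P V. entire P \<and> nonzero P \<and> (\<forall>k\<in>supp v. entire (V k) \<and> (\<forall>z. v k z = P z * V k z)) \<and>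
           (\<forall>z. \<exists>k\<in>supp v. V k z \<noteq> 0)"
  proof (rule entire_gcd[OF finite_supp[OF r] ne])
    show "entire (v k)" for k using r unfolding rel_def by blast
    show "nonzero (v k)" if "k \<in> supp v" for k using that unfolding supp_def by blast
  qed
  then obtain P V where PV: "entire P" "nonzero P" "\<And>k. k \<in> supp v \<Longrightarrow> entire (V k)"
    "\<And>k z. k \<in> supp v \<Longrightarrow> v k z = P z * V k z" "\<And>z. \<exists>k\<in>supp v. V k z \<noteq> 0"
    by blast
  define v' where "v' = (\<lambda>k z. if k \<in> supp v then V k z else 0)"
  have ent: "entire (v' k)" for k using PV(3) by (cases "k \<in> supp v") (auto simp: v'_def)
  have vP: "v k z = P z * v' k z" for k z using PV(4) not_supp by (auto simp: v'_def)
  have supp': "supp v' = supp v"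
  proof -
    have "nonzero (v' k)" if "k \<in> supp v" for k
      using that vP unfolding supp_def nonzero_def by auto
    moreover have "k \<in> supp v" if "nonzero (v' k)" for k
      using that unfolding v'_def nonzero_def by (auto split: if_splits)
    ultimately show ?thesis unfolding supp_def[of v'] by blast
  qed
  have "(\<Sum>k\<in>N. v' k z * H k i z) = 0" for i z
  proof (rule entire_mult_eq_0[where f = "\<lambda>z. \<Sum>k\<in>N. v' k z * H k i z" and g = P])
    show "entire (\<lambda>z. \<Sum>k\<in>N. v' k z * H k i z)" using ent h by (intro entire_sum entire_intros entire_mult_prod) auto
    fix z
    have "(\<Sum>k\<in>N. v' k z * H k i z) * P z = (\<Sum>k\<in>N. v k z * H k i z)"
      unfolding vP sum_distrib_right by (rule sum.cong) (auto simp: mult_ac)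
    then show "(\<Sum>k\<in>N. v' k z * H k i z) * P z = 0" using r by (simp add: rel_def)
  qed (use PV in auto)
  then have "rel v'" unfolding rel_def using ent supp' supp_subset[OF r] by (auto simp: supp_def)
  then have "circuit v'" using v supp' unfolding circuit_def by simp
  moreover have "\<exists>k\<in>supp v'. v' k z \<noteq> 0" for z using PV(5)[of z] unfolding supp' by (auto simp: v'_def)
  ultimately show ?thesis using supp' unfolding reduced_circuit_def by blast
qed

text \<open>The shifted solution has its support inside that of v, so eliminating j between the two
  leaves a solution of strictly smaller support, which must be zero. This is the difference equation
  for v j / v k, cleared of denominators.\<close>

lemma circuit_shift:
  assumes v: "circuit v" and j: "j \<in> supp v" and k: "k \<in> supp v"
  shows "v j (z + c) * (v k z * h k z) = v k (z + c) * (v j z * h j z)"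
proof -
  have r: "rel v" using v by (simp add: circuit_def)
  define s where "s = (\<lambda>k z. if k \<in> N then v k (z - c) * h k (z - c) else 0)"
  have rs: "rel s" unfolding s_def by (rule rel_shift[OF r])
  define x where "x = (\<lambda>i z. v j z * s i z - s j z * v i z)"
  have rx: "rel x" unfolding x_def by (rule rel_combine) (use r rs in \<open>auto simp: rel_def\<close>)
  have "supp x \<subseteq> supp v - {j}"
  proof
    fix i assume "i \<in> supp x"
    then obtain z where z: "x i z \<noteq> 0" by (auto simp: supp_def nonzero_def)
    then have "i \<noteq> j" by (auto simp: x_def)
    moreover have "i \<in> supp v"
    proof (rule ccontr)
      assume "i \<notin> supp v"
      then have "v i y = 0" for y by (rule not_supp)
      then show False using z by (auto simp: x_def s_def split: if_splits)
    qed
    ultimately show "i \<in> supp v - {j}" by simp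
  qed
  then have "supp x \<subset> supp v" using j by blast
  then have "supp x = {}" using v rx unfolding circuit_def by blast
  then have "x k (z + c) = 0" using not_supp[of k x] by simp
  moreover have "j \<in> N" "k \<in> N" using j k supp_subset[OF r] by auto
  ultimately show ?thesis by (simp add: x_def s_def mult_ac)
qed

lemma circuit_shift_iter:
  assumes v: "circuit v" and j: "j \<in> supp v" and k: "k \<in> supp v"
  shows "v j (z + of_nat i * c) * (v k z * H k i z) = v k (z + of_nat i * c) * (v j z * H j i z)"
proof (induction i arbitrary: z)
  case (Suc i)
  have r: "rel v" using v by (simp add: circuit_def)
  have jN: "j \<in> N" "k \<in> N" using j k supp_subset[OF r] by auto
  have ent: "entire (v j)" "entire (v k)" "nonzero (v j)" "nonzero (v k)" using r j k by (auto simp: rel_def supp_def)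
  let ?p = "\<lambda>z. z + of_nat i * c"
  have *: "v j (?p z + c) * (v k z * H k (Suc i) z) = v k (?p z + c) * (v j z * H j (Suc i) z)"
  \<comment> \<open>The components at the intermediate point may vanish for particular z, so they
    are cancelled as entire functions.\<close>
  proof (rule entire_mult_cancel[where h = "\<lambda>z. v j (?p z) * v k (?p z)" and f = "\<lambda>z. v j (?p z + c) * (v k z * H k (Suc i) z)" and g = "\<lambda>z. v k (?p z + c) * (v j z * H j (Suc i) z)"])
    show "nonzero (\<lambda>z. v j (?p z) * v k (?p z))" by (rule nonzero_mult) (use ent in auto)
    have "entire (\<lambda>z. v j (z + (of_nat i * c + c)))" "entire (\<lambda>z. v k (z + (of_nat i * c + c)))" using ent by blast+
    then show "entire (\<lambda>z. v j (?p z + c) * (v k z * H k (Suc i) z))" "entire (\<lambda>z. v k (?p z + c) * (v j z * H j (Suc i) z))"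
      unfolding add.assoc using ent h jN by (intro entire_intros entire_mult_prod; simp)+
    show "entire (\<lambda>z. v j (?p z) * v k (?p z))" using ent by auto
    fix z
    have 1: "v j (?p z) * (v k z * H k i z) = v k (?p z) * (v j z * H j i z)" by (rule Suc)
    have 2: "v j (?p z + c) * (v k (?p z) * h k (?p z)) = v k (?p z + c) * (v j (?p z) * h j (?p z))"
      by (rule circuit_shift[OF v j k])
    have "v j (?p z + c) * (v k z * H k (Suc i) z) * (v j (?p z) * v k (?p z)) =
      (v j (?p z) * (v k z * H k i z)) * (v j (?p z + c) * (v k (?p z) * h k (?p z)))"
      by (simp add: mult_prod_Suc mult_ac)
    also have "\<dots> = (v k (?p z) * (v j z * H j i z)) * (v k (?p z + c) * (v j (?p z) * h j (?p z)))"
      unfolding 1 2 ..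
    also have "\<dots> = v k (?p z + c) * (v j z * H j (Suc i) z) * (v j (?p z) * v k (?p z))"
      by (simp add: mult_prod_Suc mult_ac)
    finally show "v j (?p z + c) * (v k z * H k (Suc i) z) * (v j (?p z) * v k (?p z)) = v k (?p z + c) * (v j z * H j (Suc i) z) * (v j (?p z) * v k (?p z))" .
  qed
  then show ?case by (simp add: algebra_simps)
qed simp

text \<open>By minimality all but one of the columns admit no relation, hence have a nonvanishing
  minor, and by Cramer's rule the signed minors are proportional to v. As v has no common zeros the
  factor L is entire, and expanding the determinants bounds L v by a product of row sums.\<close>

theorem circuit_minors:
  assumes v: "reduced_circuit v"
  shows "\<exists>p \<rho> L C. 0 < C \<and> entire L \<and> nonzero L \<and>
    (\<forall>z. (\<Sum>k\<in>supp v. norm (v k z)) * norm (L z) \<le> C * (\<Prod>a<(p::nat). \<Sum>k\<in>supp v. norm (H k (\<rho> a) z)))"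
proof -
  have cv: "circuit v" and nc: "\<And>z. \<exists>k\<in>supp v. v k z \<noteq> 0" using v by (auto simp: reduced_circuit_def)
  have r: "rel v" and ne: "supp v \<noteq> {}" using cv by (auto simp: circuit_def)
  have fin: "finite (supp v)" by (rule finite_supp[OF r])
  obtain p where p: "card (supp v) = Suc p" using fin ne by (metis card_gt_0_iff gr0_implies_Suc)
  obtain ks where ks: "bij_betw ks {..<Suc p} (supp v)"
    using ex_bij_betw_nat_finite[OF fin] p by (auto simp: atLeast0LessThan)
  have ksD: "ks b \<in> supp v" if "b < Suc p" for b using ks that by (auto simp: bij_betw_def)
  have ksinj: "ks b = ks b' \<longleftrightarrow> b = b'" if "b < Suc p" "b' < Suc p" for b b'
    using ks that by (auto simp: bij_betw_def inj_on_def)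
  have ksN: "ks b \<in> N" if "b < Suc p" for b using ksD[OF that] supp_subset[OF r] by blast
  have sum_ks: "(\<Sum>k\<in>supp v. F k) = (\<Sum>b<Suc p. F (ks b))" for F :: "nat \<Rightarrow> 'a :: comm_monoid_add"
    by (rule sum.reindex_bij_betw[OF ks, symmetric])
  have entH: "entire (H (ks b) i)" if "b < Suc p" for b i using h ksN[OF that] by auto
  \<comment> \<open>A relation among the first p columns would be a nonzero solution whose support
    misses \<open>ks p\<close>.\<close>
  have "\<not> (\<exists>w. (\<forall>b<p. entire (w b)) \<and> (\<exists>b<p. nonzero (w b)) \<and> (\<forall>i z. (\<Sum>b<p. w b z * H (ks b) i z) = 0))"
  proof
    assume "\<exists>w. (\<forall>b<p. entire (w b)) \<and> (\<exists>b<p. nonzero (w b)) \<and> (\<forall>i z. (\<Sum>b<p. w b z * H (ks b) i z) = 0)"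
    then obtain w where w: "\<And>b. b < p \<Longrightarrow> entire (w b)" "\<exists>b<p. nonzero (w b)" "\<And>i z. (\<Sum>b<p. w b z * H (ks b) i z) = 0"
      by blast
    define u where "u = (\<lambda>k z. \<Sum>b<p. if ks b = k then w b z else 0)"
    have uks: "u (ks b) z = w b z" if "b < p" for b z
    proof -
      have "u (ks b) z = (\<Sum>b'<p. if b' = b then w b' z else 0)"
        unfolding u_def by (rule sum.cong) (use ksinj that in auto)
      then show ?thesis using that by simp
    qed
    have u0: "u k z = 0" if "k \<notin> ks ` {..<p}" for k z
      unfolding u_def by (rule sum.neutral) (use that in auto)
    have "(\<Sum>k\<in>N. u k z * H k i z) = 0" for i z
    proof -
      have "(\<Sum>k\<in>N. u k z * H k i z) = (\<Sum>k\<in>ks ` {..<p}. u k z * H k i z)"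
        by (rule sum.mono_neutral_right) (use finN ksN u0 in auto)
      also have "\<dots> = (\<Sum>b<p. u (ks b) z * H (ks b) i z)"
        by (rule sum.reindex[unfolded o_def]) (use ksinj in \<open>auto simp: inj_on_def\<close>)
      also have "\<dots> = (\<Sum>b<p. w b z * H (ks b) i z)" by (rule sum.cong) (use uks in auto)
      finally show ?thesis using w(3) by simp
    qed
    moreover have "entire (u k)" for k
    proof -
      have "entire (\<lambda>z. if ks b = k then w b z else 0)" if "b < p" for b
        using w(1)[OF that] by (cases "ks b = k") auto
      then show ?thesis unfolding u_def by (intro entire_sum) auto
    qed
    moreover have "\<not> nonzero (u k)" if "k \<notin> N" for k
    proof -
      have "k \<notin> ks ` {..<p}" using that ksN by auto
      then show ?thesis using u0 by (auto simp: nonzero_def)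
    qed
    ultimately have ru: "rel u" unfolding rel_def by blast
    have "supp u \<subseteq> ks ` {..<p}" using u0 by (auto simp: supp_def nonzero_def)
    moreover have "ks p \<notin> ks ` {..<p}" using ksinj by force
    moreover have "ks ` {..<p} \<subseteq> supp v" using ksD by auto
    ultimately have "supp u \<subset> supp v" using ksD[of p] by blast
    then have "supp u = {}" using cv ru unfolding circuit_def by blast
    moreover obtain b where "b < p" "nonzero (w b)" using w(2) by blast
    then have "ks b \<in> supp u" using uks by (auto simp: supp_def nonzero_def)
    ultimately show False by simp
  qed
  then obtain \<rho> z0 where \<rho>: "det (mat p p (\<lambda>(a, b). H (ks b) (\<rho> a) z0)) \<noteq> 0"
    using minor_or_relation[of p "\<lambda>b i. H (ks b) i"] entH by (auto simp: less_SucI)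
  define m where "m = (\<lambda>b z. last_minor p (\<lambda>a b. H (ks b) (\<rho> a) z) b)"
  have entm: "entire (m b)" if "b < Suc p" for b
    unfolding m_def by (rule entire_last_minor[where A = "\<lambda>a b. H (ks b) (\<rho> a)"]) (use entH that in auto)
  have nzm: "nonzero (m p)" using \<rho> unfolding nonzero_def m_def last_minor_p by blast
  have entv: "entire (v k)" for k using r by (simp add: rel_def)
  have cross: "m b z * v (ks b') z = m b' z * v (ks b) z" if "b < Suc p" "b' < Suc p" for b b' z
    unfolding m_def
  proof (rule last_minor_kernel[OF _ that])
    fix a
    show "(\<Sum>b<Suc p. H (ks b) (\<rho> a) z * v (ks b) z) = 0"
      using rel_sum_supp[OF r, of z "\<rho> a"] unfolding sum_ks by (simp add: mult.commute)
  qed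
  have vp: "entire (v (ks p))" "nonzero (v (ks p))" using ksD[of p] entv by (auto simp: supp_def)
  \<comment> \<open>Near z some component of v is nonzero, and the cross relation expresses the
    quotient through it.\<close>
  have loc: "\<exists>e. isCont e z \<and> eventually (\<lambda>w. m p w = v (ks p) w * e w) (at z)" for z
  proof -
    obtain k where "k \<in> supp v" "v k z \<noteq> 0" using nc by blast
    moreover from this ks obtain b where "b < Suc p" "k = ks b"
      unfolding bij_betw_def by (metis imageE lessThan_iff)
    ultimately have b: "b < Suc p" "v (ks b) z \<noteq> 0" by auto
    have "isCont (\<lambda>w. m b w / v (ks b) w) z"
      using b entm entv by (intro continuous_intros entire_isCont) auto
    moreover have "nonzero (v (ks b))" using b by (auto simp: nonzero_def)
    then have "eventually (\<lambda>w. m p w = v (ks p) w * (m b w / v (ks b) w)) (at z)"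
      using entire_eventually_nz[OF entv, of "ks b" z]
      by (auto elim!: eventually_mono) (use cross[of p b] b in \<open>simp add: field_simps\<close>)
    ultimately show ?thesis by blast
  qed
  obtain L where L: "entire L" "\<And>z. m p z = v (ks p) z * L z"
    by (rule entire_divides[OF entm[OF lessI] vp loc]) blast
  have nzL: "nonzero L" using nzm L(2) by (auto simp: nonzero_def)
  have mL: "m b z = L z * v (ks b) z" if "b < Suc p" for b z
  proof (rule entire_mult_cancel[where h = "v (ks p)" and f = "m b" and g = "\<lambda>z. L z * v (ks b) z"])
    show "m b z * v (ks p) z = L z * v (ks b) z * v (ks p) z" for z
      using cross[OF that, of p z] L(2)[of z] by (simp add: mult_ac)
  qed (use entm that L entv vp in auto)
  show ?thesis
  \<comment> \<open>p! terms in each determinant, and p + 1 minors.\<close>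
  proof (rule exI[of _ p], rule exI[of _ \<rho>], rule exI[of _ L], rule exI[of _ "real (Suc p) * fact p"], intro conjI allI)
    fix z
    have "(\<Sum>k\<in>supp v. norm (v k z)) * norm (L z) = (\<Sum>b<Suc p. norm (m b z))"
      unfolding sum_ks sum_distrib_right by (rule sum.cong) (auto simp: mL norm_mult mult.commute)
    also have "\<dots> \<le> (\<Sum>b<Suc p. fact p * (\<Prod>a<p. \<Sum>k\<in>supp v. norm (H k (\<rho> a) z)))"
    proof (rule sum_mono)
      fix b assume b: "b \<in> {..<Suc p}"
      show "norm (m b z) \<le> fact p * (\<Prod>a<p. \<Sum>k\<in>supp v. norm (H k (\<rho> a) z))"
        unfolding m_def by (rule norm_last_minor_le) (use b ksD fin in \<open>auto intro!: member_le_sum\<close>)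
    qed
    finally show "(\<Sum>k\<in>supp v. norm (v k z)) * norm (L z) \<le> real (Suc p) * fact p * (\<Prod>a<p. \<Sum>k\<in>supp v. norm (H k (\<rho> a) z))"
      by simp
  qed (use L nzL in auto)
qed

end

section \<open>Growth estimates\<close>

definition sphere_free :: "real \<Rightarrow> (complex \<Rightarrow> complex) \<Rightarrow> bool" where
  "sphere_free r f \<longleftrightarrow> (\<forall>z. norm z = r \<longrightarrow> f z \<noteq> 0)"

lemma sphere_freeD: "sphere_free r f \<Longrightarrow> norm z = r \<Longrightarrow> f z \<noteq> 0"
  unfolding sphere_free_def by blast

lemma continuous_on_sphere_free:
  "entire f \<Longrightarrow> sphere_free r f \<Longrightarrow> continuous_on (sphere 0 r) (\<lambda>z. ln (norm (f z)))"
  by (rule continuous_on_sphere_ln_norm) (auto dest: sphere_freeD)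

lemma circle_mean_ln_le_log_sum:
  assumes D: "finite D" "\<And>k. k \<in> D \<Longrightarrow> entire (v k)" and nc: "\<And>z. \<exists>k\<in>D. v k z \<noteq> 0"
    and k: "k \<in> D" and r: "r \<ge> 0" and free: "sphere_free r (v k)"
  shows "circle_mean r (\<lambda>z. ln (norm (v k z))) \<le> circle_mean r (log_sum D v)"
proof (rule circle_mean_mono)
  show "continuous_on (sphere 0 r) (\<lambda>z. ln (norm (v k z)))"
    by (rule continuous_on_sphere_free) (use D k free in auto)
  show "continuous_on (sphere 0 r) (log_sum D v)" by (rule continuous_on_log_sum) (use D nc in auto)
  show "ln (norm (v k z)) \<le> log_sum D v z" if "norm z = r" for z
    by (rule ln_norm_le_log_sum) (use D k sphere_freeD[OF free that] in auto)
qed (rule r)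

text \<open>The lemma on the logarithmic difference with T expressed by the characteristic of the
  whole family at R'; passing from R to R' costs ln (card D).\<close>

lemma family_log_difference:
  assumes D: "finite D" "\<And>k. k \<in> D \<Longrightarrow> entire (v k)" "\<And>k. k \<in> D \<Longrightarrow> nonzero (v k)" and nc: "\<And>z. \<exists>k\<in>D. v k z \<noteq> 0"
    and jk: "j \<in> D" "k \<in> D"
  shows "\<exists>K C. K \<ge> 0 \<and> C \<ge> 0 \<and> (\<forall>r R R'. 1 \<le> r \<longrightarrow> r < R \<longrightarrow> 2 * norm b \<le> R - r \<longrightarrow> R < R' \<longrightarrow>
     (\<forall>i\<in>D. sphere_free r (v i) \<and> sphere_free r (\<lambda>z. v i (z + b)) \<and> sphere_free R (v i) \<and> sphere_free R' (v i)) \<longrightarrow>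
     circle_mean r (\<lambda>z. \<bar>(ln (norm (v j (z + b))) - ln (norm (v j z))) - (ln (norm (v k (z + b))) - ln (norm (v k z)))\<bar>)
       \<le> K * (1 / (R - r) + R' / (R' - R) * ((1 + ln r) / r)) * (circle_mean R' (log_sum D v) + C))"
proof -
  obtain K C where K: "K \<ge> 0" "C \<ge> 0" "\<And>r R R' T. 1 \<le> r \<Longrightarrow> r < R \<Longrightarrow> 2 * norm b \<le> R - r \<Longrightarrow> R < R' \<Longrightarrow>
     (\<forall>z. norm z = r \<longrightarrow> v j z \<noteq> 0 \<and> v k z \<noteq> 0 \<and> v j (z + b) \<noteq> 0 \<and> v k (z + b) \<noteq> 0) \<Longrightarrow>
     (\<forall>z. norm z = R \<or> norm z = R' \<longrightarrow> v j z \<noteq> 0 \<and> v k z \<noteq> 0) \<Longrightarrow>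
     circle_mean R (\<lambda>z. max (ln (norm (v j z))) (ln (norm (v k z)))) \<le> T \<Longrightarrow>
     circle_mean R' (\<lambda>z. ln (norm (v j z))) \<le> T \<Longrightarrow> circle_mean R' (\<lambda>z. ln (norm (v k z))) \<le> T \<Longrightarrow>
     circle_mean r (\<lambda>z. \<bar>(ln (norm (v j (z + b))) - ln (norm (v j z))) - (ln (norm (v k (z + b))) - ln (norm (v k z)))\<bar>)
       \<le> K * (1 / (R - r) + R' / (R' - R) * ((1 + ln r) / r)) * (T + C)"
    using log_difference[OF D(2)[OF jk(1)] D(3)[OF jk(1)] D(2)[OF jk(2)] D(3)[OF jk(2)], of b] by blast
  have card: "card D \<ge> 1" using jk D(1) by (metis One_nat_def Suc_leI card_gt_0_iff empty_iff)
  show ?thesis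
  proof (rule exI[of _ K], rule exI[of _ "ln (card D) + C"], intro conjI allI impI)
    show "K \<ge> 0" "0 \<le> ln (card D) + C" using K card by auto
    fix r R R' assume r: "1 \<le> r" "r < R" "2 * norm b \<le> R - r" "R < R'"
      and fr: "\<forall>i\<in>D. sphere_free r (v i) \<and> sphere_free r (\<lambda>z. v i (z + b)) \<and> sphere_free R (v i) \<and> sphere_free R' (v i)"
    let ?T = "circle_mean R' (log_sum D v) + ln (card D)"
    have cl: "continuous_on S (log_sum D v)" for S by (rule continuous_on_log_sum) (use D nc in auto)
    have "circle_mean R (\<lambda>z. max (ln (norm (v j z))) (ln (norm (v k z)))) \<le> circle_mean R (log_sum D v)"
    proof (rule circle_mean_mono)
      show "continuous_on (sphere 0 R) (\<lambda>z. max (ln (norm (v j z))) (ln (norm (v k z))))"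
        by (intro continuous_on_max continuous_on_sphere_free) (use D jk fr in auto)
      fix z :: complex assume z: "norm z = R"
      have "v j z \<noteq> 0" "v k z \<noteq> 0" using fr jk z by (auto simp: sphere_free_def)
      then show "max (ln (norm (v j z))) (ln (norm (v k z))) \<le> log_sum D v z"
        using ln_norm_le_log_sum[of D j v z] ln_norm_le_log_sum[of D k v z] D jk by auto
    qed (use cl r in auto)
    also have "\<dots> \<le> ?T"
      by (rule circle_mean_log_sum_mono) (use D nc r fr in \<open>auto simp: sphere_free_def\<close>)
    finally have 1: "circle_mean R (\<lambda>z. max (ln (norm (v j z))) (ln (norm (v k z)))) \<le> ?T" .
    have 2: "circle_mean R' (\<lambda>z. ln (norm (v i z))) \<le> ?T" if "i \<in> D" for i
    proof -
      have "circle_mean R' (\<lambda>z. ln (norm (v i z))) \<le> circle_mean R' (log_sum D v)"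
        by (rule circle_mean_ln_le_log_sum) (use D nc that r fr in auto)
      then show ?thesis using card by (smt (verit) ln_ge_zero of_nat_1 of_nat_mono)
    qed
    show "circle_mean r (\<lambda>z. \<bar>(ln (norm (v j (z + b))) - ln (norm (v j z))) - (ln (norm (v k (z + b))) - ln (norm (v k z)))\<bar>)
       \<le> K * (1 / (R - r) + R' / (R' - R) * ((1 + ln r) / r)) * (circle_mean R' (log_sum D v) + (ln (card D) + C))"
      using K(3)[OF r _ _ 1 2[OF jk(1)] 2[OF jk(2)]] fr jk by (simp add: sphere_free_def add.assoc)
  qed
qed

lemma sphere_free_mult_prod:
  assumes "\<And>l. l < i \<Longrightarrow> sphere_free r (\<lambda>z. h (z + of_nat l * c + d))"
  shows "sphere_free r (\<lambda>z. mult_prod c h i (z + d))"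
  using assms unfolding sphere_free_def mult_prod_def by (auto simp: algebra_simps)

lemma circle_mean_ln_mult_prod:
  assumes "entire h" "r \<ge> 0" "\<And>l. l < i \<Longrightarrow> sphere_free r (\<lambda>z. h (z + of_nat l * c + d))"
  shows "circle_mean r (\<lambda>z. ln (norm (mult_prod c h i (z + d)))) = (\<Sum>l<i. circle_mean r (\<lambda>z. ln (norm (h (z + of_nat l * c + d)))))"
proof -
  have ent: "entire (\<lambda>z. h (z + of_nat l * c + d))" for l
    using entire_shift[OF assms(1), of "of_nat l * c + d"] by (simp add: add.assoc)
  have "circle_mean r (\<lambda>z. ln (norm (mult_prod c h i (z + d)))) = circle_mean r (\<lambda>z. \<Sum>l<i. ln (norm (h (z + of_nat l * c + d))))"
  proof (rule circle_mean_cong)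
    fix z :: complex assume z: "norm z = r"
    have "mult_prod c h i (z + d) = (\<Prod>l<i. h (z + of_nat l * c + d))"
      unfolding mult_prod_def by (simp add: algebra_simps)
    then have "norm (mult_prod c h i (z + d)) = (\<Prod>l<i. norm (h (z + of_nat l * c + d)))" by (simp add: prod_norm)
    also have "ln \<dots> = (\<Sum>l<i. ln (norm (h (z + of_nat l * c + d))))"
      by (rule ln_prod) (use sphere_freeD[OF assms(3) z] in auto)
    finally show "ln (norm (mult_prod c h i (z + d))) = (\<Sum>l<i. ln (norm (h (z + of_nat l * c + d))))" .
  qed (rule assms)
  also have "\<dots> = (\<Sum>l<i. circle_mean r (\<lambda>z. ln (norm (h (z + of_nat l * c + d)))))"
    by (rule circle_mean_sum) (use assms ent in \<open>auto intro: continuous_on_sphere_free\<close>)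
  finally show ?thesis .
qed

text \<open>Shaped for \<open>circuit_shift_iter\<close>: there x / y is a ratio of two products H,
  and it becomes a shift quotient of a ratio of components.\<close>

lemma ln_norm_cross_ratio:
  assumes "(a::complex) * (b * x) = d * (e * y)" "a \<noteq> 0" "b \<noteq> 0" "x \<noteq> 0" "d \<noteq> 0" "e \<noteq> 0" "y \<noteq> 0"
  shows "ln (norm x) - ln (norm y) = (ln (norm d) - ln (norm b)) - (ln (norm a) - ln (norm e))"
proof -
  have "ln (norm (a * (b * x))) = ln (norm a) + (ln (norm b) + ln (norm x))"
    using assms(2-4) by (simp add: norm_mult ln_mult)
  moreover have "ln (norm (d * (e * y))) = ln (norm d) + (ln (norm e) + ln (norm y))"
    using assms(5-7) by (simp add: norm_mult ln_mult)
  ultimately show ?thesis using assms(1) by simp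
qed

context shift_system
begin

definition minor_bound :: "(nat \<Rightarrow> complex \<Rightarrow> complex) \<Rightarrow> (complex \<Rightarrow> complex) \<Rightarrow> bool" where
  "minor_bound v L \<longleftrightarrow> entire L \<and> nonzero L \<and> (\<exists>p \<rho> C. 0 < C \<and>
    (\<forall>z. (\<Sum>k\<in>supp v. norm (v k z)) * norm (L z) \<le> C * (\<Prod>a<(p::nat). \<Sum>k\<in>supp v. norm (H k (\<rho> a) z))))"

lemma exists_minor_bound:
  assumes "reduced_circuit v"
  shows "\<exists>L. minor_bound v L"
proof -
  from circuit_minors[OF assms] show ?thesis
    unfolding minor_bound_def
  proof (elim exE conjE)
    fix p \<rho> L C
    assume *: "0 < C" "entire L" "nonzero L"
      "\<forall>z. (\<Sum>k\<in>supp v. norm (v k z)) * norm (L z) \<le> C * (\<Prod>a<(p::nat). \<Sum>k\<in>supp v. norm (H k (\<rho> a) z))"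
    show "\<exists>L. entire L \<and> nonzero L \<and> (\<exists>p \<rho> C. 0 < C \<and>
      (\<forall>z. (\<Sum>k\<in>supp v. norm (v k z)) * norm (L z) \<le> C * (\<Prod>a<(p::nat). \<Sum>k\<in>supp v. norm (H k (\<rho> a) z))))"
      by (rule exI[of _ L], intro conjI, rule *(2), rule *(3), rule exI[of _ p], rule exI[of _ \<rho>], rule exI[of _ C])
         (intro conjI *(1,4))
  qed
qed

lemma reduced_circuitD:
  assumes "reduced_circuit v"
  shows "finite (supp v)" "\<And>k. entire (v k)" "\<And>k. k \<in> supp v \<Longrightarrow> nonzero (v k)" "\<And>z. \<exists>k\<in>supp v. v k z \<noteq> 0"
    "supp v \<subseteq> N" "circuit v" "supp v \<noteq> {}"
proof -
  show c: "circuit v" and "\<And>z. \<exists>k\<in>supp v. v k z \<noteq> 0"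
    using assms unfolding reduced_circuit_def by blast+
  then have r: "rel v" and "supp v \<noteq> {}" unfolding circuit_def by blast+
  then show "supp v \<noteq> {}" "finite (supp v)" "supp v \<subseteq> N" using finite_supp supp_subset by blast+
  show "\<And>k. entire (v k)" using r unfolding rel_def by blast
  show "\<And>k. k \<in> supp v \<Longrightarrow> nonzero (v k)" unfolding supp_def by blast
qed

text \<open>The logarithm of the minor bound, averaged. The mean of ln |L| is bounded below, so L
  drops out. Comparing every H with that of one fixed k0 splits each row sum into a counting term of
  k0 and proximity terms of the ratios.\<close>

lemma circuit_mean_bound:
  assumes v: "reduced_circuit v" and L: "minor_bound v L" and k0: "k0 \<in> supp v"
  shows "\<exists>p \<rho> C. \<forall>r>1. sphere_free r L \<longrightarrow> (\<forall>k\<in>N. \<forall>l. sphere_free r (\<lambda>z. h k (z + of_nat l * c))) \<longrightarrow>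
     circle_mean r (log_sum (supp v) v) \<le> C + (\<Sum>a<(p::nat). circle_mean r (\<lambda>z. ln (norm (H k0 (\<rho> a) z)))
        + (\<Sum>j\<in>supp v. circle_mean r (\<lambda>z. \<bar>ln (norm (H j (\<rho> a) z)) - ln (norm (H k0 (\<rho> a) z))\<bar>)))"
proof -
  note vD = reduced_circuitD[OF v]
  obtain p \<rho> C where C: "0 < C" "\<And>z. (\<Sum>k\<in>supp v. norm (v k z)) * norm (L z) \<le> C * (\<Prod>a<(p::nat). \<Sum>k\<in>supp v. norm (H k (\<rho> a) z))"
    and entL: "entire L" "nonzero L" using L unfolding minor_bound_def by (elim exE conjE) blast
  obtain CL where CL: "\<And>R. R > 1 \<Longrightarrow> (\<forall>z. norm z = R \<longrightarrow> L z \<noteq> 0) \<Longrightarrow> - CL \<le> circle_mean R (\<lambda>z. ln (norm (L z)))"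
    using circle_mean_ln_lower_bound[OF entL] by blast
  let ?D = "supp v"
  have card: "card ?D > 0" using vD by (simp add: card_gt_0_iff)
  show ?thesis
  proof (rule exI[of _ p], rule exI[of _ \<rho>], rule exI[of _ "ln C + p * ln (card ?D) + CL"], intro allI impI)
    fix r :: real assume r: "1 < r" and fL: "sphere_free r L" and fh: "\<forall>k\<in>N. \<forall>l. sphere_free r (\<lambda>z. h k (z + of_nat l * c))"
    have fH: "sphere_free r (H k i)" if "k \<in> N" for k i
      using sphere_free_mult_prod[of i r "h k" c 0] fh that by simp
    have entH: "entire (H k i)" if "k \<in> N" for k i using h that by auto
    have cH: "continuous_on (sphere 0 r) (\<lambda>z. ln (norm (H k i z)))" if "k \<in> N" for k i
      by (rule continuous_on_sphere_free) (use entH fH that in auto)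
    have kN: "k0 \<in> N" using k0 vD by auto
    define \<delta> where "\<delta> j a z = \<bar>ln (norm (H j (\<rho> a) z)) - ln (norm (H k0 (\<rho> a) z))\<bar>" for j a z
    have c\<delta>: "continuous_on (sphere 0 r) (\<delta> j a)" if "j \<in> ?D" for j a
      unfolding \<delta>_def by (intro continuous_on_rabs continuous_on_diff cH) (use that vD kN in auto)
    have cl: "continuous_on S (log_sum ?D v)" for S by (rule continuous_on_log_sum) (use vD in auto)
    have cL: "continuous_on (sphere 0 r) (\<lambda>z. ln (norm (L z)))" using entL fL by (intro continuous_on_sphere_free)
    define W where "W z = (\<Sum>a<p. ln (norm (H k0 (\<rho> a) z)) + (\<Sum>j\<in>?D. \<delta> j a z))" for z
    have cW: "continuous_on (sphere 0 r) W"
      unfolding W_def by (intro continuous_on_sum continuous_on_add cH kN c\<delta>)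
    have pt: "log_sum ?D v z \<le> ((ln C + p * ln (card ?D)) + W z) - ln (norm (L z))" if z: "norm z = r" for z
    proof -
      have Lz: "norm (L z) > 0" using sphere_freeD[OF fL z] by simp
      have Hz: "norm (H k i z) > 0" if "k \<in> N" for k i using sphere_freeD[OF fH z] that by simp
      have S0: "(\<Sum>k\<in>?D. norm (v k z)) > 0" using vD(1) vD(4)[of z] by (auto intro: sum_pos2)
      define X where "X a = (\<Sum>k\<in>?D. norm (H k (\<rho> a) z))" for a
      have X0: "X a > 0" for a unfolding X_def using vD(1,5) k0 Hz kN by (auto intro!: sum_pos2[of _ k0])
      have lnX: "ln (X a) \<le> ln (card ?D) + (ln (norm (H k0 (\<rho> a) z)) + (\<Sum>j\<in>?D. \<delta> j a z))" for a
      proof -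
        let ?s = "\<Sum>j\<in>?D. \<delta> j a z"
        have "norm (H k (\<rho> a) z) \<le> norm (H k0 (\<rho> a) z) * exp ?s" if k: "k \<in> ?D" for k
        proof -
          have "\<delta> k a z \<le> ?s" by (rule member_le_sum) (use vD k in \<open>auto simp: \<delta>_def\<close>)
          then have "ln (norm (H k (\<rho> a) z)) \<le> ln (norm (H k0 (\<rho> a) z)) + ?s" unfolding \<delta>_def by linarith
          then have "exp (ln (norm (H k (\<rho> a) z))) \<le> exp (ln (norm (H k0 (\<rho> a) z)) + ?s)" by simp
          then show ?thesis using Hz[of k] Hz[OF kN] k vD(5) by (simp add: exp_add subsetD)
        qed
        then have "X a \<le> card ?D * (norm (H k0 (\<rho> a) z) * exp ?s)"
          unfolding X_def by (rule sum_bounded_above)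
        then have "ln (X a) \<le> ln (card ?D * (norm (H k0 (\<rho> a) z) * exp ?s))" using X0[of a] by (intro ln_mono)
        also have "\<dots> = ln (card ?D) + (ln (norm (H k0 (\<rho> a) z)) + ?s)"
          using card Hz[OF kN, of "\<rho> a"] by (simp add: ln_mult)
        finally show ?thesis .
      qed
      have "ln ((\<Sum>k\<in>?D. norm (v k z)) * norm (L z)) \<le> ln (C * (\<Prod>a<p. X a))"
        using C(2)[of z] S0 Lz unfolding X_def by (intro ln_mono mult_pos_pos)
      also have "\<dots> = ln C + (\<Sum>a<p. ln (X a))"
      proof -
        have "(\<Prod>a<p. X a) > 0" using X0 by (intro prod_pos) auto
        then have "ln (C * (\<Prod>a<p. X a)) = ln C + ln (\<Prod>a<p. X a)" using C(1) by (intro ln_mult_pos)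
        moreover have "ln (\<Prod>a<p. X a) = (\<Sum>a<p. ln (X a))" 
        proof (rule ln_prod)
          show "X a \<noteq> 0" for a using X0[of a] by linarith
        qed simp
        ultimately show ?thesis by simp
      qed
      also have "(\<Sum>a<p. ln (X a)) \<le> (\<Sum>a<p. ln (card ?D) + (ln (norm (H k0 (\<rho> a) z)) + (\<Sum>j\<in>?D. \<delta> j a z)))"
        by (intro sum_mono lnX)
      also have "\<dots> = p * ln (card ?D) + W z" by (simp add: W_def sum.distrib)
      also have "ln ((\<Sum>k\<in>?D. norm (v k z)) * norm (L z)) = log_sum ?D v z + ln (norm (L z))"
        unfolding log_sum_def using S0 Lz by (simp add: ln_mult)
      finally show ?thesis by linarith
    qed
    have cc: "continuous_on (sphere 0 r) (\<lambda>z. (ln C + p * ln (card ?D)) + W z)"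
      by (intro continuous_on_add continuous_on_const cW)
    have "circle_mean r (log_sum ?D v) \<le> circle_mean r (\<lambda>z. ((ln C + p * ln (card ?D)) + W z) - ln (norm (L z)))"
      by (rule circle_mean_mono[OF cl continuous_on_diff[OF cc cL]]) (use r pt in auto)
    also have "\<dots> = circle_mean r (\<lambda>z. (ln C + p * ln (card ?D)) + W z) - circle_mean r (\<lambda>z. ln (norm (L z)))"
      by (rule circle_mean_diff[OF cc cL]) (use r in simp)
    also have "circle_mean r (\<lambda>z. (ln C + p * ln (card ?D)) + W z) = (ln C + p * ln (card ?D)) + circle_mean r W"
      using circle_mean_add[OF continuous_on_const cW, of "ln C + p * ln (card ?D)"] r by simp
    also have "circle_mean r W = (\<Sum>a<p. circle_mean r (\<lambda>z. ln (norm (H k0 (\<rho> a) z)) + (\<Sum>j\<in>?D. \<delta> j a z)))"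
      unfolding W_def by (rule circle_mean_sum) (use r in \<open>auto intro!: continuous_on_add continuous_on_sum cH kN c\<delta>\<close>)
    also have "\<dots> = (\<Sum>a<p. circle_mean r (\<lambda>z. ln (norm (H k0 (\<rho> a) z))) + (\<Sum>j\<in>?D. circle_mean r (\<delta> j a)))"
    proof (rule sum.cong)
      fix a
      have cs: "continuous_on (sphere 0 r) (\<lambda>z. \<Sum>j\<in>?D. \<delta> j a z)" by (intro continuous_on_sum c\<delta>)
      have "circle_mean r (\<lambda>z. \<Sum>j\<in>?D. \<delta> j a z) = (\<Sum>j\<in>?D. circle_mean r (\<delta> j a))"
        by (rule circle_mean_sum) (use c\<delta> r in auto)
      then show "circle_mean r (\<lambda>z. ln (norm (H k0 (\<rho> a) z)) + (\<Sum>j\<in>?D. \<delta> j a z)) = circle_mean r (\<lambda>z. ln (norm (H k0 (\<rho> a) z))) + (\<Sum>j\<in>?D. circle_mean r (\<delta> j a))"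
        using circle_mean_add[OF cH[OF kN] cs] r by simp
    qed simp
    finally have *: "circle_mean r (log_sum ?D v) \<le> ((ln C + p * ln (card ?D)) + (\<Sum>a<p. circle_mean r (\<lambda>z. ln (norm (H k0 (\<rho> a) z))) + (\<Sum>j\<in>?D. circle_mean r (\<delta> j a)))) - circle_mean r (\<lambda>z. ln (norm (L z)))" .
    have "- CL \<le> circle_mean r (\<lambda>z. ln (norm (L z)))" using CL[OF r] fL unfolding sphere_free_def by blast
    then show "circle_mean r (log_sum ?D v) \<le> ln C + p * ln (card ?D) + CL + (\<Sum>a<p. circle_mean r (\<lambda>z. ln (norm (H k0 (\<rho> a) z)))
        + (\<Sum>j\<in>?D. circle_mean r (\<lambda>z. \<bar>ln (norm (H j (\<rho> a) z)) - ln (norm (H k0 (\<rho> a) z))\<bar>)))"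
      using * unfolding \<delta>_def by (simp only: mult.commute)
  qed
qed

end

text \<open>If \<tau> r > 4 C, iterating the step along radii x k at least triples \<tau> every
  time, while x k powr (1 - \<delta>) grows at most linearly in k. The growth hypothesis then allows
  only exp (O(k^\<theta>)) with \<theta> = \<rho> / (1 - \<delta>) < 1, against 3^k.\<close>

lemma growth_contradiction:
  fixes \<tau> :: "real \<Rightarrow> real"
  assumes dense: "\<And>x y. 1 \<le> x \<Longrightarrow> x < y \<Longrightarrow> \<exists>r. x < r \<and> r < y \<and> G r"
    and \<delta>: "0 < \<delta>" "\<delta> < 1" and \<rho>: "0 < \<rho>" "\<rho> + \<delta> < 1"
    and step: "\<And>r R. r0 \<le> r \<Longrightarrow> G r \<Longrightarrow> G R \<Longrightarrow> r + r powr \<delta> \<le> R \<Longrightarrow> R \<le> r + 2 * r powr \<delta> \<Longrightarrow> \<tau> r \<le> C + \<tau> R / 4"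
    and growth: "\<And>r. r0 \<le> r \<Longrightarrow> G r \<Longrightarrow> \<tau> r \<le> A * exp (2 * r powr \<rho>)"
    and C: "0 \<le> C" and r0: "1 \<le> r0"
    and r: "r0 \<le> r" "G r"
  shows "\<tau> r \<le> 4 * C"
proof (rule ccontr)
  assume "\<not> \<tau> r \<le> 4 * C"
  then have big: "\<tau> r > 4 * C" by simp
  have ex: "\<exists>R. G R \<and> r + r powr \<delta> \<le> R \<and> R \<le> r + 2 * r powr \<delta>" if "r0 \<le> r" for r
  proof -
    have "0 < r powr \<delta>" "1 \<le> r" using that r0 by auto
    then obtain R where "r + r powr \<delta> < R" "R < r + 2 * r powr \<delta>" "G R"
      using dense[of "r + r powr \<delta>" "r + 2 * r powr \<delta>"] by auto
    then show ?thesis by (intro exI[of _ R]) auto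
  qed
  define nx where "nx r = (SOME R. G R \<and> r + r powr \<delta> \<le> R \<and> R \<le> r + 2 * r powr \<delta>)" for r
  have nx: "G (nx r)" "r + r powr \<delta> \<le> nx r" "nx r \<le> r + 2 * r powr \<delta>" if "r0 \<le> r" for r
    using someI_ex[OF ex[OF that]] unfolding nx_def by auto
  define x where "x k = (nx ^^ k) r" for k
  have xS: "x (Suc k) = nx (x k)" for k by (simp add: x_def)
  have x0: "r0 \<le> x k" for k
  proof (induction k)
    case (Suc k)
    have "0 \<le> x k powr \<delta>" by simp
    then show ?case using nx(2)[OF Suc] Suc unfolding xS by linarith
  qed (use r in \<open>simp add: x_def\<close>)
  have Gx: "G (x k)" for k by (cases k) (use r nx x0 in \<open>auto simp: x_def\<close>)
  have big_k: "\<tau> (x k) \<ge> 3 ^ k * \<tau> r" for k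
  proof (induction k)
    case 0
    then show ?case by (simp add: x_def)
  next
    case (Suc k)
    have "\<tau> (x k) \<le> C + \<tau> (x (Suc k)) / 4"
      by (rule step) (use x0 Gx nx[OF x0[of k]] in \<open>auto simp: xS\<close>)
    \<comment> \<open>While \<tau> (x k) \<ge> 4 C, the constant costs at most one of the four units
      gained, and a factor 3 remains.\<close>
    moreover have "4 * C \<le> \<tau> (x k)"
    proof -
      have "1 * \<tau> r \<le> 3 ^ k * \<tau> r" using big C by (intro mult_right_mono) auto
      then show ?thesis using Suc big by linarith
    qed
    ultimately have "3 * \<tau> (x k) \<le> \<tau> (x (Suc k))" by linarith
    then show ?case using Suc by simp
  qed
  \<comment> \<open>(1 + u) powr (1 - \<delta>) \<le> 1 + u for u = 2 y powr (\<delta> - 1), and y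
    powr (1 - \<delta>) * u = 2: a constant increment per step.\<close>
  have xk: "x k powr (1 - \<delta>) \<le> r powr (1 - \<delta>) + 2 * real k" for k
  proof (induction k)
    case (Suc k)
    let ?y = "x k"
    have y: "?y \<ge> 1" using x0[of k] r0 by linarith
    have "x (Suc k) powr (1 - \<delta>) \<le> (?y + 2 * ?y powr \<delta>) powr (1 - \<delta>)"
    proof (rule powr_mono2)
      show "0 \<le> x (Suc k)" using x0[of "Suc k"] r0 by linarith
    qed (use nx[OF x0[of k]] \<delta> in \<open>auto simp: xS\<close>)
    also have "?y + 2 * ?y powr \<delta> = ?y * (1 + 2 * ?y powr (\<delta> - 1))"
      using y by (simp add: distrib_left powr_diff)
    also have "\<dots> powr (1 - \<delta>) = ?y powr (1 - \<delta>) * (1 + 2 * ?y powr (\<delta> - 1)) powr (1 - \<delta>)"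
      by (rule powr_mult)
    also have "\<dots> \<le> ?y powr (1 - \<delta>) * (1 + 2 * ?y powr (\<delta> - 1)) powr 1"
      using \<delta> by (intro mult_left_mono powr_mono) auto
    also have "\<dots> = ?y powr (1 - \<delta>) + 2 * (?y powr (1 - \<delta>) * ?y powr (\<delta> - 1))"
      by (simp add: distrib_left)
    also have "?y powr (1 - \<delta>) * ?y powr (\<delta> - 1) = 1" using y by (simp add: powr_add[symmetric])
    finally show ?case using Suc by simp
  qed (simp add: x_def)
  define \<theta> where "\<theta> = \<rho> / (1 - \<delta>)"
  have \<theta>: "0 < \<theta>" "\<theta> < 1" using \<delta> \<rho> by (auto simp: \<theta>_def)
  define a where "a = r powr (1 - \<delta>)"
  have up: "\<tau> (x k) \<le> \<bar>A\<bar> * exp (2 * (a + 2 * real k) powr \<theta>)" for k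
  proof -
    have "x k powr \<rho> = (x k powr (1 - \<delta>)) powr \<theta>" using \<delta> by (simp add: powr_powr \<theta>_def)
    also have "\<dots> \<le> (a + 2 * real k) powr \<theta>" using xk[of k] \<theta> unfolding a_def by (intro powr_mono2) auto
    finally have "exp (2 * x k powr \<rho>) \<le> exp (2 * (a + 2 * real k) powr \<theta>)" by simp
    then have "\<bar>A\<bar> * exp (2 * x k powr \<rho>) \<le> \<bar>A\<bar> * exp (2 * (a + 2 * real k) powr \<theta>)" by (intro mult_left_mono) auto
    moreover have "A * exp (2 * x k powr \<rho>) \<le> \<bar>A\<bar> * exp (2 * x k powr \<rho>)" by (intro mult_right_mono) auto
    ultimately show ?thesis using growth[OF x0[of k] Gx[of k]] by linarith
  qed
  have "(\<lambda>k::nat. \<bar>A\<bar> * exp (2 * (a + 2 * real k) powr \<theta> - ln 3 * k)) \<longlonglongrightarrow> 0"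
  proof -
    have "((\<lambda>x::real. \<bar>A\<bar> * exp (2 * (a + 2 * x) powr \<theta> - ln 3 * x)) \<longlongrightarrow> 0) at_top"
      using \<theta> by real_asymp
    then show ?thesis by (rule filterlim_compose[OF _ filterlim_real_sequentially])
  qed
  moreover have "\<tau> r > 0" using big C by linarith
  ultimately have "eventually (\<lambda>k::nat. \<bar>A\<bar> * exp (2 * (a + 2 * real k) powr \<theta> - ln 3 * k) < \<tau> r) sequentially"
    by (rule order_tendstoD)
  then obtain k :: nat where k: "\<bar>A\<bar> * exp (2 * (a + 2 * real k) powr \<theta> - ln 3 * k) < \<tau> r"
    unfolding eventually_sequentially by (meson order_refl)
  have e3: "exp (ln 3 * real k) = 3 ^ k" by (simp add: mult.commute exp_of_nat_mult)
  have "\<bar>A\<bar> * exp (2 * (a + 2 * real k) powr \<theta>) / 3 ^ k < \<tau> r"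
    using k by (simp add: exp_diff e3)
  then have "\<bar>A\<bar> * exp (2 * (a + 2 * real k) powr \<theta>) < 3 ^ k * \<tau> r" by (simp add: field_simps)
  then show False using up[of k] big_k[of k] by linarith
qed

section \<open>Equality of multipliers\<close>

text \<open>The curve seen through those of its forms that do not vanish identically.
  \<open>span\<close> is the trace of general position: wherever a form vanishes, enough of the
  others do not, and it can be expressed through them.\<close>

locale shift_curve = shift_system N h c for N h c +
  fixes g :: "nat \<Rightarrow> complex \<Rightarrow> complex" and \<rho> :: real
  assumes g: "\<And>k. k \<in> N \<Longrightarrow> entire (g k)" "\<And>k. k \<in> N \<Longrightarrow> nonzero (g k)"
    and gh: "\<And>k z. k \<in> N \<Longrightarrow> g k (z + c) = h k z * g k z"
    and no_common: "\<And>z. \<exists>k\<in>N. g k z \<noteq> 0"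
    and rho: "0 < \<rho>" "\<rho> < 1"
    and growth: "\<exists>r0. \<forall>r\<ge>r0. circle_mean r (log_sum N g) \<le> exp (r powr \<rho>)"
    and span: "\<And>k z. k \<in> N \<Longrightarrow> g k z = 0 \<Longrightarrow>
      \<exists>\<beta>. \<beta> k \<noteq> 0 \<and> (\<forall>y. (\<Sum>j\<in>N. \<beta> j * g j y) = 0) \<and> (\<forall>j\<in>N. j \<noteq> k \<longrightarrow> \<beta> j \<noteq> 0 \<longrightarrow> g j z \<noteq> 0)"
begin

section \<open>Circuits of the curve and admissible radii\<close>

definition supports :: "nat set set" where
  "supports = supp ` {v. reduced_circuit v}"

text \<open>One representative for each of the finitely many supports, so that their characteristics
  can be added up in \<open>\<tau>\<close>.\<close>

definition V :: "nat set \<Rightarrow> nat \<Rightarrow> complex \<Rightarrow> complex" where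
  "V D = (SOME v. reduced_circuit v \<and> supp v = D)"

definition minor_cofactor :: "nat set \<Rightarrow> complex \<Rightarrow> complex" where
  "minor_cofactor D = (SOME L. minor_bound (V D) L)"

lemma V: assumes "D \<in> supports" shows "reduced_circuit (V D)" "supp (V D) = D"
proof -
  obtain v where "reduced_circuit v \<and> supp v = D" using assms unfolding supports_def by blast
  then have "reduced_circuit (V D) \<and> supp (V D) = D" unfolding V_def by (rule someI[of "\<lambda>v. reduced_circuit v \<and> supp v = D"])
  then show "reduced_circuit (V D)" "supp (V D) = D" by auto
qed

lemma minor_cofactor: assumes "D \<in> supports" shows "minor_bound (V D) (minor_cofactor D)"
  unfolding minor_cofactor_def using exists_minor_bound[OF V(1)[OF assms]] by (rule someI_ex)

lemma entire_minor_cofactor: assumes "D \<in> supports" shows "entire (minor_cofactor D)" "nonzero (minor_cofactor D)"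
  using minor_cofactor[OF assms] unfolding minor_bound_def by (simp_all only:)

lemma VD:
  assumes "D \<in> supports"
  shows "finite D" "\<And>k. entire (V D k)" "\<And>k. k \<in> D \<Longrightarrow> nonzero (V D k)" "\<And>z. \<exists>k\<in>D. V D k z \<noteq> 0"
    "D \<subseteq> N" "circuit (V D)" "D \<noteq> {}" "rel (V D)"
  using reduced_circuitD[OF V(1)[OF assms]] unfolding V(2)[OF assms] by (simp_all add: circuit_def)

lemma finite_supports: "finite supports"
proof (rule finite_subset)
  show "supports \<subseteq> Pow N" using VD(5) by blast
qed (use finN in simp)

text \<open>The functions whose zeros the radii have to avoid. Shifts by negative multiples are
  included because \<open>negligible_multiplier\<close> looks at h k also at points shifted
  backwards.\<close>

definition fam :: "(complex \<Rightarrow> complex) set" where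
  "fam = (\<Union>k\<in>N. \<Union>i::int. {\<lambda>z. h k (z + of_int i * c)}) \<union> (\<Union>k\<in>N. \<Union>i::int. {\<lambda>z. g k (z + of_int i * c)}) \<union>
     (\<Union>D\<in>supports. \<Union>k\<in>D. \<Union>i::int. {\<lambda>z. V D k (z + of_int i * c)}) \<union> minor_cofactor ` supports"

definition good :: "real \<Rightarrow> bool" where
  "good r \<longleftrightarrow> 1 < r \<and> (\<forall>f\<in>fam. sphere_free r f)"

lemma fam_countable: "countable fam"
proof -
  have i: "countable (\<Union>i::int. {\<phi> i})" for \<phi> :: "int \<Rightarrow> complex \<Rightarrow> complex" by (intro countable_UN) auto
  have f: "countable (\<Union>k\<in>A. \<Union>i::int. {\<phi> k i})" if "finite A" for A :: "nat set" and \<phi> :: "nat \<Rightarrow> int \<Rightarrow> complex \<Rightarrow> complex"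
    by (rule countable_UN[OF countable_finite[OF that] i])
  have "countable (\<Union>D\<in>supports. \<Union>k\<in>D. \<Union>i::int. {\<lambda>z. V D k (z + of_int i * c)})"
    by (rule countable_UN[OF countable_finite[OF finite_supports] f]) (rule VD(1))
  moreover have "countable (minor_cofactor ` supports)" by (intro countable_image countable_finite finite_supports)
  ultimately show ?thesis unfolding fam_def by (intro countable_Un f finN)
qed

lemma fam_entire: "f \<in> fam \<Longrightarrow> entire f \<and> nonzero f"
  unfolding fam_def using h g VD(2,3) entire_minor_cofactor by auto

lemma good_dense: "1 \<le> x \<Longrightarrow> x < y \<Longrightarrow> \<exists>r. x < r \<and> r < y \<and> good r"
  using good_radius[OF fam_countable fam_entire, of x y] unfolding good_def sphere_free_def by (meson le_less_trans)

lemma good_gt_1: "good r \<Longrightarrow> 1 < r" by (simp add: good_def)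

lemma good_h: assumes "good r" "k \<in> N" shows "sphere_free r (\<lambda>z. h k (z + of_int i * c))"
proof -
  have "(\<lambda>z. h k (z + of_int i * c)) \<in> fam" unfolding fam_def using assms(2) by blast
  then show ?thesis using assms(1) unfolding good_def by blast
qed

lemma good_g: assumes "good r" "k \<in> N" shows "sphere_free r (\<lambda>z. g k (z + of_int i * c))"
proof -
  have "(\<lambda>z. g k (z + of_int i * c)) \<in> fam" unfolding fam_def using assms(2) by blast
  then show ?thesis using assms(1) unfolding good_def by blast
qed

lemma good_V: assumes "good r" "D \<in> supports" "k \<in> D" shows "sphere_free r (\<lambda>z. V D k (z + of_int i * c))"
proof -
  have "(\<lambda>z. V D k (z + of_int i * c)) \<in> fam" unfolding fam_def
    by (rule UnI1, rule UnI2, rule UN_I[OF assms(2)], rule UN_I[OF assms(3)], rule UN_I[of i], rule UNIV_I, rule singletonI)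
  then show ?thesis using assms(1) unfolding good_def by blast
qed

lemma good_h_nat: "good r \<Longrightarrow> k \<in> N \<Longrightarrow> sphere_free r (\<lambda>z. h k (z + of_nat l * c))"
  using good_h[of r k "int l"] by simp

lemma good_g_nat: "good r \<Longrightarrow> k \<in> N \<Longrightarrow> sphere_free r (\<lambda>z. g k (z + of_nat l * c))"
  using good_g[of r k "int l"] by simp

lemma good_V_nat: "good r \<Longrightarrow> D \<in> supports \<Longrightarrow> k \<in> D \<Longrightarrow> sphere_free r (\<lambda>z. V D k (z + of_nat l * c))"
  using good_V[of r D k "int l"] by simp

lemma good_g0: "good r \<Longrightarrow> k \<in> N \<Longrightarrow> sphere_free r (g k)" using good_g[of r k 0] by simp
lemma good_V0: "good r \<Longrightarrow> D \<in> supports \<Longrightarrow> k \<in> D \<Longrightarrow> sphere_free r (V D k)" using good_V[of r D k 0] by simp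

lemma good_H: "good r \<Longrightarrow> k \<in> N \<Longrightarrow> sphere_free r (H k i)"
  using sphere_free_mult_prod[of i r "h k" c 0] good_h_nat by simp

lemma rel_of_constants:
  assumes "\<And>y. (\<Sum>j\<in>N. \<beta> j * g j y) = 0"
  shows "rel (\<lambda>j z. if j \<in> N then \<beta> j * g j z else 0)"
proof -
  have "(\<Sum>j\<in>N. (if j \<in> N then \<beta> j * g j z else 0) * H j i z) = 0" for i z
  proof -
    have "(\<Sum>j\<in>N. (if j \<in> N then \<beta> j * g j z else 0) * H j i z) = (\<Sum>j\<in>N. \<beta> j * g j (z + of_nat i * c))"
    proof (rule sum.cong)
      fix j assume j: "j \<in> N"
      have "g j (z + of_nat i * c) = H j i z * g j z" by (rule mult_prod_shift_eq) (rule gh[OF j])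
      then show "(if j \<in> N then \<beta> j * g j z else 0) * H j i z = \<beta> j * g j (z + of_nat i * c)"
        using j by (simp add: mult_ac)
    qed simp
    then show ?thesis using assms by simp
  qed
  moreover have "entire (\<lambda>z. if j \<in> N then \<beta> j * g j z else 0)" for j using g by (cases "j \<in> N") auto
  ultimately show ?thesis unfolding rel_def nonzero_def by auto
qed

lemma circuit_of_constants:
  assumes "\<And>y. (\<Sum>j\<in>N. \<beta> j * g j y) = 0" "k \<in> N" "\<beta> k \<noteq> 0"
  shows "\<exists>D\<in>supports. k \<in> D \<and> (\<forall>j\<in>D. \<beta> j \<noteq> 0)"
proof -
  let ?u = "\<lambda>j z. if j \<in> N then \<beta> j * g j z else 0"
  have "k \<in> supp ?u" using assms(2,3) g(2)[of k] by (auto simp: supp_def nonzero_def)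
  from exists_circuit[OF rel_of_constants[OF assms(1)] this] obtain v where
    v: "circuit v" "k \<in> supp v" "supp v \<subseteq> supp ?u" by blast
  obtain v' where v': "reduced_circuit v'" "supp v' = supp v" using exists_reduced_circuit[OF v(1)] by blast
  have "supp v \<in> supports" unfolding supports_def using v' by (metis imageI mem_Collect_eq)
  moreover have "\<beta> j \<noteq> 0" if "j \<in> supp v" for j
    using that v(3) by (auto simp: supp_def nonzero_def split: if_splits)
  ultimately show ?thesis using v(2) by blast
qed

text \<open>A zero of \<open>H k s (z - s c)\<close> is forced to be a zero of the \<open>k\<close>-th component of a reduced circuit:
  the other components of that circuit come from forms that do not vanish at \<open>z\<close>.\<close>
lemma circuit_component_divisible:
  assumes k: "k \<in> N"
  shows "\<exists>E. entire E \<and> (\<forall>z. (\<Prod>D\<in>{D \<in> supports. k \<in> D}. V D k z) = H k s (z - of_nat s * c) * E z)"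
proof -
  let ?S = "{D \<in> supports. k \<in> D}"
  \<comment> \<open>Which circuit yields the required zero depends on z, so the product over all
    circuits through k is taken.\<close>
  let ?P = "\<lambda>z. \<Prod>D\<in>?S. V D k z"
  let ?q = "\<lambda>z. z - of_nat s * c"
  have fS: "finite ?S" using finite_supports by simp
  have entP: "entire ?P" using VD(2) by (intro entire_prod) auto
  have entH: "entire (\<lambda>z. H j s (?q z))" if "j \<in> N" for j
    using h that by (intro entire_shift_diff entire_mult_prod) auto
  have nzH: "nonzero (\<lambda>z. H k s (?q z))"
    unfolding nonzero_shift_diff by (rule nonzero_mult_prod) (use h k in auto)
  have loc: "\<exists>e. isCont e z \<and> eventually (\<lambda>w. ?P w = H k s (?q w) * e w) (at z)" for z
  proof (cases "H k s (?q z) = 0")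
    case False
    have "isCont (\<lambda>w. ?P w / H k s (?q w)) z"
      using False entP entH[OF k] by (intro continuous_divide entire_isCont) auto
    moreover have "eventually (\<lambda>w. ?P w = H k s (?q w) * (?P w / H k s (?q w))) (at z)"
      using entire_eventually_nz[OF entH[OF k] nzH] by eventually_elim auto
    ultimately show ?thesis by blast
  next
    case True
    have gq: "g j z = H j s (?q z) * g j (?q z)" if "j \<in> N" for j
      using mult_prod_shift_eq[of "g j" c "h j" "?q z" s] gh that by simp
    have "g k z = 0" using gq[OF k] True by simp
    from span[OF k this] obtain \<beta> where \<beta>: "\<beta> k \<noteq> 0" "\<And>y. (\<Sum>j\<in>N. \<beta> j * g j y) = 0"
      "\<And>j. j \<in> N \<Longrightarrow> j \<noteq> k \<Longrightarrow> \<beta> j \<noteq> 0 \<Longrightarrow> g j z \<noteq> 0" by blast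
    from circuit_of_constants[OF \<beta>(2) k \<beta>(1)] obtain D where D: "D \<in> supports" "k \<in> D" "\<And>j. j \<in> D \<Longrightarrow> \<beta> j \<noteq> 0" by blast
    note vD = VD[OF D(1)]
    have "\<exists>j\<in>D. j \<noteq> k \<and> V D j (?q z) \<noteq> 0"
    proof (rule ccontr)
      assume no: "\<not> (\<exists>j\<in>D. j \<noteq> k \<and> V D j (?q z) \<noteq> 0)"
      have "(\<Sum>j\<in>D. V D j (?q z)) = 0"
        using rel_sum_supp[OF vD(8), of "?q z" 0] unfolding V(2)[OF D(1)] by simp
      moreover have "(\<Sum>j\<in>D. V D j (?q z)) = V D k (?q z)"
      proof -
        have "(\<Sum>j\<in>D - {k}. V D j (?q z)) = 0" by (rule sum.neutral) (use no in auto)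
        then show ?thesis using sum.remove[OF vD(1) D(2), of "\<lambda>j. V D j (?q z)"] by simp
      qed
      ultimately have "V D k (?q z) = 0" by simp
      then have "V D j (?q z) = 0" if "j \<in> D" for j using no that by (cases "j = k") auto
      then show False using vD(4)[of "?q z"] by blast
    qed
    then obtain j where j: "j \<in> D" "j \<noteq> k" "V D j (?q z) \<noteq> 0" by blast
    have jN: "j \<in> N" using j vD by blast
    have "g j z \<noteq> 0" by (rule \<beta>(3)) (use j jN D in auto)
    then have Hj: "H j s (?q z) \<noteq> 0" using gq[OF jN] by auto
    \<comment> \<open>The denominator of the local quotient: it is nonzero at z, and by the shift
      identity V D k times it is divisible by H k s at the shifted point.\<close>
    define den where "den = (\<lambda>w. V D j (?q w) * H j s (?q w))"
    have entden: "entire den" unfolding den_def using vD(2)[of j] entH[OF jN] by auto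
    have den0: "den z \<noteq> 0" using Hj j by (simp add: den_def)
    have nzden: "nonzero den" using den0 by (auto simp: nonzero_def)
    define Rst where "Rst = (\<lambda>w. \<Prod>D\<in>?S - {D}. V D k w)"
    have entR: "entire Rst" unfolding Rst_def using VD(2) by (intro entire_prod) auto
    have PR: "?P w = V D k w * Rst w" for w
      unfolding Rst_def by (rule prod.remove[OF fS]) (use D in auto)
    have id: "V D k w * den w = V D j w * (V D k (?q w) * H k s (?q w))" for w
      using circuit_shift_iter[OF vD(6), of j k "?q w" s] j D unfolding V(2)[OF D(1)] den_def by simp
    define e where "e = (\<lambda>w. V D j w * V D k (?q w) * Rst w / den w)"
    have "isCont (\<lambda>w. V D j w * V D k (?q w) * Rst w) z"
      by (intro entire_isCont entire_intros entire_shift_diff entR vD(2))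
    then have "isCont e z" unfolding e_def using entire_isCont[OF entden] den0 by (rule isCont_divide)
    moreover have "eventually (\<lambda>w. ?P w = H k s (?q w) * e w) (at z)"
      using entire_eventually_nz[OF entden nzden]
    proof eventually_elim
      case (elim w)
      have "?P w * den w = H k s (?q w) * (V D j w * V D k (?q w) * Rst w)"
        unfolding PR using id[of w] by (simp add: mult_ac)
      then show ?case unfolding e_def using elim by (simp add: field_simps)
    qed
    ultimately show ?thesis by blast
  qed
  obtain E where "entire E" "\<And>z. ?P z = H k s (?q z) * E z"
    by (rule entire_divides[OF entP entH[OF k] nzH loc]) blast
  then show ?thesis by blast
qed

definition \<tau> :: "real \<Rightarrow> real" where
  "\<tau> r = (\<Sum>D\<in>supports. circle_mean r (log_sum D (V D)))"

text \<open>A mean of \<open>log_sum\<close> may be negative, but it is bounded below since the V D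
  are fixed. B absorbs these bounds, so that single terms and partial sums are controlled by
  \<tau>.\<close>

lemma tau_bounds:
  "\<exists>B\<ge>0. \<forall>r. good r \<longrightarrow> 0 \<le> \<tau> r + B \<and> (\<forall>S\<subseteq>supports. (\<Sum>D\<in>S. circle_mean r (log_sum D (V D))) \<le> \<tau> r + B)"
proof -
  have "\<exists>B. \<forall>r. good r \<longrightarrow> - B \<le> circle_mean r (log_sum D (V D))" if D: "D \<in> supports" for D
  proof -
    note vD = VD[OF D]
    obtain k where k: "k \<in> D" using vD(7) by blast
    obtain C where C: "\<And>R. R > 1 \<Longrightarrow> (\<forall>z. norm z = R \<longrightarrow> V D k z \<noteq> 0) \<Longrightarrow> - C \<le> circle_mean R (\<lambda>z. ln (norm (V D k z)))"
      using circle_mean_ln_lower_bound[OF vD(2) vD(3)[OF k]] by blast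
    show ?thesis
    proof (intro exI[of _ C] allI impI)
      fix r assume r: "good r"
      have "- C \<le> circle_mean r (\<lambda>z. ln (norm (V D k z)))"
        using C[OF good_gt_1[OF r]] good_V0[OF r D k] unfolding sphere_free_def by blast
      also have "\<dots> \<le> circle_mean r (log_sum D (V D))"
        by (rule circle_mean_ln_le_log_sum) (use vD k good_gt_1[OF r] good_V0[OF r D k] in auto)
      finally show "- C \<le> circle_mean r (log_sum D (V D))" .
    qed
  qed
  then obtain B where B: "\<And>D r. D \<in> supports \<Longrightarrow> good r \<Longrightarrow> - B D \<le> circle_mean r (log_sum D (V D))" by metis
  define B0 where "B0 = (\<Sum>D\<in>supports. \<bar>B D\<bar>)"
  show ?thesis
  proof (rule exI[of _ B0], intro conjI allI impI)
    show "0 \<le> B0" unfolding B0_def by (intro sum_nonneg) auto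
    fix r assume r: "good r"
    have low: "- \<bar>B D\<bar> \<le> circle_mean r (log_sum D (V D))" if "D \<in> supports" for D
      using B[OF that r] by linarith
    have gen: "(\<Sum>D\<in>S. circle_mean r (log_sum D (V D))) \<le> \<tau> r + B0" if S: "S \<subseteq> supports" for S
    proof -
      have fS: "finite S" using S finite_supports finite_subset by blast
      have "\<tau> r = (\<Sum>D\<in>S. circle_mean r (log_sum D (V D))) + (\<Sum>D\<in>supports - S. circle_mean r (log_sum D (V D)))"
        unfolding \<tau>_def by (subst add.commute) (rule sum.subset_diff[OF S finite_supports])
      moreover have "(\<Sum>D\<in>supports - S. circle_mean r (log_sum D (V D))) \<ge> (\<Sum>D\<in>supports - S. - \<bar>B D\<bar>)"
        by (intro sum_mono low) auto
      moreover have "(\<Sum>D\<in>supports - S. \<bar>B D\<bar>) \<le> B0"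
        unfolding B0_def by (intro sum_mono2 finite_supports) auto
      ultimately show ?thesis by (simp add: sum_negf)
    qed
    show "0 \<le> \<tau> r + B0" using gen[of "{}"] by simp
    fix S assume "S \<subseteq> supports"
    then show "(\<Sum>D\<in>S. circle_mean r (log_sum D (V D))) \<le> \<tau> r + B0" by (rule gen)
  qed
qed

section \<open>Negligible and dominated terms\<close>

text \<open>Half of the gap 1 - \<rho>. r powr \<delta> eventually exceeds every multiple of ln r,
  as the logarithmic difference requires, and \<rho> + \<delta> < 1, as
  \<open>growth_contradiction\<close> requires.\<close>

definition \<delta> :: real where "\<delta> = (1 - \<rho>) / 2"

lemma delta: "0 < \<delta>" "\<delta> < 1" "\<rho> + \<delta> < 1"
proof -
  have d: "2 * \<delta> = 1 - \<rho>" by (simp add: \<delta>_def)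
  show "0 < \<delta>" "\<delta> < 1" "\<rho> + \<delta> < 1" using d rho by linarith+
qed

text \<open>Small compared with \<tau> at the end of one step of the iteration. Asking for every
  \<eta> makes the notion stable under finite sums.\<close>

definition negligible :: "(real \<Rightarrow> real) \<Rightarrow> bool" where
  "negligible \<Phi> \<longleftrightarrow> (\<forall>\<eta>>0. \<exists>C r0. \<forall>r R. r0 \<le> r \<longrightarrow> good r \<longrightarrow> good R \<longrightarrow> r + r powr \<delta> \<le> R \<longrightarrow> R \<le> r + 2 * r powr \<delta> \<longrightarrow>
     \<Phi> r \<le> C + \<eta> * \<tau> R)"

text \<open>The a priori bound. The factor 2 in (2 * r) powr \<rho> is there because a term at r is
  estimated by the curve at radii up to 2 r.\<close>

definition dominated :: "(real \<Rightarrow> real) \<Rightarrow> bool" where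
  "dominated \<Phi> \<longleftrightarrow> (\<exists>A r0. \<forall>r. r0 \<le> r \<longrightarrow> good r \<longrightarrow> \<Phi> r \<le> A * exp ((2 * r) powr \<rho>))"

lemma negligible_mono:
  assumes "negligible \<Psi>" "\<And>r. good r \<Longrightarrow> \<Phi> r \<le> \<Psi> r" shows "negligible \<Phi>"
  unfolding negligible_def
proof (intro allI impI)
  fix \<eta> :: real assume "\<eta> > 0"
  then obtain C r0 where C: "\<And>r R. r0 \<le> r \<Longrightarrow> good r \<Longrightarrow> good R \<Longrightarrow> r + r powr \<delta> \<le> R \<Longrightarrow> R \<le> r + 2 * r powr \<delta> \<Longrightarrow>
     \<Psi> r \<le> C + \<eta> * \<tau> R" using assms(1) unfolding negligible_def by blast
  show "\<exists>C r0. \<forall>r R. r0 \<le> r \<longrightarrow> good r \<longrightarrow> good R \<longrightarrow> r + r powr \<delta> \<le> R \<longrightarrow> R \<le> r + 2 * r powr \<delta> \<longrightarrow> \<Phi> r \<le> C + \<eta> * \<tau> R"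
    by (rule exI[of _ C], rule exI[of _ r0]) (use C assms(2) order_trans in blast)
qed

lemma negligible_const: "negligible (\<lambda>r. K)"
  unfolding negligible_def
proof (intro allI impI)
  fix \<eta> :: real assume \<eta>: "\<eta> > 0"
  obtain B where B: "\<And>r. good r \<Longrightarrow> 0 \<le> \<tau> r + B" using tau_bounds by blast
  show "\<exists>C r0. \<forall>r R. r0 \<le> r \<longrightarrow> good r \<longrightarrow> good R \<longrightarrow> r + r powr \<delta> \<le> R \<longrightarrow> R \<le> r + 2 * r powr \<delta> \<longrightarrow> K \<le> C + \<eta> * \<tau> R"
  proof (rule exI[of _ "K + \<eta> * B"], rule exI[of _ 0], intro allI impI)
    fix r R assume "good R"
    then have "0 \<le> \<eta> * (\<tau> R + B)" using B \<eta> by simp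
    then show "K \<le> K + \<eta> * B + \<eta> * \<tau> R" by (simp add: distrib_left)
  qed
qed

lemma negligible_add:
  assumes "negligible \<Phi>" "negligible \<Psi>" shows "negligible (\<lambda>r. \<Phi> r + \<Psi> r)"
  unfolding negligible_def
proof (intro allI impI)
  fix \<eta> :: real assume "\<eta> > 0"
  then have e2: "\<eta> / 2 > 0" by simp
  obtain C1 r1 where C1: "\<And>r R. r1 \<le> r \<Longrightarrow> good r \<Longrightarrow> good R \<Longrightarrow> r + r powr \<delta> \<le> R \<Longrightarrow> R \<le> r + 2 * r powr \<delta> \<Longrightarrow>
     \<Phi> r \<le> C1 + \<eta> / 2 * \<tau> R" using assms(1) e2 unfolding negligible_def by blast
  obtain C2 r2 where C2: "\<And>r R. r2 \<le> r \<Longrightarrow> good r \<Longrightarrow> good R \<Longrightarrow> r + r powr \<delta> \<le> R \<Longrightarrow> R \<le> r + 2 * r powr \<delta> \<Longrightarrow>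
     \<Psi> r \<le> C2 + \<eta> / 2 * \<tau> R" using assms(2) e2 unfolding negligible_def by blast
  show "\<exists>C r0. \<forall>r R. r0 \<le> r \<longrightarrow> good r \<longrightarrow> good R \<longrightarrow> r + r powr \<delta> \<le> R \<longrightarrow> R \<le> r + 2 * r powr \<delta> \<longrightarrow> \<Phi> r + \<Psi> r \<le> C + \<eta> * \<tau> R"
  proof (rule exI[of _ "C1 + C2"], rule exI[of _ "max r1 r2"], intro allI impI)
    fix r R assume "max r1 r2 \<le> r" "good r" "good R" "r + r powr \<delta> \<le> R" "R \<le> r + 2 * r powr \<delta>"
    then have "\<Phi> r \<le> C1 + \<eta> / 2 * \<tau> R" "\<Psi> r \<le> C2 + \<eta> / 2 * \<tau> R" using C1 C2 by auto
    then show "\<Phi> r + \<Psi> r \<le> C1 + C2 + \<eta> * \<tau> R" by linarith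
  qed
qed

lemma negligible_sum:
  assumes "\<And>a. a \<in> A \<Longrightarrow> negligible (\<Phi> a)" shows "negligible (\<lambda>r. \<Sum>a\<in>A. \<Phi> a r)"
  using assms by (induction A rule: infinite_finite_induct) (auto intro: negligible_const negligible_add)

lemma dominated_mono:
  assumes "dominated \<Psi>" "\<And>r. good r \<Longrightarrow> \<Phi> r \<le> \<Psi> r" shows "dominated \<Phi>"
proof -
  obtain A r0 where "\<And>r. r0 \<le> r \<Longrightarrow> good r \<Longrightarrow> \<Psi> r \<le> A * exp ((2 * r) powr \<rho>)"
    using assms(1) unfolding dominated_def by blast
  then show ?thesis unfolding dominated_def using assms(2) by (intro exI[of _ A] exI[of _ r0]) (meson order_trans)
qed

lemma dominated_const: "dominated (\<lambda>r. K)"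
  unfolding dominated_def
proof (rule exI[of _ "\<bar>K\<bar>"], rule exI[of _ 0], intro allI impI)
  fix r :: real
  have "\<bar>K\<bar> * 1 \<le> \<bar>K\<bar> * exp ((2 * r) powr \<rho>)" by (intro mult_left_mono) auto
  then show "K \<le> \<bar>K\<bar> * exp ((2 * r) powr \<rho>)" by linarith
qed

lemma dominated_add:
  assumes "dominated \<Phi>" "dominated \<Psi>" shows "dominated (\<lambda>r. \<Phi> r + \<Psi> r)"
proof -
  obtain A r0 where A: "\<And>r. r0 \<le> r \<Longrightarrow> good r \<Longrightarrow> \<Phi> r \<le> A * exp ((2 * r) powr \<rho>)"
    using assms(1) unfolding dominated_def by blast
  obtain B r1 where B: "\<And>r. r1 \<le> r \<Longrightarrow> good r \<Longrightarrow> \<Psi> r \<le> B * exp ((2 * r) powr \<rho>)"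
    using assms(2) unfolding dominated_def by blast
  show ?thesis unfolding dominated_def
  proof (rule exI[of _ "A + B"], rule exI[of _ "max r0 r1"], intro allI impI)
    fix r assume "max r0 r1 \<le> r" "good r"
    then show "\<Phi> r + \<Psi> r \<le> (A + B) * exp ((2 * r) powr \<rho>)"
      using A[of r] B[of r] by (simp add: distrib_right)
  qed
qed

lemma dominated_sum:
  assumes "\<And>a. a \<in> A \<Longrightarrow> dominated (\<Phi> a)" shows "dominated (\<lambda>r. \<Sum>a\<in>A. \<Phi> a r)"
  using assms by (induction A rule: infinite_finite_induct) (auto intro: dominated_const dominated_add)

section \<open>Multipliers and ratios are small against \<tau>\<close>

lemma powr_delta_ge: "\<exists>r0\<ge>1. \<forall>r\<ge>r0. X \<le> r powr \<delta>"
proof -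
  have "filterlim (\<lambda>r::real. r powr \<delta>) at_top at_top" using delta(1) by real_asymp
  then have "eventually (\<lambda>r. X \<le> r powr \<delta>) at_top" by (simp add: filterlim_at_top)
  then obtain r0 where "\<And>r. r0 \<le> r \<Longrightarrow> X \<le> r powr \<delta>" unfolding eventually_at_top_linorder by blast
  then show ?thesis by (intro exI[of _ "max 1 r0"]) auto
qed

text \<open>For any s the product over the circuits through k is divisible by s shifted copies of h
  k, so the sum of their means at R is at most \<tau> R plus a constant. By
  \<open>circle_mean_shift\<close> each of them bounds one and the same mean at r up to the factor
  3; hence s times that mean is at most 3 \<tau> R plus a constant, and s is arbitrary.\<close>

lemma negligible_multiplier:
  assumes k: "k \<in> N"
  shows "negligible (\<lambda>r. circle_mean r (\<lambda>z. ln (norm (h k (z + of_nat m * c)))))"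
  unfolding negligible_def
proof (intro allI impI)
  fix \<eta> :: real assume \<eta>: "\<eta> > 0"
  \<comment> \<open>3 is the factor of \<open>circle_mean_shift\<close>.\<close>
  obtain s :: nat where s: "3 / \<eta> < s" using reals_Archimedean2 by blast
  have s0: "s > 0" using s \<eta> by (metis divide_pos_pos gr0I less_asym of_nat_0 zero_less_numeral)
  obtain B where B: "B \<ge> 0" "\<And>r. good r \<Longrightarrow> 0 \<le> \<tau> r + B" "\<And>r S. good r \<Longrightarrow> S \<subseteq> supports \<Longrightarrow> (\<Sum>D\<in>S. circle_mean r (log_sum D (V D))) \<le> \<tau> r + B"
    using tau_bounds by blast
  let ?S = "{D \<in> supports. k \<in> D}"
  obtain E where E: "entire E" "\<And>z. (\<Prod>D\<in>?S. V D k z) = H k s (z - of_nat s * c) * E z"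
    using circuit_component_divisible[OF k, of s] by blast
  have nzP: "nonzero (\<lambda>z. \<Prod>D\<in>?S. V D k z)" by (rule nonzero_prod) (use VD in auto)
  have nzE: "nonzero E" using nzP E(2) by (auto simp: nonzero_def)
  obtain CE where CE: "\<And>R. R > 1 \<Longrightarrow> (\<forall>z. norm z = R \<longrightarrow> E z \<noteq> 0) \<Longrightarrow> - CE \<le> circle_mean R (\<lambda>z. ln (norm (E z)))"
    using circle_mean_ln_lower_bound[OF E(1) nzE] by blast
  \<comment> \<open>H k s is evaluated at z - s c, so its factors are h k shifted by (l - s)
    c.\<close>
  define d where "d = - (of_nat s * c)"
  define hl where "hl l = (\<lambda>z. h k (z + of_nat l * c + d))" for l
  have hl_int: "hl l = (\<lambda>z. h k (z + of_int (int l - int s) * c))" for l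
    by (simp add: hl_def d_def algebra_simps)
  have hl_free: "sphere_free r (hl l)" if "good r" for l r unfolding hl_int by (rule good_h[OF that k])
  have hl_ent: "entire (hl l)" "nonzero (hl l)" for l unfolding hl_int using h k by auto
  \<comment> \<open>The shift that takes the l-th factor to the common function h k (z + m
    c).\<close>
  define b where "b l = of_nat m * c - of_nat l * c - d" for l
  have hlb: "hl l (z + b l) = h k (z + of_nat m * c)" for l z by (simp add: hl_def b_def)
  have "\<exists>C. \<forall>r R. 1 \<le> r \<longrightarrow> 2 * norm (b l) + 1 < R \<longrightarrow> r + norm (b l) < R \<longrightarrow> (\<forall>z. norm z = R \<longrightarrow> hl l z \<noteq> 0) \<longrightarrow> (\<forall>z. norm z = r \<longrightarrow> hl l (z + b l) \<noteq> 0) \<longrightarrow>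
    circle_mean r (\<lambda>z. ln (norm (hl l (z + b l)))) \<le> 3 * circle_mean R (\<lambda>z. ln (norm (hl l z))) + C" for l
    by (rule circle_mean_shift[OF hl_ent])
  then obtain C where C: "\<And>l r R. 1 \<le> r \<Longrightarrow> 2 * norm (b l) + 1 < R \<Longrightarrow> r + norm (b l) < R \<Longrightarrow> (\<forall>z. norm z = R \<longrightarrow> hl l z \<noteq> 0) \<Longrightarrow> (\<forall>z. norm z = r \<longrightarrow> hl l (z + b l) \<noteq> 0) \<Longrightarrow>
    circle_mean r (\<lambda>z. ln (norm (hl l (z + b l)))) \<le> 3 * circle_mean R (\<lambda>z. ln (norm (hl l z))) + C l" by metis
  define M where "M = (\<Sum>l<s. norm (b l))"
  have bM: "norm (b l) \<le> M" if "l < s" for l unfolding M_def by (rule member_le_sum) (use that in auto)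
  obtain r0 where r0: "r0 \<ge> 1" "\<And>r. r \<ge> r0 \<Longrightarrow> 2 * M + 1 \<le> r powr \<delta>" using powr_delta_ge[of "2 * M + 1"] by blast
  define C0 where "C0 = (3 * (B + CE) + (\<Sum>l<s. C l)) / s"
  show "\<exists>C r0. \<forall>r R. r0 \<le> r \<longrightarrow> good r \<longrightarrow> good R \<longrightarrow> r + r powr \<delta> \<le> R \<longrightarrow> R \<le> r + 2 * r powr \<delta> \<longrightarrow>
      circle_mean r (\<lambda>z. ln (norm (h k (z + of_nat m * c)))) \<le> C + \<eta> * \<tau> R"
  proof (rule exI[of _ "C0 + \<eta> * B"], rule exI[of _ r0], intro allI impI)
    fix r R assume r: "r0 \<le> r" "good r" and R: "good R" "r + r powr \<delta> \<le> R" "R \<le> r + 2 * r powr \<delta>"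
    have M0: "M \<ge> 0" unfolding M_def by (intro sum_nonneg) auto
    have rM: "r + (2 * M + 1) \<le> R" using r0(2)[OF r(1)] R by linarith
    have r1: "1 < r" "1 < R" using good_gt_1 r R by auto
    have fV: "sphere_free R (V D k)" if "D \<in> ?S" for D using good_V0[OF R(1)] that by auto
    have fE: "sphere_free R E"
      unfolding sphere_free_def
    proof (intro allI impI)
      fix z :: complex assume z: "norm z = R"
      have "(\<Prod>D\<in>?S. V D k z) \<noteq> 0" using finite_supports sphere_freeD[OF fV z] by simp
      then show "E z \<noteq> 0" using E(2)[of z] by auto
    qed
    let ?X = "circle_mean r (\<lambda>z. ln (norm (h k (z + of_nat m * c))))"
    have "s * ?X = (\<Sum>l<s. circle_mean r (\<lambda>z. ln (norm (hl l (z + b l)))))" unfolding hlb by simp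
    also have "\<dots> \<le> (\<Sum>l<s. 3 * circle_mean R (\<lambda>z. ln (norm (hl l z))) + C l)"
    proof (rule sum_mono)
      fix l assume "l \<in> {..<s}"
      then have l: "norm (b l) \<le> M" using bM by simp
      show "circle_mean r (\<lambda>z. ln (norm (hl l (z + b l)))) \<le> 3 * circle_mean R (\<lambda>z. ln (norm (hl l z))) + C l"
      proof (rule C)
        show "\<forall>z. norm z = R \<longrightarrow> hl l z \<noteq> 0" using hl_free[OF R(1)] unfolding sphere_free_def by blast
        show "\<forall>z. norm z = r \<longrightarrow> hl l (z + b l) \<noteq> 0" using good_h_nat[OF r(2) k, of m] unfolding sphere_free_def hlb by blast
      qed (use l rM r1 M0 in auto)
    qed
    also have "\<dots> = 3 * (\<Sum>l<s. circle_mean R (\<lambda>z. ln (norm (hl l z)))) + (\<Sum>l<s. C l)"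
      by (simp add: sum.distrib sum_distrib_left)
    also have "(\<Sum>l<s. circle_mean R (\<lambda>z. ln (norm (hl l z)))) = circle_mean R (\<lambda>z. ln (norm (H k s (z + d))))"
      unfolding hl_def by (rule circle_mean_ln_mult_prod[symmetric]) (use h k r1 hl_free[OF R(1)] in \<open>auto simp: hl_def\<close>)
    also have "circle_mean R (\<lambda>z. ln (norm (H k s (z + d)))) \<le> \<tau> R + B + CE"
    proof -
      have fH: "sphere_free R (\<lambda>z. H k s (z + d))"
        by (rule sphere_free_mult_prod) (use hl_free[OF R(1)] in \<open>simp add: hl_def\<close>)
      have cH: "continuous_on (sphere 0 R) (\<lambda>z. ln (norm (H k s (z + d))))"
        by (rule continuous_on_sphere_free[OF _ fH]) (use h k in auto)
      have cE: "continuous_on (sphere 0 R) (\<lambda>z. ln (norm (E z)))" by (rule continuous_on_sphere_free[OF E(1) fE])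
      have "circle_mean R (\<lambda>z. ln (norm (H k s (z + d)))) + circle_mean R (\<lambda>z. ln (norm (E z))) =
         circle_mean R (\<lambda>z. ln (norm (H k s (z + d))) + ln (norm (E z)))"
        by (rule circle_mean_add[symmetric]) (use cH cE r1 in auto)
      also have "\<dots> = circle_mean R (\<lambda>z. \<Sum>D\<in>?S. ln (norm (V D k z)))"
      proof (rule circle_mean_cong)
        fix z :: complex assume z: "norm z = R"
        have "ln (norm (H k s (z + d))) + ln (norm (E z)) = ln (norm (H k s (z + d) * E z))"
          using sphere_freeD[OF fH z] sphere_freeD[OF fE z] by (simp add: norm_mult ln_mult)
        also have "H k s (z + d) * E z = (\<Prod>D\<in>?S. V D k z)" using E(2)[of z] by (simp add: d_def)
        also have "ln (norm (\<Prod>D\<in>?S. V D k z)) = (\<Sum>D\<in>?S. ln (norm (V D k z)))"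
          unfolding prod_norm[symmetric] by (rule ln_prod) (use finite_supports sphere_freeD[OF fV z] in auto)
        finally show "ln (norm (H k s (z + d))) + ln (norm (E z)) = (\<Sum>D\<in>?S. ln (norm (V D k z)))" .
      qed (use r1 in simp)
      also have "\<dots> = (\<Sum>D\<in>?S. circle_mean R (\<lambda>z. ln (norm (V D k z))))"
        by (rule circle_mean_sum) (use VD(2) fV r1 in \<open>auto intro!: continuous_on_sphere_free\<close>)
      also have "\<dots> \<le> (\<Sum>D\<in>?S. circle_mean R (log_sum D (V D)))"
        by (intro sum_mono circle_mean_ln_le_log_sum) (use VD fV r1 in auto)
      also have "\<dots> \<le> \<tau> R + B" by (rule B(3)[OF R(1)]) auto
      finally have "circle_mean R (\<lambda>z. ln (norm (H k s (z + d)))) + circle_mean R (\<lambda>z. ln (norm (E z))) \<le> \<tau> R + B" .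
      moreover have "- CE \<le> circle_mean R (\<lambda>z. ln (norm (E z)))" using CE[OF r1(2)] fE unfolding sphere_free_def by blast
      ultimately show ?thesis by linarith
    qed
    finally have "s * ?X \<le> 3 * (\<tau> R + B + CE) + (\<Sum>l<s. C l)" by simp
    then have "?X \<le> (3 * (\<tau> R + B + CE) + (\<Sum>l<s. C l)) / s" using s0 by (simp add: field_simps)
    also have "\<dots> = C0 + 3 / s * \<tau> R" using s0 by (simp add: C0_def field_simps)
    also have "\<dots> \<le> C0 + \<eta> * B + \<eta> * \<tau> R"
    proof -
      have sn: "3 / s \<le> \<eta>" using s \<eta> s0 by (simp add: field_simps)
      \<comment> \<open>Applied to \<tau> R + B, which is nonnegative, as \<tau> R alone may be
        negative.\<close>
      have "3 / s * (\<tau> R + B) \<le> \<eta> * (\<tau> R + B)" using sn B(2)[OF R(1)] by (rule mult_right_mono)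
      moreover have "0 \<le> 3 / s * B" using B(1) by simp
      ultimately show ?thesis by (simp add: distrib_left)
    qed
    finally show "?X \<le> C0 + \<eta> * B + \<eta> * \<tau> R" .
  qed
qed

text \<open>9 + 6 ln r = 3 + 6 (1 + ln r), the sum of the two error terms in
  \<open>negligible_ratio\<close>.\<close>

lemma eps_small: "0 < \<epsilon> \<Longrightarrow> \<exists>r0\<ge>1. \<forall>r\<ge>r0. (9 + 6 * ln r) / r powr \<delta> \<le> \<epsilon>"
proof -
  assume "0 < \<epsilon>"
  have "((\<lambda>r::real. (9 + 6 * ln r) / r powr \<delta>) \<longlongrightarrow> 0) at_top" using delta(1) by real_asymp
  then have "eventually (\<lambda>r. (9 + 6 * ln r) / r powr \<delta> < \<epsilon>) at_top" using \<open>0 < \<epsilon>\<close> by (rule order_tendstoD)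
  then obtain r0 where "\<And>r. r0 \<le> r \<Longrightarrow> (9 + 6 * ln r) / r powr \<delta> < \<epsilon>" unfolding eventually_at_top_linorder by blast
  then show ?thesis by (intro exI[of _ "max 1 r0"]) (auto intro: less_imp_le)
qed

text \<open>By the shift identity the ratio of the two products H is a shift quotient of a ratio of
  components of V D. So the logarithmic difference is applied to the circuit and not to the curve,
  and its error is relative to \<tau>.\<close>

lemma negligible_ratio:
  assumes D: "D \<in> supports" and jk: "j \<in> D" "k \<in> D"
  shows "negligible (\<lambda>r. circle_mean r (\<lambda>z. \<bar>ln (norm (H j i z)) - ln (norm (H k i z))\<bar>))"
  unfolding negligible_def
proof (intro allI impI)
  fix \<eta> :: real assume \<eta>: "\<eta> > 0"
  note vD = VD[OF D]
  have jkN: "j \<in> N" "k \<in> N" using jk vD by auto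
  define b where "b = of_nat i * c"
  obtain B where B: "B \<ge> 0" "\<And>r. good r \<Longrightarrow> 0 \<le> \<tau> r + B" "\<And>r S. good r \<Longrightarrow> S \<subseteq> supports \<Longrightarrow> (\<Sum>D\<in>S. circle_mean r (log_sum D (V D))) \<le> \<tau> r + B"
    using tau_bounds by blast
  obtain K C where K: "K \<ge> 0" "C \<ge> 0" "\<And>r R R'. 1 \<le> r \<Longrightarrow> r < R \<Longrightarrow> 2 * norm b \<le> R - r \<Longrightarrow> R < R' \<Longrightarrow>
     (\<forall>l\<in>D. sphere_free r (V D l) \<and> sphere_free r (\<lambda>z. V D l (z + b)) \<and> sphere_free R (V D l) \<and> sphere_free R' (V D l)) \<Longrightarrow>
     circle_mean r (\<lambda>z. \<bar>(ln (norm (V D j (z + b))) - ln (norm (V D j z))) - (ln (norm (V D k (z + b))) - ln (norm (V D k z)))\<bar>)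
       \<le> K * (1 / (R - r) + R' / (R' - R) * ((1 + ln r) / r)) * (circle_mean R' (log_sum D (V D)) + C)"
    using family_log_difference[OF vD(1,2,3,4) jk, of b] by blast
  obtain r1 where r1: "r1 \<ge> 1" "\<And>r. r \<ge> r1 \<Longrightarrow> 6 * norm b \<le> r powr \<delta>" using powr_delta_ge[of "6 * norm b"] by blast
  obtain r2 where r2: "r2 \<ge> 1" "\<And>r. r \<ge> r2 \<Longrightarrow> (9 + 6 * ln r) / r powr \<delta> \<le> \<eta> / (K + 1)"
    using eps_small[of "\<eta> / (K + 1)"] \<eta> K by auto
  show "\<exists>C r0. \<forall>r R. r0 \<le> r \<longrightarrow> good r \<longrightarrow> good R \<longrightarrow> r + r powr \<delta> \<le> R \<longrightarrow> R \<le> r + 2 * r powr \<delta> \<longrightarrow>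
      circle_mean r (\<lambda>z. \<bar>ln (norm (H j i z)) - ln (norm (H k i z))\<bar>) \<le> C + \<eta> * \<tau> R"
  proof (rule exI[of _ "\<eta> * (B + C)"], rule exI[of _ "max r1 r2"], intro allI impI)
    fix r R' assume r: "max r1 r2 \<le> r" "good r" and R': "good R'" "r + r powr \<delta> \<le> R'" "R' \<le> r + 2 * r powr \<delta>"
    define \<omega> where "\<omega> = r powr \<delta>"
    have r1': "1 < r" using good_gt_1 r by auto
    have \<omega>0: "\<omega> > 0" unfolding \<omega>_def using r1' by simp
    have \<omega>r: "\<omega> \<le> r"
    proof -
      have "r powr \<delta> \<le> r powr 1" using r1' delta by (intro powr_mono) auto
      then show ?thesis using r1' by (simp add: \<omega>_def)
    qed
    \<comment> \<open>An intermediate radius keeps both R - r and R' - R of order r powr \<delta>; a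
      third of \<omega> exceeds the shift sufficiently since 6 norm b \<le> \<omega>.\<close>
    obtain R where R: "r + \<omega> / 3 < R" "R < r + \<omega> / 2" "good R"
      using good_dense[of "r + \<omega> / 3" "r + \<omega> / 2"] \<omega>0 r1' by auto
    have b6: "6 * norm b \<le> \<omega>" using r1(2)[of r] r by (simp add: \<omega>_def)
    have R'r: "R' \<le> 3 * r" "R' - R \<ge> \<omega> / 2" using R' R \<omega>r by (auto simp: \<omega>_def[symmetric])
    have free: "\<forall>l\<in>D. sphere_free r (V D l) \<and> sphere_free r (\<lambda>z. V D l (z + b)) \<and> sphere_free R (V D l) \<and> sphere_free R' (V D l)"
      using good_V0[OF r(2) D] good_V_nat[OF r(2) D, of _ i] good_V0[OF R(3) D] good_V0[OF R'(1) D] by (auto simp: b_def)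
    have "circle_mean r (\<lambda>z. \<bar>ln (norm (H j i z)) - ln (norm (H k i z))\<bar>) =
       circle_mean r (\<lambda>z. \<bar>(ln (norm (V D j (z + b))) - ln (norm (V D j z))) - (ln (norm (V D k (z + b))) - ln (norm (V D k z)))\<bar>)"
    proof (rule circle_mean_cong)
      fix z :: complex assume z: "norm z = r"
      have id: "V D k (z + b) * (V D j z * H j i z) = V D j (z + b) * (V D k z * H k i z)"
        using circuit_shift_iter[OF vD(6), of j k z i] jk unfolding V(2)[OF D] b_def by simp
      have "ln (norm (H j i z)) - ln (norm (H k i z)) = (ln (norm (V D j (z + b))) - ln (norm (V D j z))) - (ln (norm (V D k (z + b))) - ln (norm (V D k z)))"
      proof (rule ln_norm_cross_ratio[OF id])
        show "H j i z \<noteq> 0" "H k i z \<noteq> 0" using good_H[OF r(2) jkN(1)] good_H[OF r(2) jkN(2)] z by (auto simp: sphere_free_def)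
      qed (use free jk z in \<open>auto simp: sphere_free_def\<close>)
      then show "\<bar>ln (norm (H j i z)) - ln (norm (H k i z))\<bar> = \<bar>(ln (norm (V D j (z + b))) - ln (norm (V D j z))) - (ln (norm (V D k (z + b))) - ln (norm (V D k z)))\<bar>"
        by simp
    qed (use r1' in simp)
    also have "\<dots> \<le> K * (1 / (R - r) + R' / (R' - R) * ((1 + ln r) / r)) * (circle_mean R' (log_sum D (V D)) + C)"
      by (rule K(3)) (use r1' R b6 \<omega>0 R'r free in auto)
    also have "\<dots> \<le> K * (1 / (R - r) + R' / (R' - R) * ((1 + ln r) / r)) * (\<tau> R' + B + C)"
    proof (rule mult_left_mono)
      show "circle_mean R' (log_sum D (V D)) + C \<le> \<tau> R' + B + C" using B(3)[OF R'(1), of "{D}"] D by simp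
      have "0 \<le> ln r" using r1' by simp
      then show "0 \<le> K * (1 / (R - r) + R' / (R' - R) * ((1 + ln r) / r))"
        using K(1) R \<omega>0 R'r r1' good_gt_1[OF R'(1)] by (intro mult_nonneg_nonneg add_nonneg_nonneg divide_nonneg_nonneg) auto
    qed
    also have "\<dots> \<le> \<eta> * (\<tau> R' + B + C)"
    proof (rule mult_right_mono)
      have "1 / (R - r) \<le> 1 / (\<omega> / 3)" using R \<omega>0 by (intro divide_left_mono) auto
      moreover have "R' / (R' - R) \<le> (3 * r) / (\<omega> / 2)" using R'r \<omega>0 r1' good_gt_1[OF R'(1)] by (intro frac_le) auto
      then have "R' / (R' - R) * ((1 + ln r) / r) \<le> (3 * r) / (\<omega> / 2) * ((1 + ln r) / r)" using r1' by (intro mult_right_mono) auto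
      moreover have "(3 * r) / (\<omega> / 2) * ((1 + ln r) / r) = 6 * (1 + ln r) / \<omega>" using r1' by simp
      moreover have "1 / (\<omega> / 3) + 6 * (1 + ln r) / \<omega> = (9 + 6 * ln r) / \<omega>" by (simp add: add_divide_distrib[symmetric])
      ultimately have "1 / (R - r) + R' / (R' - R) * ((1 + ln r) / r) \<le> (9 + 6 * ln r) / \<omega>" by linarith
      also have "\<dots> \<le> \<eta> / (K + 1)" unfolding \<omega>_def using r2(2) r by simp
      finally have "K * (1 / (R - r) + R' / (R' - R) * ((1 + ln r) / r)) \<le> K * (\<eta> / (K + 1))" using K(1) by (rule mult_left_mono)
      also have "\<dots> \<le> \<eta>" using K(1) \<eta> by (simp add: field_simps)
      finally show "K * (1 / (R - r) + R' / (R' - R) * ((1 + ln r) / r)) \<le> \<eta>" .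
      show "0 \<le> \<tau> R' + B + C" using B(2)[OF R'(1)] K(2) by simp
    qed
    finally show "circle_mean r (\<lambda>z. \<bar>ln (norm (H j i z)) - ln (norm (H k i z))\<bar>) \<le> \<eta> * (B + C) + \<eta> * \<tau> R'"
      by (simp add: algebra_simps)
  qed
qed

section \<open>A priori bounds from the growth of the curve\<close>

lemma curve_growth: "\<exists>r0\<ge>1. \<forall>r R. r0 \<le> r \<longrightarrow> r \<le> R \<longrightarrow> R \<le> 2 * r \<longrightarrow> circle_mean R (log_sum N g) \<le> exp ((2 * r) powr \<rho>)"
proof -
  obtain r0 where r0: "\<And>r. r0 \<le> r \<Longrightarrow> circle_mean r (log_sum N g) \<le> exp (r powr \<rho>)" using growth by blast
  show ?thesis
  proof (rule exI[of _ "max 1 r0"], intro conjI allI impI)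
    fix r R assume r: "max 1 r0 \<le> r" "r \<le> R" "R \<le> 2 * r"
    have "circle_mean R (log_sum N g) \<le> exp (R powr \<rho>)" using r0[of R] r by auto
    also have "\<dots> \<le> exp ((2 * r) powr \<rho>)" using r rho by (auto intro!: powr_mono2)
    finally show "circle_mean R (log_sum N g) \<le> exp ((2 * r) powr \<rho>)" .
  qed simp
qed

text \<open>h k (z + m c) is a quotient of two shifts of g k: the mean of the numerator is bounded
  through \<open>circle_mean_shift\<close>, that of the denominator from below.\<close>

lemma dominated_multiplier:
  assumes k: "k \<in> N"
  shows "dominated (\<lambda>r. circle_mean r (\<lambda>z. ln (norm (h k (z + of_nat m * c)))))"
proof -
  define b where "b = of_nat (Suc m) * c"
  have gm: "entire (\<lambda>z. g k (z + of_nat m * c))" "nonzero (\<lambda>z. g k (z + of_nat m * c))" using g k by auto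
  obtain C1 where C1: "\<And>R. R > 1 \<Longrightarrow> (\<forall>z. norm z = R \<longrightarrow> g k (z + of_nat m * c) \<noteq> 0) \<Longrightarrow> - C1 \<le> circle_mean R (\<lambda>z. ln (norm (g k (z + of_nat m * c))))"
    using circle_mean_ln_lower_bound[OF gm] by blast
  obtain C2 where C2: "\<And>r R. 1 \<le> r \<Longrightarrow> 2 * norm b + 1 < R \<Longrightarrow> r + norm b < R \<Longrightarrow> (\<forall>z. norm z = R \<longrightarrow> g k z \<noteq> 0) \<Longrightarrow> (\<forall>z. norm z = r \<longrightarrow> g k (z + b) \<noteq> 0) \<Longrightarrow>
    circle_mean r (\<lambda>z. ln (norm (g k (z + b)))) \<le> 3 * circle_mean R (\<lambda>z. ln (norm (g k z))) + C2"
    using circle_mean_shift[OF g(1)[OF k] g(2)[OF k], of b] by blast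
  obtain r0 where r0: "r0 \<ge> 1" "\<And>r R. r0 \<le> r \<Longrightarrow> r \<le> R \<Longrightarrow> R \<le> 2 * r \<Longrightarrow> circle_mean R (log_sum N g) \<le> exp ((2 * r) powr \<rho>)"
    using curve_growth by blast
  show ?thesis unfolding dominated_def
  proof (rule exI[of _ "3 + \<bar>C1\<bar> + \<bar>C2\<bar>"], rule exI[of _ "max r0 (2 * norm b + 1)"], intro allI impI)
    fix r assume r: "max r0 (2 * norm b + 1) \<le> r" "good r"
    have r1: "1 < r" using good_gt_1 r by auto
    obtain R where R: "2 * r - 1 / 2 < R" "R < 2 * r" "good R" using good_dense[of "2 * r - 1 / 2" "2 * r"] r1 by auto
    have c1: "continuous_on (sphere 0 r) (\<lambda>z. ln (norm (h k (z + of_nat m * c))))"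
      by (rule continuous_on_sphere_free) (use h k good_h_nat[OF r(2) k] in auto)
    have c2: "continuous_on (sphere 0 r) (\<lambda>z. ln (norm (g k (z + of_nat m * c))))"
      by (rule continuous_on_sphere_free) (use gm good_g_nat[OF r(2) k] in auto)
    have "circle_mean r (\<lambda>z. ln (norm (h k (z + of_nat m * c)))) + circle_mean r (\<lambda>z. ln (norm (g k (z + of_nat m * c))))
      = circle_mean r (\<lambda>z. ln (norm (h k (z + of_nat m * c))) + ln (norm (g k (z + of_nat m * c))))"
      by (rule circle_mean_add[symmetric]) (use c1 c2 r1 in auto)
    also have "\<dots> = circle_mean r (\<lambda>z. ln (norm (g k (z + b))))"
    proof (rule circle_mean_cong)
      fix z :: complex assume z: "norm z = r"
      have "g k (z + b) = h k (z + of_nat m * c) * g k (z + of_nat m * c)"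
        using gh[OF k, of "z + of_nat m * c"] by (simp add: b_def algebra_simps)
      then show "ln (norm (h k (z + of_nat m * c))) + ln (norm (g k (z + of_nat m * c))) = ln (norm (g k (z + b)))"
        using sphere_freeD[OF good_h_nat[OF r(2) k] z] sphere_freeD[OF good_g_nat[OF r(2) k] z] by (simp add: norm_mult ln_mult)
    qed (use r1 in simp)
    also have "\<dots> \<le> 3 * circle_mean R (\<lambda>z. ln (norm (g k z))) + C2"
    proof (rule C2)
      show "\<forall>z. norm z = R \<longrightarrow> g k z \<noteq> 0" using good_g0[OF R(3) k] unfolding sphere_free_def by blast
      show "\<forall>z. norm z = r \<longrightarrow> g k (z + b) \<noteq> 0" using good_g_nat[OF r(2) k, of "Suc m"] unfolding sphere_free_def b_def by blast
      show "2 * norm b + 1 < R" "r + norm b < R" "1 \<le> r" using r R r1 norm_ge_zero[of b] by linarith+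
    qed
    also have "circle_mean R (\<lambda>z. ln (norm (g k z))) \<le> circle_mean R (log_sum N g)"
      by (rule circle_mean_ln_le_log_sum) (use finN g no_common k good_g0[OF R(3) k] good_gt_1[OF R(3)] in auto)
    also have "\<dots> \<le> exp ((2 * r) powr \<rho>)" by (rule r0(2)) (use r R r1 in auto)
    finally have 1: "circle_mean r (\<lambda>z. ln (norm (h k (z + of_nat m * c)))) + circle_mean r (\<lambda>z. ln (norm (g k (z + of_nat m * c))))
       \<le> 3 * exp ((2 * r) powr \<rho>) + C2" by simp
    have 2: "- C1 \<le> circle_mean r (\<lambda>z. ln (norm (g k (z + of_nat m * c))))"
      using C1[OF r1] good_g_nat[OF r(2) k] unfolding sphere_free_def by blast
    have "(\<bar>C1\<bar> + \<bar>C2\<bar>) * 1 \<le> (\<bar>C1\<bar> + \<bar>C2\<bar>) * exp ((2 * r) powr \<rho>)" by (intro mult_left_mono) auto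
    then show "circle_mean r (\<lambda>z. ln (norm (h k (z + of_nat m * c)))) \<le> (3 + \<bar>C1\<bar> + \<bar>C2\<bar>) * exp ((2 * r) powr \<rho>)"
      using 1 2 by (simp add: distrib_right)
  qed
qed

text \<open>The argument of \<open>negligible_ratio\<close> with the curve in place of a circuit. R
  - r and R' - R are now proportional to r, so the error factor is merely bounded.\<close>

lemma dominated_ratio:
  assumes jk: "j \<in> N" "k \<in> N"
  shows "dominated (\<lambda>r. circle_mean r (\<lambda>z. \<bar>ln (norm (H j i z)) - ln (norm (H k i z))\<bar>))"
proof -
  define b where "b = of_nat i * c"
  obtain K C where K: "K \<ge> 0" "C \<ge> 0" "\<And>r R R'. 1 \<le> r \<Longrightarrow> r < R \<Longrightarrow> 2 * norm b \<le> R - r \<Longrightarrow> R < R' \<Longrightarrow>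
     (\<forall>l\<in>N. sphere_free r (g l) \<and> sphere_free r (\<lambda>z. g l (z + b)) \<and> sphere_free R (g l) \<and> sphere_free R' (g l)) \<Longrightarrow>
     circle_mean r (\<lambda>z. \<bar>(ln (norm (g j (z + b))) - ln (norm (g j z))) - (ln (norm (g k (z + b))) - ln (norm (g k z)))\<bar>)
       \<le> K * (1 / (R - r) + R' / (R' - R) * ((1 + ln r) / r)) * (circle_mean R' (log_sum N g) + C)"
    using family_log_difference[OF finN g no_common jk, of b] by blast
  obtain r0 where r0: "r0 \<ge> 1" "\<And>r R. r0 \<le> r \<Longrightarrow> r \<le> R \<Longrightarrow> R \<le> 2 * r \<Longrightarrow> circle_mean R (log_sum N g) \<le> exp ((2 * r) powr \<rho>)"
    using curve_growth by blast
  show ?thesis unfolding dominated_def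
  proof (rule exI[of _ "K * 12 * (1 + C)"], rule exI[of _ "max r0 (8 * norm b)"], intro allI impI)
    fix r assume r: "max r0 (8 * norm b) \<le> r" "good r"
    have r1: "1 < r" using good_gt_1 r by auto
    obtain R where R: "5/4 * r < R" "R < 3/2 * r" "good R" using good_dense[of "5/4 * r" "3/2 * r"] r1 by auto
    obtain R' where R': "7/4 * r < R'" "R' < 2 * r" "good R'" using good_dense[of "7/4 * r" "2 * r"] r1 by auto
    have free: "\<forall>l\<in>N. sphere_free r (g l) \<and> sphere_free r (\<lambda>z. g l (z + b)) \<and> sphere_free R (g l) \<and> sphere_free R' (g l)"
      using good_g0[OF r(2)] good_g_nat[OF r(2), of _ i] good_g0[OF R(3)] good_g0[OF R'(3)] by (auto simp: b_def)
    have "circle_mean r (\<lambda>z. \<bar>ln (norm (H j i z)) - ln (norm (H k i z))\<bar>) =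
       circle_mean r (\<lambda>z. \<bar>(ln (norm (g j (z + b))) - ln (norm (g j z))) - (ln (norm (g k (z + b))) - ln (norm (g k z)))\<bar>)"
    proof (rule circle_mean_cong)
      fix z :: complex assume z: "norm z = r"
      have gb: "g l (z + b) = H l i z * g l z" if "l \<in> N" for l
        unfolding b_def by (rule mult_prod_shift_eq) (rule gh[OF that])
      have id: "g k (z + b) * (g j z * H j i z) = g j (z + b) * (g k z * H k i z)"
        unfolding gb[OF jk(1)] gb[OF jk(2)] by (simp add: mult_ac)
      have "ln (norm (H j i z)) - ln (norm (H k i z)) = (ln (norm (g j (z + b))) - ln (norm (g j z))) - (ln (norm (g k (z + b))) - ln (norm (g k z)))"
      proof (rule ln_norm_cross_ratio[OF id])
        show "H j i z \<noteq> 0" "H k i z \<noteq> 0" using good_H[OF r(2) jk(1)] good_H[OF r(2) jk(2)] z by (auto simp: sphere_free_def)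
      qed (use free jk z in \<open>auto simp: sphere_free_def\<close>)
      then show "\<bar>ln (norm (H j i z)) - ln (norm (H k i z))\<bar> = \<bar>(ln (norm (g j (z + b))) - ln (norm (g j z))) - (ln (norm (g k (z + b))) - ln (norm (g k z)))\<bar>"
        by simp
    qed (use r1 in simp)
    also have "\<dots> \<le> K * (1 / (R - r) + R' / (R' - R) * ((1 + ln r) / r)) * (circle_mean R' (log_sum N g) + C)"
      by (rule K(3)) (use r1 r R R' free in auto)
    also have "\<dots> \<le> K * (1 / (R - r) + R' / (R' - R) * ((1 + ln r) / r)) * (exp ((2 * r) powr \<rho>) + C)"
    proof (rule mult_left_mono)
      show "circle_mean R' (log_sum N g) + C \<le> exp ((2 * r) powr \<rho>) + C" using r0(2)[of r R'] r R' r1 by auto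
      have "0 \<le> ln r" using r1 by simp
      then show "0 \<le> K * (1 / (R - r) + R' / (R' - R) * ((1 + ln r) / r))"
        using K(1) R R' r1 by (intro mult_nonneg_nonneg add_nonneg_nonneg divide_nonneg_nonneg) auto
    qed
    also have "\<dots> \<le> K * 12 * (exp ((2 * r) powr \<rho>) + C)"
    proof (intro mult_right_mono mult_left_mono)
      \<comment> \<open>12 = 4 + 8: R - r is at least 1/4, and R' \<le> 2 r with R' - R \<ge> r / 4
        gives the 8.\<close>
      have "1 / (R - r) \<le> 1 / (1 / 4)" using R r1 by (intro divide_left_mono) auto
      then have a: "1 / (R - r) \<le> 4" by simp
      have "R' / (R' - R) \<le> (2 * r) / (r / 4)" using R' R r1 by (intro frac_le) auto
      then have b8: "R' / (R' - R) \<le> 8" using r1 by simp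
      have "ln r \<le> r - 1" using r1 by (intro ln_le_minus_one) auto
      then have l1: "(1 + ln r) / r \<le> 1" using r1 by simp
      have l2: "0 \<le> (1 + ln r) / r" using r1 by simp
      have "R' / (R' - R) * ((1 + ln r) / r) \<le> 8 * 1" using b8 l1 l2 R' R r1 by (intro mult_mono) auto
      with a show "1 / (R - r) + R' / (R' - R) * ((1 + ln r) / r) \<le> 12" by simp
    qed (use K in auto)
    also have "\<dots> \<le> K * 12 * (1 + C) * exp ((2 * r) powr \<rho>)"
    proof -
      have "C * 1 \<le> C * exp ((2 * r) powr \<rho>)" using K(2) by (intro mult_left_mono) auto
      then have "exp ((2 * r) powr \<rho>) + C \<le> (1 + C) * exp ((2 * r) powr \<rho>)" by (simp add: distrib_right)
      then have "K * 12 * (exp ((2 * r) powr \<rho>) + C) \<le> K * 12 * ((1 + C) * exp ((2 * r) powr \<rho>))"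
        using K(1) by (intro mult_left_mono) auto
      then show ?thesis by (simp only: mult.assoc)
    qed
    finally show "circle_mean r (\<lambda>z. \<bar>ln (norm (H j i z)) - ln (norm (H k i z))\<bar>) \<le> K * 12 * (1 + C) * exp ((2 * r) powr \<rho>)" .
  qed
qed

section \<open>Boundedness of \<tau> and equality of multipliers\<close>

lemma circuit_mean_estimate:
  assumes D: "D \<in> supports" and k0: "k0 \<in> D"
  shows "\<exists>p q C. \<forall>r. good r \<longrightarrow> circle_mean r (log_sum D (V D)) \<le> C + (\<Sum>a<(p::nat). (\<Sum>l<q a. circle_mean r (\<lambda>z. ln (norm (h k0 (z + of_nat l * c)))))
        + (\<Sum>j\<in>D. circle_mean r (\<lambda>z. \<bar>ln (norm (H j (q a) z)) - ln (norm (H k0 (q a) z))\<bar>)))"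
proof -
  note vD = VD[OF D]
  have k0N: "k0 \<in> N" using k0 vD by auto
  obtain p q C where C: "\<And>r. r > 1 \<Longrightarrow> sphere_free r (minor_cofactor D) \<Longrightarrow> (\<forall>k\<in>N. \<forall>l. sphere_free r (\<lambda>z. h k (z + of_nat l * c))) \<Longrightarrow>
     circle_mean r (log_sum D (V D)) \<le> C + (\<Sum>a<(p::nat). circle_mean r (\<lambda>z. ln (norm (H k0 (q a) z)))
        + (\<Sum>j\<in>D. circle_mean r (\<lambda>z. \<bar>ln (norm (H j (q a) z)) - ln (norm (H k0 (q a) z))\<bar>)))"
    using circuit_mean_bound[OF V(1)[OF D] minor_cofactor[OF D], of k0] k0 unfolding V(2)[OF D] by blast
  show ?thesis
  proof (rule exI[of _ p], rule exI[of _ q], rule exI[of _ C], intro allI impI)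
    fix r assume r: "good r"
    have r1: "1 < r" by (rule good_gt_1[OF r])
    have "minor_cofactor D \<in> fam" unfolding fam_def by (rule UnI2) (rule imageI[OF D])
    then have fM: "sphere_free r (minor_cofactor D)" using r unfolding good_def by blast
    have "circle_mean r (\<lambda>z. ln (norm (H k0 i z))) = (\<Sum>l<i. circle_mean r (\<lambda>z. ln (norm (h k0 (z + of_nat l * c)))))" for i
      using circle_mean_ln_mult_prod[of "h k0" r i c 0] h k0N r1 good_h_nat[OF r k0N] by simp
    then show "circle_mean r (log_sum D (V D)) \<le> C + (\<Sum>a<p. (\<Sum>l<q a. circle_mean r (\<lambda>z. ln (norm (h k0 (z + of_nat l * c)))))
        + (\<Sum>j\<in>D. circle_mean r (\<lambda>z. \<bar>ln (norm (H j (q a) z)) - ln (norm (H k0 (q a) z))\<bar>)))"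
      using C[OF r1 fM] good_h_nat[OF r] by simp
  qed
qed

lemma negligible_circuit: "D \<in> supports \<Longrightarrow> negligible (\<lambda>r. circle_mean r (log_sum D (V D)))"
proof -
  assume D: "D \<in> supports"
  obtain k0 where k0: "k0 \<in> D" using VD(7)[OF D] by blast
  have k0N: "k0 \<in> N" using k0 VD(5)[OF D] by auto
  obtain p q C where C: "\<And>r. good r \<Longrightarrow> circle_mean r (log_sum D (V D)) \<le> C + (\<Sum>a<(p::nat). (\<Sum>l<q a. circle_mean r (\<lambda>z. ln (norm (h k0 (z + of_nat l * c)))))
        + (\<Sum>j\<in>D. circle_mean r (\<lambda>z. \<bar>ln (norm (H j (q a) z)) - ln (norm (H k0 (q a) z))\<bar>)))"
    using circuit_mean_estimate[OF D k0] by blast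
  show ?thesis
    by (rule negligible_mono[OF _ C])
       (intro negligible_add negligible_const negligible_sum negligible_multiplier negligible_ratio[OF D] k0 k0N)
qed

lemma dominated_circuit: "D \<in> supports \<Longrightarrow> dominated (\<lambda>r. circle_mean r (log_sum D (V D)))"
proof -
  assume D: "D \<in> supports"
  obtain k0 where k0: "k0 \<in> D" using VD(7)[OF D] by blast
  have k0N: "k0 \<in> N" using k0 VD(5)[OF D] by auto
  obtain p q C where C: "\<And>r. good r \<Longrightarrow> circle_mean r (log_sum D (V D)) \<le> C + (\<Sum>a<(p::nat). (\<Sum>l<q a. circle_mean r (\<lambda>z. ln (norm (h k0 (z + of_nat l * c)))))
        + (\<Sum>j\<in>D. circle_mean r (\<lambda>z. \<bar>ln (norm (H j (q a) z)) - ln (norm (H k0 (q a) z))\<bar>)))"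
    using circuit_mean_estimate[OF D k0] by blast
  show ?thesis
    by (rule dominated_mono[OF _ C])
       (intro dominated_add dominated_const dominated_sum dominated_multiplier dominated_ratio k0N;
        use VD(5)[OF D] in blast)
qed

text \<open>Negligibility with \<eta> = 1/4 is the step inequality of
  \<open>growth_contradiction\<close>, domination is its growth bound.\<close>

lemma tau_bounded: "\<exists>M r0. \<forall>r\<ge>r0. good r \<longrightarrow> \<tau> r \<le> M"
proof -
  have "negligible \<tau>" unfolding \<tau>_def[abs_def] by (intro negligible_sum negligible_circuit)
  then obtain C r1 where C: "\<And>r R. r1 \<le> r \<Longrightarrow> good r \<Longrightarrow> good R \<Longrightarrow> r + r powr \<delta> \<le> R \<Longrightarrow> R \<le> r + 2 * r powr \<delta> \<Longrightarrow>
     \<tau> r \<le> C + 1 / 4 * \<tau> R" unfolding negligible_def by (metis zero_less_divide_1_iff zero_less_numeral)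
  have "dominated \<tau>" unfolding \<tau>_def[abs_def] by (intro dominated_sum dominated_circuit)
  then obtain A r2 where A: "\<And>r. r2 \<le> r \<Longrightarrow> good r \<Longrightarrow> \<tau> r \<le> A * exp ((2 * r) powr \<rho>)" unfolding dominated_def by blast
  define r0 where "r0 = max 1 (max r1 r2)"
  have "\<tau> r \<le> 4 * \<bar>C\<bar>" if "r0 \<le> r" "good r" for r
  proof (rule growth_contradiction[where \<tau> = \<tau> and r = r and C = "\<bar>C\<bar>" and G = good and \<delta> = \<delta> and \<rho> = \<rho> and ?r0.0 = r0 and A = "\<bar>A\<bar>"])
    show "\<exists>r. x < r \<and> r < y \<and> good r" if "1 \<le> x" "x < y" for x y using good_dense that by blast
    show "\<tau> r \<le> \<bar>C\<bar> + \<tau> R / 4" if "r0 \<le> r" "good r" "good R" "r + r powr \<delta> \<le> R" "R \<le> r + 2 * r powr \<delta>" for r R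
      using C[of r R] that by (simp add: r0_def)
    show "\<tau> r \<le> \<bar>A\<bar> * exp (2 * r powr \<rho>)" if "r0 \<le> r" "good r" for r
    proof -
      have "(2 * r) powr \<rho> = 2 powr \<rho> * r powr \<rho>" by (rule powr_mult)
      also have "\<dots> \<le> 2 powr 1 * r powr \<rho>" using rho by (intro mult_right_mono powr_mono) auto
      finally have e: "exp ((2 * r) powr \<rho>) \<le> exp (2 * r powr \<rho>)" by simp
      have "\<tau> r \<le> A * exp ((2 * r) powr \<rho>)" using A that by (simp add: r0_def)
      also have "\<dots> \<le> \<bar>A\<bar> * exp ((2 * r) powr \<rho>)" by (intro mult_right_mono) auto
      also have "\<dots> \<le> \<bar>A\<bar> * exp (2 * r powr \<rho>)" using e by (intro mult_left_mono) auto
      finally show ?thesis .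
    qed
  qed (use delta rho that in \<open>auto simp: r0_def\<close>)
  then show ?thesis by blast
qed

text \<open>As \<tau> is bounded, two components of a circuit have bounded characteristic and differ
  by a constant factor; this constant cancels from the difference equation.\<close>

theorem circuit_multipliers_eq:
  assumes D: "D \<in> supports" and jk: "j \<in> D" "k \<in> D"
  shows "h j z = h k z"
proof -
  note vD = VD[OF D]
  have jkN: "j \<in> N" "k \<in> N" using jk vD by auto
  obtain M r0 where M: "\<And>r. r0 \<le> r \<Longrightarrow> good r \<Longrightarrow> \<tau> r \<le> M" using tau_bounded by blast
  obtain B where B: "\<And>r S. good r \<Longrightarrow> S \<subseteq> supports \<Longrightarrow> (\<Sum>D\<in>S. circle_mean r (log_sum D (V D))) \<le> \<tau> r + B"
    using tau_bounds by blast
  have "\<exists>\<kappa>. \<kappa> \<noteq> 0 \<and> (\<forall>z. V D j z = \<kappa> * V D k z)"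
  proof (rule proportional_of_bounded_mean)
    show "entire (V D j)" "entire (V D k)" "nonzero (V D j)" "nonzero (V D k)" using vD jk by auto
    fix X :: real
    define x where "x = max 1 (max X r0)"
    obtain R where R: "x < R" "R < x + 1" "good R" using good_dense[of x "x + 1"] by (auto simp: x_def)
    have free: "sphere_free R (V D j)" "sphere_free R (V D k)" using good_V0[OF R(3) D] jk by auto
    have "circle_mean R (\<lambda>z. max (ln (norm (V D j z))) (ln (norm (V D k z)))) \<le> circle_mean R (log_sum D (V D))"
    proof (rule circle_mean_mono)
      show "continuous_on (sphere 0 R) (\<lambda>z. max (ln (norm (V D j z))) (ln (norm (V D k z))))"
        by (intro continuous_on_max continuous_on_sphere_free free vD(2))
      show "continuous_on (sphere 0 R) (log_sum D (V D))" by (rule continuous_on_log_sum) (use vD in auto)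
      show "max (ln (norm (V D j z))) (ln (norm (V D k z))) \<le> log_sum D (V D) z" if "norm z = R" for z
        using ln_norm_le_log_sum[of D j "V D" z] ln_norm_le_log_sum[of D k "V D" z] vD(1) jk
          sphere_freeD[OF free(1) that] sphere_freeD[OF free(2) that] by simp
    qed (use good_gt_1[OF R(3)] in simp)
    also have "\<dots> \<le> \<tau> R + B" using B[OF R(3), of "{D}"] D by simp
    also have "\<dots> \<le> M + B" using M[of R] R by (simp add: x_def)
    finally have "circle_mean R (\<lambda>z. max (ln (norm (V D j z))) (ln (norm (V D k z)))) \<le> M + B" .
    moreover have "X < R" using R by (simp add: x_def)
    ultimately show "\<exists>R>X. (\<forall>z. norm z = R \<longrightarrow> V D j z \<noteq> 0 \<and> V D k z \<noteq> 0) \<and>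
      circle_mean R (\<lambda>z. max (ln (norm (V D j z))) (ln (norm (V D k z)))) \<le> M + B"
      using free unfolding sphere_free_def by blast
  qed
  then obtain \<kappa> where \<kappa>: "\<kappa> \<noteq> 0" "\<And>z. V D j z = \<kappa> * V D k z" by blast
  have ent: "entire (V D k)" "nonzero (V D k)" using vD jk by auto
  show ?thesis
  proof (rule entire_mult_cancel[where f = "h j" and g = "h k" and h = "\<lambda>z. V D k (z + c) * V D k z"])
    show "nonzero (\<lambda>z. V D k (z + c) * V D k z)" by (rule nonzero_mult) (use ent in auto)
    show "h j z * (V D k (z + c) * V D k z) = h k z * (V D k (z + c) * V D k z)" for z
    proof -
      have "V D j (z + c) * (V D k z * h k z) = V D k (z + c) * (V D j z * h j z)"
        using circuit_shift[OF vD(6), of j k z] jk unfolding V(2)[OF D] by blast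
      then have "\<kappa> * (h j z * (V D k (z + c) * V D k z)) = \<kappa> * (h k z * (V D k (z + c) * V D k z))"
        unfolding \<kappa>(2) by (auto simp: mult_ac)
      then show ?thesis using \<kappa>(1) by simp
    qed
  qed (use h jkN ent in auto)
qed

text \<open>A difference analogue of Borel's theorem on sums of zero-free entire functions.\<close>
theorem exists_equal_multiplier:
  assumes "\<And>y. (\<Sum>j\<in>N. \<beta> j * g j y) = 0" "k \<in> N" "\<beta> k \<noteq> 0"
  shows "\<exists>j\<in>N. j \<noteq> k \<and> \<beta> j \<noteq> 0 \<and> (\<forall>z. h j z = h k z)"
proof -
  obtain D where D: "D \<in> supports" "k \<in> D" "\<And>j. j \<in> D \<Longrightarrow> \<beta> j \<noteq> 0" using circuit_of_constants[OF assms] by blast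
  note vD = VD[OF D(1)]
  have "\<exists>j\<in>D. j \<noteq> k"
  proof (rule ccontr)
    assume "\<not> (\<exists>j\<in>D. j \<noteq> k)"
    then have Dk: "D = {k}" using D(2) by blast
    have "V D k z = 0" for z
      using rel_sum_supp[OF vD(8), of z 0] unfolding V(2)[OF D(1)] unfolding Dk by simp
    then show False using vD(3)[OF D(2)] by (simp add: nonzero_def)
  qed
  then obtain j where j: "j \<in> D" "j \<noteq> k" by blast
  then show ?thesis using circuit_multipliers_eq[OF D(1) j(1) D(2)] D(3) vD(5) by blast
qed

end

section \<open>Hyperplanes in general position\<close>

lemma zorder_factored:
  assumes "entire E" "E p \<noteq> 0" "\<And>z. g z = (z - p) ^ k * E z"
  shows "zorder g p = int k"
  by (rule zorder_eqI[of UNIV p E]) (use assms in \<open>auto simp: entire_def\<close>)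

lemma zero_mult_factored:
  assumes E: "entire E" "E p \<noteq> 0" "\<And>z. g z = (z - p) ^ k * E z"
  shows "zero_mult g p = enat k"
proof -
  \<comment> \<open>\<open>zero_mult\<close> is infinite for the zero function, which has to be
    excluded first.\<close>
  have nz: "\<not> (\<forall>w. g w = 0)"
  proof
    assume "\<forall>w. g w = 0"
    then have "(w - p) ^ k * E w = 0" for w using E(3) by metis
    then have Ez: "w \<noteq> p \<Longrightarrow> E w = 0" for w by (metis eq_iff_diff_eq_0 mult_eq_0_iff power_not_zero)
    have "eventually (\<lambda>w. E w \<noteq> 0) (at p)" by (rule entire_eventually_nz) (use E in \<open>auto simp: nonzero_def\<close>)
    then have "eventually (\<lambda>w. False) (at p)"
      using eventually_neq_at_within[of p p UNIV] by eventually_elim (use Ez in blast)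
    then show False by simp
  qed
  show ?thesis
  proof (cases "k = 0")
    case True
    then show ?thesis using nz E unfolding zero_mult_def by (simp add: zero_enat_def)
  next
    case False
    have "zorder g p = int k" by (rule zorder_factored[OF E])
    moreover have "g p = 0" using False E(3)[of p] by simp
    ultimately show ?thesis using nz unfolding zero_mult_def by simp
  qed
qed

text \<open>At each point the multiplicity l of the shifted function is at least the multiplicity k
  of the original one, so the quotient is locally (w - z)^(l - k) times a function continuous at
  z.\<close>

lemma entire_multiplier:
  assumes \<phi>: "entire \<phi>" "nonzero \<phi>"
    and inv: "\<And>z0. zero_mult \<phi> z0 > 0 \<Longrightarrow> zero_mult (\<lambda>z. \<phi> (z + c)) z0 \<ge> zero_mult \<phi> z0"
  shows "\<exists>h. entire h \<and> nonzero h \<and> (\<forall>z. \<phi> (z + c) = h z * \<phi> z)"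
proof -
  have F: "entire (\<lambda>z. \<phi> (z + c))" "nonzero (\<lambda>z. \<phi> (z + c))" using \<phi> by auto
  have loc: "\<exists>e. isCont e z \<and> eventually (\<lambda>w. \<phi> (w + c) = \<phi> w * e w) (at z)" for z
  proof -
    obtain k E where E: "entire E" "E z \<noteq> 0" "\<And>w. \<phi> w = (w - z) ^ k * E w"
      by (rule entire_factor_zero[OF \<phi>, where p = z]) blast
    obtain l E' where E': "entire E'" "E' z \<noteq> 0" "\<And>w. \<phi> (w + c) = (w - z) ^ l * E' w"
      by (rule entire_factor_zero[OF F, where p = z]) blast
    have "zero_mult \<phi> z = enat k" by (rule zero_mult_factored[OF E])
    moreover have "zero_mult (\<lambda>w. \<phi> (w + c)) z = enat l" by (rule zero_mult_factored[OF E'])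
    \<comment> \<open>For k = 0 the invariance gives no information at z, but then k \<le> l is
      trivial.\<close>
    ultimately have kl: "k \<le> l" using inv[of z] by (cases "k = 0") (auto simp: zero_enat_def)
    have nE: "nonzero E" using E(2) by (auto simp: nonzero_def)
    have "isCont (\<lambda>w. (w - z) ^ (l - k) * E' w) z" using E' by (intro entire_isCont) auto
    then have "isCont (\<lambda>w. (w - z) ^ (l - k) * E' w / E w) z" using entire_isCont[OF E(1)] E(2) by (rule isCont_divide)
    moreover have "eventually (\<lambda>w. \<phi> (w + c) = \<phi> w * ((w - z) ^ (l - k) * E' w / E w)) (at z)"
      using entire_eventually_nz[OF E(1) nE, of z]
    proof eventually_elim
      case (elim w)
      have "(w - z) ^ l = (w - z) ^ k * (w - z) ^ (l - k)" using kl by (simp flip: power_add)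
      then show ?case using elim E(3)[of w] E'(3)[of w] by simp
    qed
    ultimately show ?thesis by blast
  qed
  obtain h where h: "entire h" "\<And>z. \<phi> (z + c) = \<phi> z * h z"
    by (rule entire_divides[OF F(1) \<phi> loc]) blast
  have "nonzero h" using F(2) h(2) by (auto simp: nonzero_def)
  then show ?thesis using h by (auto simp: mult.commute)
qed

section \<open>Linear algebra of the coefficient vectors\<close>

text \<open>n + 1 independent vectors form an invertible square matrix; B is its inverse, read off
  the adjugate and indexed by S itself.\<close>

lemma lin_indep_inverse:
  assumes S: "finite S" "card S = Suc n" and ind: "lin_indep_family n S a"
  shows "\<exists>B. \<forall>i\<le>n. \<forall>j\<le>n. (\<Sum>k\<in>S. a k j * B k i) = (if i = j then 1 else 0)"
proof -
  obtain ks where ks: "bij_betw ks {..<Suc n} S"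
    using ex_bij_betw_nat_finite[OF S(1)] S(2) by (auto simp: atLeast0LessThan)
  have inj: "inj_on ks {..<Suc n}" using ks by (simp add: bij_betw_def)
  \<comment> \<open>The vectors are the columns, so a kernel vector of A is a linear relation
    between them.\<close>
  define A where "A = mat (Suc n) (Suc n) (\<lambda>(j, i). a (ks i) j)"
  have A: "A \<in> carrier_mat (Suc n) (Suc n)" by (simp add: A_def)
  have dA: "det A \<noteq> 0"
  proof
    assume "det A = 0"
    then obtain v where v: "v \<in> carrier_vec (Suc n)" "v \<noteq> 0\<^sub>v (Suc n)" "A *\<^sub>v v = 0\<^sub>v (Suc n)"
      using det_0_iff_vec_prod_zero[OF A] by blast
    define b where "b k = vec_index v (the_inv_into {..<Suc n} ks k)" for k
    have bks: "b (ks i) = vec_index v i" if "i < Suc n" for i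
      unfolding b_def using the_inv_into_f_f[OF inj] that by simp
    have "\<forall>j\<le>n. (\<Sum>k\<in>S. b k * a k j) = 0"
    proof (intro allI impI)
      fix j assume j: "j \<le> n"
      have "(\<Sum>k\<in>S. b k * a k j) = (\<Sum>i<Suc n. b (ks i) * a (ks i) j)"
        by (rule sum.reindex_bij_betw[OF ks, symmetric])
      also have "\<dots> = (\<Sum>i<Suc n. A $$ (j, i) * vec_index v i)"
        by (rule sum.cong) (use j bks in \<open>auto simp: A_def\<close>)
      also have "\<dots> = vec_index (A *\<^sub>v v) j"
        using j v(1) A by (simp add: mult_mat_vec_def scalar_prod_def atLeast0LessThan)
      finally show "(\<Sum>k\<in>S. b k * a k j) = 0" using v(3) j by simp
    qed
    then have "\<forall>k\<in>S. b k = 0" using ind unfolding lin_indep_family_def by blast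
    then have "vec_index v i = 0" if "i < Suc n" for i using bks[OF that] ks that by (auto simp: bij_betw_def)
    then have "v = 0\<^sub>v (Suc n)" using v(1) by (intro eq_vecI) auto
    with v(2) show False by simp
  qed
  define B where "B k i = adj_mat A $$ (the_inv_into {..<Suc n} ks k, i) / det A" for k i
  have Bks: "B (ks l) i = adj_mat A $$ (l, i) / det A" if "l < Suc n" for l i
    unfolding B_def using the_inv_into_f_f[OF inj] that by simp
  show ?thesis
  proof (intro exI[of _ B] allI impI)
    fix i j assume i: "i \<le> n" and j: "j \<le> n"
    have "(\<Sum>k\<in>S. a k j * B k i) = (\<Sum>l<Suc n. a (ks l) j * B (ks l) i)"
      by (rule sum.reindex_bij_betw[OF ks, symmetric])
    also have "\<dots> = (\<Sum>l<Suc n. A $$ (j, l) * adj_mat A $$ (l, i)) / det A"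
      unfolding sum_divide_distrib by (rule sum.cong) (use j Bks in \<open>auto simp: A_def\<close>)
    also have "(\<Sum>l<Suc n. A $$ (j, l) * adj_mat A $$ (l, i)) = (A * adj_mat A) $$ (j, i)"
      using i j A adj_mat(1)[OF A] by (simp add: times_mat_def scalar_prod_def atLeast0LessThan)
    also have "\<dots> = (if i = j then det A else 0)" unfolding adj_mat(2)[OF A] using i j by auto
    finally show "(\<Sum>k\<in>S. a k j * B k i) = (if i = j then 1 else 0)" using dA by simp
  qed
qed

lemma lin_form_combination:
  assumes "finite S" "card S = Suc n" "lin_indep_family n S a"
  shows "\<exists>b. \<forall>x. lin_form n \<alpha> x = (\<Sum>k\<in>S. b k * lin_form n (a k) x)"
proof -
  obtain B where B: "\<And>i j. i \<le> n \<Longrightarrow> j \<le> n \<Longrightarrow> (\<Sum>k\<in>S. a k j * B k i) = (if i = j then 1 else 0)"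
    using lin_indep_inverse[OF assms] by blast
  have \<alpha>: "\<alpha> j = (\<Sum>k\<in>S. (\<Sum>i\<le>n. B k i * \<alpha> i) * a k j)" if j: "j \<le> n" for j
  proof -
    have "(\<Sum>k\<in>S. (\<Sum>i\<le>n. B k i * \<alpha> i) * a k j) = (\<Sum>i\<le>n. (\<Sum>k\<in>S. a k j * B k i) * \<alpha> i)"
      unfolding sum_distrib_right by (subst sum.swap) (simp add: mult_ac)
    also have "\<dots> = (\<Sum>i\<le>n. if i = j then \<alpha> i else 0)" by (rule sum.cong) (use B j in auto)
    also have "\<dots> = \<alpha> j" using j by simp
    finally show ?thesis by simp
  qed
  show ?thesis
  proof (intro exI allI)
    fix x
    have "lin_form n \<alpha> x = (\<Sum>j\<le>n. (\<Sum>k\<in>S. (\<Sum>i\<le>n. B k i * \<alpha> i) * a k j) * x j)"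
      unfolding lin_form_def by (rule sum.cong) (use \<alpha> in auto)
    also have "\<dots> = (\<Sum>k\<in>S. (\<Sum>i\<le>n. B k i * \<alpha> i) * lin_form n (a k) x)"
      unfolding lin_form_def sum_distrib_left sum_distrib_right[where A = S] by (subst sum.swap) (simp only: mult.assoc)
    finally show "lin_form n \<alpha> x = (\<Sum>k\<in>S. (\<lambda>k. \<Sum>i\<le>n. B k i * \<alpha> i) k * lin_form n (a k) x)" .
  qed
qed

text \<open>The j-th coordinate is itself a linear form, hence a combination of the given
  ones.\<close>

lemma lin_forms_vanish:
  assumes "finite S" "card S = Suc n" "lin_indep_family n S a" "\<And>k. k \<in> S \<Longrightarrow> lin_form n (a k) x = 0" "j \<le> n"
  shows "x j = 0"
proof -
  have "lin_form n (\<lambda>i. if i = j then 1 else 0) x = x j"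
  proof -
    have "(\<Sum>i\<le>n. (if i = j then 1 else 0) * x i) = (\<Sum>i\<le>n. if i = j then x i else 0)" by (rule sum.cong) auto
    then show ?thesis unfolding lin_form_def using assms(5) by simp
  qed
  moreover obtain b where "\<And>x. lin_form n (\<lambda>i. if i = j then 1 else 0) x = (\<Sum>k\<in>S. b k * lin_form n (a k) x)"
    using lin_form_combination[OF assms(1-3)] by blast
  ultimately show ?thesis using assms(4) by simp
qed

section \<open>The growth of the curve\<close>

lemma continuous_on_Max_image:
  fixes f :: "'a \<Rightarrow> 'b::topological_space \<Rightarrow> real"
  assumes "finite A" "A \<noteq> {}" "\<And>k. k \<in> A \<Longrightarrow> continuous_on S (f k)"
  shows "continuous_on S (\<lambda>z. Max ((\<lambda>k. f k z) ` A))"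
  using assms
proof (induction A rule: finite_ne_induct)
  case (insert k A)
  have "(\<lambda>z. Max ((\<lambda>k. f k z) ` insert k A)) = (\<lambda>z. max (f k z) (Max ((\<lambda>k. f k z) ` A)))"
    using insert by simp
  then show ?case using insert by (simp add: continuous_on_max)
qed simp

text \<open>Skipping the vanishing components agrees with taking the logarithm of the largest
  modulus, because the largest one is not zero; in the latter form continuity is evident.\<close>

lemma log_max_eq:
  assumes "\<exists>j\<le>n. f j z \<noteq> 0"
  shows "log_max n f z = ln (Max ((\<lambda>j. norm (f j z)) ` {..n}))" "0 < Max ((\<lambda>j. norm (f j z)) ` {..n})"
proof -
  let ?M = "Max ((\<lambda>j. norm (f j z)) ` {..n})"
  have le: "norm (f j z) \<le> ?M" if "j \<le> n" for j by (rule Max_ge) (use that in auto)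
  obtain i where "i \<le> n" "f i z \<noteq> 0" using assms by blast
  then show M0: "0 < ?M" using le[of i] by (meson less_le_trans zero_less_norm_iff)
  have "?M \<in> (\<lambda>j. norm (f j z)) ` {..n}" by (rule Max_in) auto
  then obtain j where j: "j \<le> n" "?M = norm (f j z)" by (elim imageE) simp
  show "log_max n f z = ln ?M" unfolding log_max_def
  proof (rule Max_eqI)
    show "y \<le> ln ?M" if "y \<in> (\<lambda>j. ln (norm (f j z))) ` {j. j \<le> n \<and> f j z \<noteq> 0}" for y
      using that le by (auto intro!: ln_mono)
    show "ln ?M \<in> (\<lambda>j. ln (norm (f j z))) ` {j. j \<le> n \<and> f j z \<noteq> 0}"
      using j M0 by (intro image_eqI[of _ _ j]) auto
  qed auto
qed

lemma cartan_char_bound: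
  assumes "hyper_order n f < 1"
  shows "\<exists>\<rho> r0. 0 < \<rho> \<and> \<rho> < 1 \<and> (\<forall>r\<ge>r0. cartan_char n f r \<le> exp (r powr \<rho>))"
proof -
  obtain x where x: "hyper_order n f < ereal x" "ereal x < 1" using ereal_dense2[OF assms] by blast
  \<comment> \<open>The maximum with 1/2 makes \<rho> visibly positive.\<close>
  define \<rho> where "\<rho> = max x (1 / 2)"
  have \<rho>: "0 < \<rho>" "\<rho> < 1" using x(2) by (auto simp: \<rho>_def)
  have "eventually (\<lambda>r. ereal (log_plus (log_plus (cartan_char n f r)) / ln r) < ereal x) at_top"
    by (rule Limsup_lessD) (use x(1) in \<open>simp add: hyper_order_def\<close>)
  then obtain r1 where r1: "\<And>r. r \<ge> r1 \<Longrightarrow> log_plus (log_plus (cartan_char n f r)) / ln r < x"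
    unfolding eventually_at_top_linorder by auto
  show ?thesis
  proof (rule exI[of _ \<rho>], rule exI[of _ "max 2 r1"], intro conjI allI impI \<rho>)
    fix r assume r: "max 2 r1 \<le> r"
    define T where "T = cartan_char n f r"
    have lr: "ln r > 0" using r by simp
    have rp: "1 \<le> r powr \<rho>" using r \<rho> by (intro ge_one_powr_ge_zero) auto
    show "cartan_char n f r \<le> exp (r powr \<rho>)"
    \<comment> \<open>For T > e both truncations in \<open>log_plus\<close> are inactive; smaller
      values lie below exp (r powr \<rho>) because r powr \<rho> \<ge> 1.\<close>
    proof (cases "T \<le> exp 1")
      case True
      also have "exp 1 \<le> exp (r powr \<rho>)" using rp by simp
      finally show ?thesis by (simp add: T_def)
    next
      case False
      then have T0: "T > 0" by (meson exp_gt_zero less_trans not_le)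
      have "ln (exp 1) < ln T" using False T0 by (subst ln_less_cancel_iff) auto
      then have l1: "1 < ln T" by simp
      have l0: "0 < ln T" using l1 by linarith
      have "log_plus T = ln T" unfolding log_plus_def if_P[OF T0] using l1 by linarith
      moreover have "log_plus (ln T) = ln (ln T)"
        unfolding log_plus_def if_P[OF l0] using ln_gt_zero[OF l1] by linarith
      ultimately have "log_plus (log_plus T) = ln (ln T)" by simp
      then have "ln (ln T) / ln r < x" using r1[of r] r by (simp add: T_def)
      then have "ln (ln T) < x * ln r" using lr by (simp add: field_simps)
      also have "\<dots> \<le> \<rho> * ln r" using lr by (intro mult_right_mono) (auto simp: \<rho>_def)
      finally have "exp (ln (ln T)) < exp (\<rho> * ln r)" by simp
      then have "ln T < r powr \<rho>" using l1 r by (simp add: powr_def)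
      have "T = exp (ln T)" using T0 by simp
      also have "\<dots> \<le> exp (r powr \<rho>)" using \<open>ln T < r powr \<rho>\<close> unfolding exp_le_cancel_iff by simp
      finally show ?thesis by (simp add: T_def)
    qed
  qed
qed

theorem corollary1p3:
  fixes n :: nat
    and f :: "nat \<Rightarrow> complex \<Rightarrow> complex"
    and F :: "complex \<Rightarrow> (nat \<Rightarrow> complex) set"
    and c :: complex
    and a :: "nat \<Rightarrow> nat \<Rightarrow> complex"
  assumes "reduced_representation n f F"
    and "hyper_order n f < 1"
    and "\<And>k. k \<le> 2 * n \<Longrightarrow> \<exists>j\<le>n. a k j \<noteq> 0"
    and "general_position n (2 * n) a"
    and "\<And>k. k \<le> 2 * n \<Longrightarrow> forward_invariant_preimage n f c (a k)"
  shows "\<forall>z. F (z + c) = F z"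
proof -
  have f: "\<And>j. j \<le> n \<Longrightarrow> entire (f j)" and fnc: "\<And>z. \<exists>j\<le>n. f j z \<noteq> 0"
    and F: "\<And>z. F z = proj_point n (\<lambda>j. f j z)"
    using assms(1) unfolding reduced_representation_def entire_def by blast+
  have gp: "lin_indep_family n S a" if "S \<subseteq> {..2 * n}" "card S = Suc n" for S
    using assms(4) that unfolding general_position_def by (simp add: atLeast0AtMost)
  have finS: "finite S" if "S \<subseteq> {..2 * n}" for S using that finite_subset by blast
  define \<phi> where "\<phi> k z = lin_form n (a k) (\<lambda>j. f j z)" for k z
  have ent\<phi>: "entire (\<phi> k)" for k
    unfolding \<phi>_def lin_form_def using f by (intro entire_sum entire_intros) auto
  \<comment> \<open>A form that vanishes identically on the curve does not determine a multiplier;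
    it is left out here and satisfies the final identity trivially.\<close>
  define N where "N = {k. k \<le> 2 * n \<and> nonzero (\<phi> k)}"
  have N: "N \<subseteq> {..2 * n}" "finite N" unfolding N_def by auto
  have notN: "\<phi> k z = 0" if "k \<le> 2 * n" "k \<notin> N" for k z using that by (auto simp: N_def nonzero_def)
  have "\<exists>h. entire h \<and> nonzero h \<and> (\<forall>z. \<phi> k (z + c) = h z * \<phi> k z)" if "k \<in> N" for k
  proof (rule entire_multiplier[OF ent\<phi>])
    show "nonzero (\<phi> k)" using that by (simp add: N_def)
    show "zero_mult (\<phi> k) z0 \<le> zero_mult (\<lambda>z. \<phi> k (z + c)) z0" if "0 < zero_mult (\<phi> k) z0" for z0
      using assms(5)[of k] \<open>k \<in> N\<close> that unfolding forward_invariant_preimage_def Let_def \<phi>_def[abs_def] N_def by auto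
  qed
  then obtain h where h: "\<And>k. k \<in> N \<Longrightarrow> entire (h k)" "\<And>k. k \<in> N \<Longrightarrow> nonzero (h k)"
    "\<And>k z. k \<in> N \<Longrightarrow> \<phi> k (z + c) = h k z * \<phi> k z" by metis
  have vanish: "\<not> (\<forall>k\<in>S. \<phi> k z = 0)" if "S \<subseteq> {..2 * n}" "card S = Suc n" for S z
    using lin_forms_vanish[OF finS[OF that(1)] that(2) gp[OF that], of "\<lambda>j. f j z"] fnc[of z] unfolding \<phi>_def by blast
  have combination: "\<exists>\<beta>. \<beta> k \<noteq> 0 \<and> (\<forall>y. (\<Sum>j\<in>N. \<beta> j * \<phi> j y) = 0) \<and> (\<forall>j\<in>N. j \<noteq> k \<longrightarrow> \<beta> j \<noteq> 0 \<longrightarrow> j \<in> S)"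
    if k: "k \<in> N" and S: "S \<subseteq> {..2 * n} - {k}" "card S = Suc n" for k S
  proof -
    have S': "S \<subseteq> {..2 * n}" using S by blast
    obtain b where b: "\<And>x. lin_form n (a k) x = (\<Sum>i\<in>S. b i * lin_form n (a i) x)"
      using lin_form_combination[OF finS[OF S'] S(2) gp[OF S' S(2)]] by blast
    \<comment> \<open>-1 at k and the coefficients of the combination on S. Indices of S outside N
      drop out because their forms vanish identically.\<close>
    define \<beta> where "\<beta> j = (if j = k then -1 else if j \<in> S then b j else 0)" for j
    have "(\<Sum>j\<in>N. \<beta> j * \<phi> j y) = 0" for y
    proof -
      have "(\<Sum>j\<in>N. \<beta> j * \<phi> j y) = - \<phi> k y + (\<Sum>j\<in>N - {k}. \<beta> j * \<phi> j y)"
        using sum.remove[OF N(2) k, of "\<lambda>j. \<beta> j * \<phi> j y"] by (simp add: \<beta>_def)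
      also have "(\<Sum>j\<in>N - {k}. \<beta> j * \<phi> j y) = (\<Sum>j\<in>S. b j * \<phi> j y)"
      proof (rule sum.mono_neutral_cong)
        show "finite (N - {k})" "finite S" using N finS[OF S'] by auto
        show "b i * \<phi> i y = 0" if "i \<in> S - (N - {k})" for i
          using notN[of i y] that S by auto
        show "\<beta> i * \<phi> i y = 0" if "i \<in> N - {k} - S" for i using that by (auto simp: \<beta>_def)
        show "\<beta> i * \<phi> i y = b i * \<phi> i y" if "i \<in> (N - {k}) \<inter> S" for i using that by (auto simp: \<beta>_def)
      qed
      also have "\<dots> = \<phi> k y" unfolding \<phi>_def b[of "\<lambda>j. f j y"] ..
      finally show ?thesis by simp
    qed
    then show ?thesis by (intro exI[of _ \<beta>]) (auto simp: \<beta>_def)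
  qed
  have span: "\<exists>\<beta>. \<beta> k \<noteq> 0 \<and> (\<forall>y. (\<Sum>j\<in>N. \<beta> j * \<phi> j y) = 0) \<and> (\<forall>j\<in>N. j \<noteq> k \<longrightarrow> \<beta> j \<noteq> 0 \<longrightarrow> \<phi> j z \<noteq> 0)"
    if k: "k \<in> N" "\<phi> k z = 0" for k z
  proof -
    define Z where "Z = {i. i \<le> 2 * n \<and> \<phi> i z = 0}"
    have Z: "Z \<subseteq> {..2 * n}" unfolding Z_def by auto
    \<comment> \<open>At most n forms vanish at z, so at least n + 1 of the 2 n + 1 do not, and
      these span.\<close>
    have "card Z \<le> n"
    proof (rule ccontr)
      assume "\<not> card Z \<le> n"
      then obtain S where S: "S \<subseteq> Z" "card S = Suc n" using obtain_subset_with_card_n[of "Suc n" Z] by auto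
      then show False using vanish[of S z] Z by (auto simp: Z_def)
    qed
    then have "Suc n \<le> card ({..2 * n} - Z)" using card_Diff_subset[OF finS[OF Z] Z] by simp
    then obtain S where S: "S \<subseteq> {..2 * n} - Z" "card S = Suc n" using obtain_subset_with_card_n by metis
    have "k \<in> Z" using k N by (auto simp: Z_def N_def)
    then have "S \<subseteq> {..2 * n} - {k}" using S by blast
    from combination[OF k(1) this S(2)] obtain \<beta> where "\<beta> k \<noteq> 0" "\<forall>y. (\<Sum>j\<in>N. \<beta> j * \<phi> j y) = 0"
      "\<forall>j\<in>N. j \<noteq> k \<longrightarrow> \<beta> j \<noteq> 0 \<longrightarrow> j \<in> S" by blast
    moreover have "\<phi> j z \<noteq> 0" if "j \<in> S" for j using that S by (auto simp: Z_def)
    ultimately show ?thesis by blast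
  qed
  have ncN: "\<exists>k\<in>N. \<phi> k z \<noteq> 0" for z
  proof -
    have "\<not> (\<forall>k\<in>{..n}. \<phi> k z = 0)" by (rule vanish) auto
    then obtain k where "k \<le> n" "\<phi> k z \<noteq> 0" by auto
    then show ?thesis using notN[of k z] by (intro bexI[of _ k]) auto
  qed
  obtain \<rho>0 r1 where \<rho>0: "0 < \<rho>0" "\<rho>0 < 1" "\<And>r. r \<ge> r1 \<Longrightarrow> cartan_char n f r \<le> exp (r powr \<rho>0)"
    using cartan_char_bound[OF assms(2)] by blast
  \<comment> \<open>Strictly between \<rho>0 and 1, to absorb the additive constants between
    \<open>log_sum\<close> and the characteristic.\<close>
  define \<rho> where "\<rho> = (1 + \<rho>0) / 2"
  have \<rho>: "0 < \<rho>" "\<rho> < 1" "\<rho>0 < \<rho>" using \<rho>0 by (auto simp: \<rho>_def)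
  define M where "M z = Max ((\<lambda>j. norm (f j z)) ` {..n})" for z
  have lmM: "log_max n f z = ln (M z)" "0 < M z" for z using log_max_eq[where n = n and f = f, OF fnc[of z]] by (auto simp: M_def)
  have Mnz: "M z \<noteq> 0" for z using lmM(2)[of z] by linarith
  have cM: "continuous_on UNIV M"
    unfolding M_def
  proof (rule continuous_on_Max_image)
    show "continuous_on UNIV (\<lambda>z. norm (f j z))" if "j \<in> {..n}" for j
      using f[of j] that by (intro continuous_on_norm entire_continuous_on[of "f j" _ "\<lambda>z. z"] continuous_on_id) auto
  qed auto
  have clm: "continuous_on S (log_max n f)" for S
  proof -
    have "continuous_on UNIV (\<lambda>z. ln (M z))" by (intro continuous_on_ln cM ballI Mnz)
    then show ?thesis unfolding lmM(1)[abs_def] by (rule continuous_on_subset) simp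
  qed
  define A where "A = 1 + (\<Sum>k\<in>N. \<Sum>j\<le>n. norm (a k j))"
  have A1: "1 \<le> A" unfolding A_def by (simp add: sum_nonneg)
  have log_le: "log_sum N \<phi> z \<le> ln A + log_max n f z" for z
  proof -
    have "norm (\<phi> k z) \<le> (\<Sum>j\<le>n. norm (a k j)) * M z" for k
    proof -
      have "norm (\<phi> k z) \<le> (\<Sum>j\<le>n. norm (a k j * f j z))" unfolding \<phi>_def lin_form_def by (rule norm_sum)
      also have "\<dots> \<le> (\<Sum>j\<le>n. norm (a k j) * M z)"
        unfolding norm_mult M_def by (intro sum_mono mult_left_mono Max_ge) auto
      finally show ?thesis by (simp add: sum_distrib_right)
    qed
    then have "(\<Sum>k\<in>N. norm (\<phi> k z)) \<le> (\<Sum>k\<in>N. (\<Sum>j\<le>n. norm (a k j)) * M z)" by (rule sum_mono)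
    also have "\<dots> = (\<Sum>k\<in>N. \<Sum>j\<le>n. norm (a k j)) * M z" by (simp add: sum_distrib_right)
    also have "\<dots> \<le> A * M z" using lmM(2)[of z] by (intro mult_right_mono) (auto simp: A_def)
    finally have "(\<Sum>k\<in>N. norm (\<phi> k z)) \<le> A * M z" .
    moreover have "0 < (\<Sum>k\<in>N. norm (\<phi> k z))" using ncN[of z] N by (auto intro: sum_pos2)
    ultimately have "log_sum N \<phi> z \<le> ln (A * M z)" unfolding log_sum_def by (intro ln_mono)
    also have "\<dots> = ln A + ln (M z)" using A1 lmM(2)[of z] by (intro ln_mult_pos) auto
    finally show ?thesis using lmM by simp
  qed
  have growth: "\<exists>r0. \<forall>r\<ge>r0. circle_mean r (log_sum N \<phi>) \<le> exp (r powr \<rho>)"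
  proof -
    define K where "K = ln A + log_max n f 0"
    have "eventually (\<lambda>r. exp (r powr \<rho>0) + K \<le> exp (r powr \<rho>)) at_top" using \<rho> \<rho>0 by real_asymp
    then obtain r2 where r2: "\<And>r. r \<ge> r2 \<Longrightarrow> exp (r powr \<rho>0) + K \<le> exp (r powr \<rho>)" unfolding eventually_at_top_linorder by blast
    show ?thesis
    proof (intro exI allI impI)
      fix r assume r: "r \<ge> max 0 (max r1 r2)"
      have "circle_mean r (log_sum N \<phi>) \<le> circle_mean r (\<lambda>z. ln A + log_max n f z)"
        by (rule circle_mean_mono)
           (use N ent\<phi> ncN clm r log_le in \<open>auto intro!: continuous_on_log_sum continuous_on_add continuous_on_const\<close>)
      also have "\<dots> = ln A + circle_mean r (log_max n f)"
        using circle_mean_add[OF continuous_on_const clm, of r "ln A"] r by simp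
      also have "circle_mean r (log_max n f) = cartan_char n f r + log_max n f 0"
        unfolding cartan_char_def circle_mean_def by simp
      also have "ln A + (cartan_char n f r + log_max n f 0) \<le> exp (r powr \<rho>0) + K"
        using \<rho>0(3)[of r] r by (simp add: K_def)
      also have "\<dots> \<le> exp (r powr \<rho>)" using r2[of r] r by simp
      finally show "circle_mean r (log_sum N \<phi>) \<le> exp (r powr \<rho>)" .
    qed
  qed
  note shift\<phi> = h(3)
  interpret shift_curve N h c \<phi> \<rho>
    by unfold_locales (use N h ent\<phi> ncN \<rho> growth span in \<open>auto simp: N_def\<close>)
  obtain k0 where k0: "k0 \<in> N" using ncN by blast
  have eq: "h k z = h k0 z" if k1: "k \<in> N" for k z
  proof (rule ccontr)
    assume ne: "h k z \<noteq> h k0 z"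
    define I where "I \<kappa> = {j \<in> N. \<forall>z. h j z = h \<kappa> z}" for \<kappa>
    have I: "I \<kappa> \<subseteq> {..2 * n}" for \<kappa> using N by (auto simp: I_def)
    have disj: "I k \<inter> I k0 = {}" using ne by (auto simp: I_def)
    \<comment> \<open>If n + 1 indices lay outside the class of \<kappa>, its form would be a
      combination of theirs, and \<open>exists_equal_multiplier\<close> would find among them one
      with the same multiplier. So each class has more than n elements, and two disjoint ones do not
      fit into 2 n + 1.\<close>
    have small: "\<not> Suc n \<le> card ({..2 * n} - I \<kappa>)" if \<kappa>: "\<kappa> \<in> N" for \<kappa>
    proof
      assume "Suc n \<le> card ({..2 * n} - I \<kappa>)"
      then obtain S where S: "S \<subseteq> {..2 * n} - I \<kappa>" "card S = Suc n" using obtain_subset_with_card_n by metis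
      have "\<kappa> \<in> I \<kappa>" using \<kappa> by (simp add: I_def)
      then have "S \<subseteq> {..2 * n} - {\<kappa>}" using S by blast
      from combination[OF \<kappa> this S(2)] obtain \<beta> where \<beta>: "\<beta> \<kappa> \<noteq> 0" "\<And>y. (\<Sum>j\<in>N. \<beta> j * \<phi> j y) = 0"
        "\<And>j. j \<in> N \<Longrightarrow> j \<noteq> \<kappa> \<Longrightarrow> \<beta> j \<noteq> 0 \<Longrightarrow> j \<in> S" by blast
      obtain j where "j \<in> N" "j \<noteq> \<kappa>" "\<beta> j \<noteq> 0" "\<forall>z. h j z = h \<kappa> z"
        using exists_equal_multiplier[OF \<beta>(2) \<kappa> \<beta>(1)] by blast
      then have "j \<in> S" "j \<in> I \<kappa>" using \<beta>(3) by (auto simp: I_def)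
      then show False using S by blast
    qed
    have "card (I k \<union> I k0) \<le> card {..2 * n}" by (rule card_mono) (use I in auto)
    then have "card (I k) + card (I k0) \<le> 2 * n + 1" using card_Un_disjoint[OF finS[OF I] finS[OF I] disj] by simp
    moreover have "card ({..2 * n} - I \<kappa>) = 2 * n + 1 - card (I \<kappa>)" for \<kappa> using card_Diff_subset[OF finS[OF I] I] by simp
    ultimately show False using small[OF k1] small[OF k0] by simp
  qed
  show ?thesis
  proof
    fix z
    have sh: "\<phi> k (z + c) = h k0 z * \<phi> k z" if "k \<le> 2 * n" for k
      using shift\<phi>[of k z] eq[of k z] notN[OF that] by (cases "k \<in> N") auto
    have fj: "f j (z + c) = h k0 z * f j z" if "j \<le> n" for j
    proof -
      \<comment> \<open>n + 1 independent forms annihilate the vector with these entries.\<close>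
      have "f j (z + c) - h k0 z * f j z = 0"
      proof (rule lin_forms_vanish[where S = "{..n}" and n = n and a = a and x = "\<lambda>j. f j (z + c) - h k0 z * f j z"])
        show "lin_indep_family n {..n} a" by (rule gp) auto
        show "lin_form n (a k) (\<lambda>j. f j (z + c) - h k0 z * f j z) = 0" if "k \<in> {..n}" for k
        proof -
          have "lin_form n (a k) (\<lambda>j. f j (z + c) - h k0 z * f j z) = \<phi> k (z + c) - h k0 z * \<phi> k z"
            unfolding \<phi>_def lin_form_def by (simp add: right_diff_distrib sum_subtractf sum_distrib_left mult.left_commute)
          then show ?thesis using sh[of k] that by simp
        qed
      qed (use that in auto)
      then show ?thesis by simp
    qed
    \<comment> \<open>Otherwise all f j would vanish at z + c.\<close>
    have h0: "h k0 z \<noteq> 0" using fnc[of "z + c"] fj by auto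
    show "F (z + c) = F z"
      unfolding F proj_point_def
    proof (intro Collect_cong iffI; elim exE conjE)
      fix y l assume l: "l \<noteq> 0" "\<forall>j\<le>n. y j = l * f j (z + c)"
      show "\<exists>l. l \<noteq> 0 \<and> (\<forall>j\<le>n. y j = l * f j z)"
        by (rule exI[of _ "l * h k0 z"]) (use l h0 fj in auto)
    next
      fix y l assume l: "l \<noteq> 0" "\<forall>j\<le>n. y j = l * f j z"
      show "\<exists>l. l \<noteq> 0 \<and> (\<forall>j\<le>n. y j = l * f j (z + c))"
        by (rule exI[of _ "l / h k0 z"]) (use l h0 fj in auto)
    qed
  qed
qed

end
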